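(* Let $M=\{M_u\}_{u\in[0,T]}$ be a convex-valued, uniformly square-integrably bounded set-valued martingale with respect to $\mathbb F=\mathbb F^B$. Then, for each $u\in[0,T]$, $$M_u=\int_{0-}^u \mathcal R^M\circ dB\quad\text{a.s.}$$ Moreover, for each $t\in[0,u]$, it holds that $S^2_{\mathcal F_u}(M_u)=\overline{\mathrm{dec}}_{\mathcal F_u}\big(\mathcal J^t_u[\mathcal R^M_t]\big)$.
   Context: Let $(\Omega,\mathcal F,\mathbb P)$ be a complete probability space carrying a standard $m$-dimensional Brownian motion $B=\{B_t\}_{t\in[0,T]}$, $T>0$, and let $\mathbb F=\mathbb F^B=\{\mathcal F_t\}_{t\in[0,T]}$ be the natural filtration of $B$ augmented by all $\mathbb P$-null sets. Set-valued random variables. $\mathscr C(\mathbb R^d)$ is the set of nonempty closed subsets of $\mathbb R^d$. For a sub-$\sigma$-field $\mathcal G\subset\mathcal F$, a map $X:\Omega\to\mathscr C(\mathbb R^d)$ is $\mathcal G$-measurable if $\{\omega: X(\omega)\cap D\ne\emptyset\}\in\mathcal G$ for every closed $D\subset\mathbb R^d$. For $p\ge1$, $S^p_{\mathcal G}(X)$ is the set of all $f\in\mathbb L^p_{\mathcal G}(\Omega,\mathbb R^d)$ with $f\in X$ a.s., and $\mathscr A^p_{\mathcal G}(\Omega,\mathscr C(\mathbb R^d))$ is the set of $\mathcal G$-measurable $X$ (up to a.s. equality) with $S^p_{\mathcal G}(X)\neq\emptyset$. For $A\subset\mathbb R^d$, $\|A\|=\sup\{|a|:a\in A\}$. For $X\in\mathscr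 A^1_{\mathcal F}(\Omega,\mathscr C(\mathbb R^d))$, $\mathbb E[X|\mathcal G]$ is the a.s. unique element of $\mathscr A^1_{\mathcal G}(\Omega,\mathscr C(\mathbb R^d))$ with $S^1_{\mathcal G}(\mathbb E[X|\mathcal G])=\mathrm{cl}\{\mathbb E[f|\mathcal G]: f\in S^1_{\mathcal F}(X)\}$ (closure in $\mathbb L^1_{\mathcal G}(\Omega,\mathbb R^d)$). Decomposable hulls. $V\subset \mathbb L^2_{\mathcal G}(\Omega,\mathbb R^d)$ is $\mathcal G$-decomposable if $\mathbf 1_Df_1+\mathbf 1_{D^c}f_2\in V$ for all $f_1,f_2\in V$, $D\in\mathcal G$. $\overline{\mathrm{dec}}_{\mathcal G}(V)$ is the smallest closed $\mathcal G$-decomposable subset of $\mathbb L^2_{\mathcal G}(\Omega,\mathbb R^d)$ containing $V$. Every nonempty closed $\mathcal G$-decomposable $V\subset\mathbb L^2_{\mathcal G}(\Omega,\mathbb R^d)$ equals $S^2_{\mathcal G}(X)$ for a unique $X\in\mathscr A^2_{\mathcal G}(\Omega,\mathscr C(\mathbb R^d))$. Set-valued martingales. A set-valued $\mathbb F$-martingale is an $\mathbb F$-progressively measurable process $M$ with values in $\mathscr C(\mathbb R^d)$, $M_t\in\mathscr A^1_{\mathcal F_t}(\Omega,\mathscr C(\mathbb R^d))$, and $M_s=\mathbb E[M_t|\mathcal F_s]$ for $0\le s\le t\le T$. It is uniformly square-integrably bounded if there is $\ell\in\mathbb L^2(\Omega,\mathbb R_+)$ with $\sup_{t\in[0,T]}\|M_t\|\le\ell$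 a.s. $MS(M)$ is the set of all $\mathbb R^d$-valued square-integrable $\mathbb F$-martingales $y=\{y_t\}_{t\in[0,T]}$ with $y_t\in S^2_{\mathcal F_t}(M_t)$ for all $t$. The maps $\mathcal J^t$ and the sets $\mathcal R^M_t$. For $t\in[0,T]$ let $\mathbb R_t:=\mathbb L^2_{\mathcal F_t}(\Omega,\mathbb R^d)\times\mathbb L^2_{\mathbb F}([t,T]\times\Omega,\mathbb R^{d\times m})$, the second factor being the square-integrable $\mathbb F$-progressively measurable processes on $[t,T]$. For $(\xi,z)\in\mathbb R_t$ define the martingale $\mathcal J^t(\xi,z)=\{\mathcal J^t_u(\xi,z)\}_{u\in[0,T]}$ by $$\mathcal J^t_u(\xi,z):=\mathbb E[\xi|\mathcal F_u]\mathbf 1_{[0,t)}(u)+\Big(\xi+\int_t^u z_s\,dB_s\Big)\mathbf 1_{[t,T]}(u).$$ Martingales are identified up to modification. Set $\mathcal R^M_t:=\{(\xi,z)\in\mathbb R_t:\mathcal J^t(\xi,z)\in MS(M)\}$ and $\mathcal R^M:=\mathcal R^M_0$. For a map $g$ and a set $K$, $g[K]$ denotes the image. The stochastic integral. For nonempty $\mathcal R\subset\mathbb R_0$ and $t\in[0,T]$, $\int_{0-}^t\mathcal R\circ dB$ is the unique set-valued random variable in $\mathscr A^2_{\mathcal F_t}(\Omega,\mathscr C(\mathbb R^d))$ with $S^2_{\mathcal F_t}\big(\int_{0-}^t\mathcal R\circ dB\big)=\overline{\mathrm{dec}}_{\mathcal F_t}(\mathcal J^0_t[\mathcal R])$. 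*)

theory Defs
  imports "HOL-Probability.Probability"
begin

text \<open>
  Throughout, \<open>P\<close> is the complete probability space carrying the full \<sigma>-field, and a sub-\<sigma>-field
  is a measure \<open>G\<close> with \<open>subalgebra P G\<close>, of which only \<open>space G\<close> and \<open>sets G\<close> matter (integrals
  are always taken with respect to \<open>P\<close>).  Elements of the spaces of p-integrable random variables are
  functions rather than equivalence classes; all the sets of functions compared below are closed
  for the p-th mean pseudometric and hence saturated for almost sure equality.
\<close>

section \<open>Integrable random variables and conditional expectation\<close>

definition Lp :: "'a measure \<Rightarrow> 'a measure \<Rightarrow> real \<Rightarrow> ('a \<Rightarrow> 'b::euclidean_space) set" where
  "Lp P G p = {f \<in> borel_measurable G. integrable P (\<lambda>\<omega>. norm (f \<omega>) powr p)}"

text \<open>The following are meant for subsets \<open>V\<close> of \<open>Lp P G p\<close>.\<close>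

definition Lp_closure ::
  "'a measure \<Rightarrow> 'a measure \<Rightarrow> real \<Rightarrow> ('a \<Rightarrow> 'b::euclidean_space) set \<Rightarrow> ('a \<Rightarrow> 'b) set" where
  "Lp_closure P G p V =
     {f \<in> Lp P G p. \<forall>e>0. \<exists>g\<in>V. (\<integral>\<omega>. norm (f \<omega> - g \<omega>) powr p \<partial>P) < e}"

definition Lp_closed ::
  "'a measure \<Rightarrow> 'a measure \<Rightarrow> real \<Rightarrow> ('a \<Rightarrow> 'b::euclidean_space) set \<Rightarrow> bool" where
  "Lp_closed P G p V \<longleftrightarrow> V \<subseteq> Lp P G p \<and> Lp_closure P G p V \<subseteq> V"

definition vec_cond_exp ::
  "'a measure \<Rightarrow> 'a measure \<Rightarrow> ('a \<Rightarrow> real^'d) \<Rightarrow> 'a \<Rightarrow> real^'d" where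
  "vec_cond_exp P G f \<omega> = (\<chi> i. real_cond_exp P G (\<lambda>\<omega>'. f \<omega>' $ i) \<omega>)"

section \<open>Set-valued random variables\<close>

definition set_valued_rv :: "'a measure \<Rightarrow> ('a \<Rightarrow> (real^'d) set) \<Rightarrow> bool" where
  "set_valued_rv G X \<longleftrightarrow>
     (\<forall>\<omega>\<in>space G. closed (X \<omega>) \<and> X \<omega> \<noteq> {}) \<and>
     (\<forall>D. closed D \<longrightarrow> {\<omega> \<in> space G. X \<omega> \<inter> D \<noteq> {}} \<in> sets G)"

definition selections ::
  "'a measure \<Rightarrow> 'a measure \<Rightarrow> real \<Rightarrow> ('a \<Rightarrow> (real^'d) set) \<Rightarrow> ('a \<Rightarrow> real^'d) set" where
  "selections P G p X = {f \<in> Lp P G p. AE \<omega> in P. f \<omega> \<in> X \<omega>}"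

definition p_integrable_svrv ::
  "'a measure \<Rightarrow> 'a measure \<Rightarrow> real \<Rightarrow> ('a \<Rightarrow> (real^'d) set) set" where
  "p_integrable_svrv P G p = {X. set_valued_rv G X \<and> selections P G p X \<noteq> {}}"

definition set_norm :: "(real^'d) set \<Rightarrow> ereal" where
  "set_norm A = (SUP a\<in>A. ereal (norm a))"

text \<open>
  \<open>is_set_cond_exp P G X Y\<close>: \<open>Y\<close> is (a version of) the set-valued conditional expectation of \<open>X\<close>
  given \<open>G\<close>, which is defined by this property and unique up to almost sure equality.
\<close>

definition is_set_cond_exp ::
  "'a measure \<Rightarrow> 'a measure \<Rightarrow> ('a \<Rightarrow> (real^'d) set) \<Rightarrow> ('a \<Rightarrow> (real^'d) set) \<Rightarrow> bool" where
  "is_set_cond_exp P G X Y \<longleftrightarrow>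
     Y \<in> p_integrable_svrv P G 1 \<and>
     selections P G 1 Y = Lp_closure P G 1 (vec_cond_exp P G ` selections P P 1 X)"

section \<open>Decomposable hulls\<close>

definition decomposable :: "'a measure \<Rightarrow> ('a \<Rightarrow> real^'d) set \<Rightarrow> bool" where
  "decomposable G V \<longleftrightarrow>
     (\<forall>f1\<in>V. \<forall>f2\<in>V. \<forall>D\<in>sets G. (\<lambda>\<omega>. if \<omega> \<in> D then f1 \<omega> else f2 \<omega>) \<in> V)"

definition closed_dec_hull ::
  "'a measure \<Rightarrow> 'a measure \<Rightarrow> ('a \<Rightarrow> real^'d) set \<Rightarrow> ('a \<Rightarrow> real^'d) set" where
  "closed_dec_hull P G V = \<Inter>{W. V \<subseteq> W \<and> Lp_closed P G 2 W \<and> decomposable G W}"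

section \<open>Brownian motion and its augmented filtration\<close>

definition brownian_motion :: "'a measure \<Rightarrow> real \<Rightarrow> (real \<Rightarrow> 'a \<Rightarrow> real^'m) \<Rightarrow> bool" where
  "brownian_motion P T B \<longleftrightarrow>
     (\<forall>t\<in>{0..T}. B t \<in> borel_measurable P) \<and>
     (AE \<omega> in P. B 0 \<omega> = 0) \<and>
     (AE \<omega> in P. continuous_on {0..T} (\<lambda>t. B t \<omega>)) \<and>
     (\<forall>n \<tau>. (\<forall>i\<le>n. \<tau> i \<in> {0..T}) \<and> (\<forall>i<n. \<tau> i \<le> \<tau> (Suc i)) \<longrightarrow>
        prob_space.indep_vars P (\<lambda>_. borel) (\<lambda>i \<omega>. B (\<tau> (Suc i)) \<omega> - B (\<tau> i) \<omega>) {..<n::nat}) \<and>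
     (\<forall>s t. 0 \<le> s \<and> s < t \<and> t \<le> T \<longrightarrow>
        prob_space.indep_vars P (\<lambda>_. borel) (\<lambda>j \<omega>. (B t \<omega> - B s \<omega>) $ j) UNIV \<and>
        (\<forall>j. distributed P lborel (\<lambda>\<omega>. (B t \<omega> - B s \<omega>) $ j) (normal_density 0 (sqrt (t - s)))))"

definition augmented_filtration ::
  "'a measure \<Rightarrow> (real \<Rightarrow> 'a \<Rightarrow> real^'m) \<Rightarrow> real \<Rightarrow> 'a measure" where
  "augmented_filtration P B t =
     sigma (space P)
       ({B s -` A \<inter> space P | s A. s \<in> {0..t} \<and> A \<in> sets borel} \<union> null_sets P)"

section \<open>Martingales and set-valued martingales\<close>

definition sq_int_martingales ::
  "'a measure \<Rightarrow> (real \<Rightarrow> 'a measure) \<Rightarrow> real \<Rightarrow> (real \<Rightarrow> 'a \<Rightarrow> real^'d) set" where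
  "sq_int_martingales P F T =
     {y. (\<forall>t\<in>{0..T}. y t \<in> Lp P (F t) 2) \<and>
         (\<forall>s t. 0 \<le> s \<and> s \<le> t \<and> t \<le> T \<longrightarrow> (AE \<omega> in P. vec_cond_exp P (F s) (y t) \<omega> = y s \<omega>))}"

definition set_progressive ::
  "(real \<Rightarrow> 'a measure) \<Rightarrow> real \<Rightarrow> (real \<Rightarrow> 'a \<Rightarrow> (real^'d) set) \<Rightarrow> bool" where
  "set_progressive F T M \<longleftrightarrow>
     (\<forall>t\<in>{0..T}. set_valued_rv (restrict_space borel {0..t} \<Otimes>\<^sub>M F t) (\<lambda>(s, \<omega>). M s \<omega>))"

definition set_martingale ::
  "'a measure \<Rightarrow> (real \<Rightarrow> 'a measure) \<Rightarrow> real \<Rightarrow> (real \<Rightarrow> 'a \<Rightarrow> (real^'d) set) \<Rightarrow> bool" where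
  "set_martingale P F T M \<longleftrightarrow>
     set_progressive F T M \<and>
     (\<forall>t\<in>{0..T}. M t \<in> p_integrable_svrv P (F t) 1) \<and>
     (\<forall>s t. 0 \<le> s \<and> s \<le> t \<and> t \<le> T \<longrightarrow> is_set_cond_exp P (F s) (M t) (M s))"

definition unif_sq_int_bounded ::
  "'a measure \<Rightarrow> real \<Rightarrow> (real \<Rightarrow> 'a \<Rightarrow> (real^'d) set) \<Rightarrow> bool" where
  "unif_sq_int_bounded P T M \<longleftrightarrow>
     (\<exists>l :: 'a \<Rightarrow> real. l \<in> Lp P P 2 \<and> (\<forall>\<omega>\<in>space P. 0 \<le> l \<omega>) \<and>
        (AE \<omega> in P. (SUP t\<in>{0..T}. set_norm (M t \<omega>)) \<le> ereal (l \<omega>)))"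

definition martingale_selections ::
  "'a measure \<Rightarrow> (real \<Rightarrow> 'a measure) \<Rightarrow> real \<Rightarrow> (real \<Rightarrow> 'a \<Rightarrow> (real^'d) set)
    \<Rightarrow> (real \<Rightarrow> 'a \<Rightarrow> real^'d) set" where
  "martingale_selections P F T M =
     {y \<in> sq_int_martingales P F T. \<forall>t\<in>{0..T}. y t \<in> selections P (F t) 2 (M t)}"

section \<open>The Ito integral\<close>

text \<open>
  A simple integrand on \<open>[t, u]\<close> is given by a grid \<open>\<tau> 0 \<le> \<dots> \<le> \<tau> n\<close> in \<open>[t, u]\<close> and bounded
  matrix-valued random variables \<open>c i\<close>, measurable at time \<open>\<tau> i\<close>; \<open>d \<times> m\<close> matrices have type
  \<^typ>\<open>real^'m^'d\<close>, whose norm is the Frobenius norm.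
\<close>

definition simple_integrand ::
  "'a measure \<Rightarrow> (real \<Rightarrow> 'a measure) \<Rightarrow> real \<Rightarrow> real \<Rightarrow> nat \<Rightarrow> (nat \<Rightarrow> real)
    \<Rightarrow> (nat \<Rightarrow> 'a \<Rightarrow> real^'m^'d) \<Rightarrow> bool" where
  "simple_integrand P F t u n \<tau> c \<longleftrightarrow>
     (\<forall>i\<le>n. \<tau> i \<in> {t..u}) \<and> (\<forall>i<n. \<tau> i \<le> \<tau> (Suc i)) \<and>
     (\<forall>i<n. c i \<in> borel_measurable (F (\<tau> i)) \<and> bounded (c i ` space P))"

definition simple_process ::
  "nat \<Rightarrow> (nat \<Rightarrow> real) \<Rightarrow> (nat \<Rightarrow> 'a \<Rightarrow> real^'m^'d) \<Rightarrow> real \<Rightarrow> 'a \<Rightarrow> real^'m^'d" where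
  "simple_process n \<tau> c s \<omega> = (\<Sum>i<n. indicator {\<tau> i<..\<tau> (Suc i)} s *\<^sub>R c i \<omega>)"

definition simple_integral ::
  "(real \<Rightarrow> 'a \<Rightarrow> real^'m) \<Rightarrow> nat \<Rightarrow> (nat \<Rightarrow> real) \<Rightarrow> (nat \<Rightarrow> 'a \<Rightarrow> real^'m^'d) \<Rightarrow> 'a \<Rightarrow> real^'d" where
  "simple_integral B n \<tau> c \<omega> = (\<Sum>i<n. c i \<omega> *v (B (\<tau> (Suc i)) \<omega> - B (\<tau> i) \<omega>))"

definition L2_progressive ::
  "'a measure \<Rightarrow> (real \<Rightarrow> 'a measure) \<Rightarrow> real \<Rightarrow> real \<Rightarrow> (real \<Rightarrow> 'a \<Rightarrow> real^'m^'d) set" where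
  "L2_progressive P F t T =
     {z. (\<forall>u\<in>{t..T}. (\<lambda>(s, \<omega>). z s \<omega>) \<in> borel_measurable (restrict_space borel {t..u} \<Otimes>\<^sub>M F u)) \<and>
         integrable (restrict_space lborel {t..T} \<Otimes>\<^sub>M P) (\<lambda>(s, \<omega>). (norm (z s \<omega>))\<^sup>2)}"

text \<open>
  The integral of \<open>z\<close> over \<open>[t, u]\<close> is the mean-square limit of the integrals of simple integrands
  converging to \<open>z\<close> in mean square on \<open>[t, u] \<times> \<Omega>\<close>; by the isometry property it is determined up to
  almost sure equality, and \<open>ito_integral\<close> selects a version of it.
\<close>

definition is_ito_integral ::
  "'a measure \<Rightarrow> (real \<Rightarrow> 'a measure) \<Rightarrow> (real \<Rightarrow> 'a \<Rightarrow> real^'m) \<Rightarrow> real \<Rightarrow> real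
    \<Rightarrow> (real \<Rightarrow> 'a \<Rightarrow> real^'m^'d) \<Rightarrow> ('a \<Rightarrow> real^'d) \<Rightarrow> bool" where
  "is_ito_integral P F B t u z I \<longleftrightarrow>
     I \<in> Lp P (F u) 2 \<and>
     (\<exists>n \<tau> c. (\<forall>k::nat. simple_integrand P F t u (n k) (\<tau> k) (c k)) \<and>
        (\<lambda>k. \<integral>(s, \<omega>). (norm (simple_process (n k) (\<tau> k) (c k) s \<omega> - z s \<omega>))\<^sup>2
               \<partial>(restrict_space lborel {t..u} \<Otimes>\<^sub>M P)) \<longlonglongrightarrow> 0 \<and>
        (\<lambda>k. \<integral>\<omega>. (norm (simple_integral B (n k) (\<tau> k) (c k) \<omega> - I \<omega>))\<^sup>2 \<partial>P) \<longlonglongrightarrow> 0)"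

definition ito_integral ::
  "'a measure \<Rightarrow> (real \<Rightarrow> 'a measure) \<Rightarrow> (real \<Rightarrow> 'a \<Rightarrow> real^'m) \<Rightarrow> real \<Rightarrow> real
    \<Rightarrow> (real \<Rightarrow> 'a \<Rightarrow> real^'m^'d) \<Rightarrow> 'a \<Rightarrow> real^'d" where
  "ito_integral P F B t u z = (SOME I. is_ito_integral P F B t u z I)"

section \<open>The martingales \<open>J\<close> and the set-valued stochastic integral\<close>

definition R_space ::
  "'a measure \<Rightarrow> (real \<Rightarrow> 'a measure) \<Rightarrow> real \<Rightarrow> real
    \<Rightarrow> (('a \<Rightarrow> real^'d) \<times> (real \<Rightarrow> 'a \<Rightarrow> real^'m^'d)) set" where
  "R_space P F T t = Lp P (F t) 2 \<times> L2_progressive P F t T"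

fun J_mart ::
  "'a measure \<Rightarrow> (real \<Rightarrow> 'a measure) \<Rightarrow> (real \<Rightarrow> 'a \<Rightarrow> real^'m) \<Rightarrow> real
    \<Rightarrow> ('a \<Rightarrow> real^'d) \<times> (real \<Rightarrow> 'a \<Rightarrow> real^'m^'d) \<Rightarrow> real \<Rightarrow> 'a \<Rightarrow> real^'d" where
  "J_mart P F B t (\<xi>, z) u \<omega> =
     (if u < t then vec_cond_exp P (F u) \<xi> \<omega> else \<xi> \<omega> + ito_integral P F B t u z \<omega>)"

definition R_of ::
  "'a measure \<Rightarrow> (real \<Rightarrow> 'a measure) \<Rightarrow> (real \<Rightarrow> 'a \<Rightarrow> real^'m) \<Rightarrow> real
    \<Rightarrow> (real \<Rightarrow> 'a \<Rightarrow> (real^'d) set) \<Rightarrow> real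
    \<Rightarrow> (('a \<Rightarrow> real^'d) \<times> (real \<Rightarrow> 'a \<Rightarrow> real^'m^'d)) set" where
  "R_of P F B T M t =
     {p \<in> R_space P F T t. J_mart P F B t p \<in> martingale_selections P F T M}"

text \<open>
  For nonempty \<open>R \<subseteq> R_space P F T 0\<close> the set-valued random variable below exists and is unique up to
  almost sure equality; \<open>set_stoch_integral\<close> selects a version of it.
\<close>

definition set_stoch_integral ::
  "'a measure \<Rightarrow> (real \<Rightarrow> 'a measure) \<Rightarrow> (real \<Rightarrow> 'a \<Rightarrow> real^'m)
    \<Rightarrow> (('a \<Rightarrow> real^'d) \<times> (real \<Rightarrow> 'a \<Rightarrow> real^'m^'d)) set \<Rightarrow> real \<Rightarrow> 'a \<Rightarrow> (real^'d) set" where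
  "set_stoch_integral P F B R t =
     (SOME X. X \<in> p_integrable_svrv P (F t) 2 \<and>
        selections P (F t) 2 X = closed_dec_hull P (F t) ((\<lambda>p. J_mart P F B 0 p t) ` R))"

end

theory Submission
  imports Defs
begin

text \<open>
  Every selection \<open>f\<close> of \<open>M u\<close> is a limit in the mean of conditional expectations \<open>E[g | F u]\<close> of
  selections \<open>g\<close> of \<open>M T\<close>; the bound on \<open>M\<close> turns this into a limit in mean square.  The martingale
  \<open>E[g | F s]\<close> selects from \<open>M s\<close> for every \<open>s\<close>, and by martingale representation it is
  \<open>J\<close> of some pair \<open>(\<xi>, z)\<close>, so \<open>f\<close> lies even in the closure of \<open>J\<close> of \<open>R_of \<dots> t\<close>.  The converse
  inclusion holds because selections form a closed decomposable set, and two set-valued random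
  variables with the same selections agree almost surely, by selecting nearly nearest points.

  Martingale representation amounts to the density of constants plus simple integrals in \<open>L2\<close> of the
  Brownian filtration.  Their closure contains the trigonometric functions of the Brownian motion,
  these span an algebra, and its uniform closure generates the filtration, so that a Dynkin
  argument applies.
\<close>

section \<open>Square-integrable functions\<close>

text \<open>Random variables are functions here, not classes, and \<open>L2_progressive\<close> asks
  for joint measurability with respect to \<open>F u\<close> for every \<open>u\<close>. A
  mean-square limit known only up to null sets would not provide this. Hence one sequence of simple
  processes serves all \<open>u\<close> at once, and the integrand is its pointwise
  \<open>lim\<close> along one subsequence. The integrals \<open>ito_integral\<close> and
  \<open>set_stoch_integral\<close> are \<open>SOME\<close> choices, about which nothing is known
  until a witness is exhibited. The representation theorem therefore delivers a version of the Ito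
  integral for every \<open>u\<close> together with the integrand, and \<open>M u\<close> itself is
  the witness for the set-valued integral. The trigonometric algebra is closed uniformly for the
  sake of absolute values: Weierstrass' theorem puts \<open>\<bar>f\<bar>\<close> into the closure,
  hence also minima. This makes the sets where a member is positive stable under intersection, as
  the Dynkin argument requires, and lets their indicators be reached by bounded monotone
  limits.\<close>

definition L2 :: "'a measure \<Rightarrow> ('a \<Rightarrow> 'b::euclidean_space) set" where
  "L2 M = {f \<in> borel_measurable M. integrable M (\<lambda>x. (norm (f x))\<^sup>2)}"

text \<open>Working with the square of the seminorm keeps orthogonal sums additive
  (\<open>msq_sum_orthogonal\<close>); the price is the factor 2 in \<open>msq_add_le\<close>, which
  takes the place of the triangle inequality.\<close>

definition msq :: "'a measure \<Rightarrow> ('a \<Rightarrow> 'b::euclidean_space) \<Rightarrow> real" where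
  "msq M f = (\<integral>x. (norm (f x))\<^sup>2 \<partial>M)"

lemma L2_measurable: "f \<in> L2 M \<Longrightarrow> f \<in> borel_measurable M"
  and L2_integrable_sq: "f \<in> L2 M \<Longrightarrow> integrable M (\<lambda>x. (norm (f x))\<^sup>2)"
  by (auto simp: L2_def)

lemma L2I: "f \<in> borel_measurable M \<Longrightarrow> integrable M (\<lambda>x. (norm (f x))\<^sup>2) \<Longrightarrow> f \<in> L2 M"
  by (auto simp: L2_def)

lemma Lp_2_iff: "f \<in> Lp P G 2 \<longleftrightarrow> f \<in> borel_measurable G \<and> integrable P (\<lambda>x. (norm (f x))\<^sup>2)"
  by (simp add: Lp_def)

lemma Lp_1_iff: "f \<in> Lp P G 1 \<longleftrightarrow> f \<in> borel_measurable G \<and> integrable P (\<lambda>x. norm (f x))"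
  by (simp add: Lp_def)

lemma msq_nonneg [simp]: "0 \<le> msq M f"
  by (simp add: msq_def)

lemma norm_add_sq_le:
  fixes a b :: "'b::real_inner"
  shows "(norm (a + b))\<^sup>2 \<le> 2 * (norm a)\<^sup>2 + 2 * (norm b)\<^sup>2"
proof -
  have "(norm (a + b))\<^sup>2 + (norm (a - b))\<^sup>2 = 2 * (norm a)\<^sup>2 + 2 * (norm b)\<^sup>2"
    by (simp add: power2_norm_eq_inner algebra_simps inner_commute)
  then show ?thesis
    by (smt (verit) zero_le_power2)
qed

lemma L2_dominated:
  assumes "f \<in> borel_measurable M" "w \<in> L2 M" "AE x in M. norm (f x) \<le> norm (w x)"
  shows "f \<in> L2 M"
proof (rule L2I[OF assms(1)])
  show "integrable M (\<lambda>x. (norm (f x))\<^sup>2)"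
    using assms by (intro Bochner_Integration.integrable_bound[OF L2_integrable_sq[OF assms(2)]])
      (auto elim!: eventually_mono intro: power_mono)
qed

lemma L2_add:
  assumes "f \<in> L2 M" "g \<in> L2 M"
  shows "(\<lambda>x. f x + g x) \<in> L2 M"
proof (rule L2I)
  have [measurable]: "f \<in> borel_measurable M" "g \<in> borel_measurable M"
    using assms by (auto simp: L2_def)
  show "(\<lambda>x. f x + g x) \<in> borel_measurable M"
    by measurable
  have "integrable M (\<lambda>x. 2 * (norm (f x))\<^sup>2 + 2 * (norm (g x))\<^sup>2)"
    using assms by (auto simp: L2_def)
  then show "integrable M (\<lambda>x. (norm (f x + g x))\<^sup>2)"
    by (rule Bochner_Integration.integrable_bound) (auto intro!: order_trans[OF norm_add_sq_le])
qed

lemma L2_scale: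
  assumes "f \<in> L2 M"
  shows "(\<lambda>x. c *\<^sub>R f x) \<in> L2 M"
proof (rule L2I)
  have [measurable]: "f \<in> borel_measurable M"
    using assms by (auto simp: L2_def)
  show "(\<lambda>x. c *\<^sub>R f x) \<in> borel_measurable M"
    by measurable
  show "integrable M (\<lambda>x. (norm (c *\<^sub>R f x))\<^sup>2)"
    using assms by (auto simp: L2_def power_mult_distrib)
qed

lemma L2_zero [simp]: "(\<lambda>x. 0) \<in> L2 M"
  by (simp add: L2_def)

lemma L2_uminus: "f \<in> L2 M \<Longrightarrow> (\<lambda>x. - f x) \<in> L2 M"
  using L2_scale[of f M "-1"] by simp

lemma L2_diff: "f \<in> L2 M \<Longrightarrow> g \<in> L2 M \<Longrightarrow> (\<lambda>x. f x - g x) \<in> L2 M"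
  using L2_add[of f M "\<lambda>x. - g x"] L2_uminus[of g M] by simp

lemma L2_sum: "(\<And>i. i \<in> I \<Longrightarrow> f i \<in> L2 M) \<Longrightarrow> (\<lambda>x. \<Sum>i\<in>I. f i x) \<in> L2 M"
  by (induction I rule: infinite_finite_induct) (auto intro: L2_add)

lemma L2_bounded:
  assumes "finite_measure M" "f \<in> borel_measurable M" "\<And>x. x \<in> space M \<Longrightarrow> norm (f x) \<le> C"
  shows "f \<in> L2 M"
proof -
  have "(norm (f x))\<^sup>2 \<le> C\<^sup>2" if "x \<in> space M" for x
    using assms(3)[OF that] by (intro power_mono) auto
  then show ?thesis
    using assms(2)
    by (intro L2I assms finite_measure.integrable_const_bound[OF assms(1), where B="C\<^sup>2"]) auto
qed

lemma L2_inner_integrable: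
  assumes "f \<in> L2 M" "g \<in> L2 M"
  shows "integrable M (\<lambda>x. f x \<bullet> g x)"
proof -
  have [measurable]: "f \<in> borel_measurable M" "g \<in> borel_measurable M"
    using assms by (auto simp: L2_def)
  have "integrable M (\<lambda>x. (norm (f x))\<^sup>2 + (norm (g x))\<^sup>2)"
    using assms by (auto simp: L2_def)
  moreover have "\<bar>f x \<bullet> g x\<bar> \<le> (norm (f x))\<^sup>2 + (norm (g x))\<^sup>2" for x
  proof -
    have "\<bar>f x \<bullet> g x\<bar> \<le> norm (f x) * norm (g x)"
      by (rule Cauchy_Schwarz_ineq2)
    also have "\<dots> \<le> (norm (f x))\<^sup>2 + (norm (g x))\<^sup>2"
    proof -
      have "0 \<le> norm (f x) * norm (g x)" "0 \<le> (norm (f x) - norm (g x))\<^sup>2"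
        by simp_all
      then show ?thesis
        unfolding power2_diff by linarith
    qed
    finally show ?thesis .
  qed
  ultimately show ?thesis
    by (intro Bochner_Integration.integrable_bound[of M _ "\<lambda>x. f x \<bullet> g x"]) auto
qed

lemma L2_integrable:
  assumes "finite_measure M" "f \<in> L2 M"
  shows "integrable M f"
proof -
  have [measurable]: "f \<in> borel_measurable M"
    using assms by (auto simp: L2_def)
  have "integrable M (\<lambda>x. 1 + (norm (f x))\<^sup>2)"
    using assms by (auto simp: L2_def finite_measure.integrable_const)
  moreover have "norm (f x) \<le> 1 + (norm (f x))\<^sup>2" for x
    using zero_le_power2[of "norm (f x) - 1/2"] by (simp add: power2_eq_square algebra_simps)
  ultimately show ?thesis
    by (intro Bochner_Integration.integrable_bound[of M _ f]) auto
qed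

lemma borel_measurable_vec_nth [measurable]: "(\<lambda>x::real^'n. x $ i) \<in> borel_measurable borel"
  by (intro borel_measurable_continuous_onI continuous_intros)

lemma L2_vec_nth:
  fixes f :: "'a \<Rightarrow> real^'d"
  assumes "f \<in> L2 M"
  shows "(\<lambda>x. f x $ i) \<in> L2 M"
proof (rule L2_dominated[OF _ assms])
  have [measurable]: "f \<in> borel_measurable M"
    using assms by (auto simp: L2_def)
  show "(\<lambda>x. f x $ i) \<in> borel_measurable M"
    by measurable
qed (use component_le_norm_cart in auto)

lemma msq_add_le:
  assumes "f \<in> L2 M" "g \<in> L2 M"
  shows "msq M (\<lambda>x. f x + g x) \<le> 2 * msq M f + 2 * msq M g"
proof -
  have "msq M (\<lambda>x. f x + g x) \<le> (\<integral>x. 2 * (norm (f x))\<^sup>2 + 2 * (norm (g x))\<^sup>2 \<partial>M)"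
    unfolding msq_def using assms L2_add[OF assms]
    by (intro integral_mono) (auto simp: L2_def norm_add_sq_le)
  also have "\<dots> = 2 * msq M f + 2 * msq M g"
    using assms by (simp add: msq_def L2_def)
  finally show ?thesis .
qed

lemma msq_uminus [simp]: "msq M (\<lambda>x. - f x) = msq M f"
  by (simp add: msq_def)

lemma msq_minus_commute: "msq M (\<lambda>x. f x - g x) = msq M (\<lambda>x. g x - f x)"
  by (simp add: msq_def norm_minus_commute)

lemma msq_scale: "msq M (\<lambda>x. c *\<^sub>R f x) = c\<^sup>2 * msq M f"
  by (simp add: msq_def power_mult_distrib)

lemma msq_diff_le:
  assumes "f \<in> L2 M" "g \<in> L2 M"
  shows "msq M (\<lambda>x. f x - g x) \<le> 2 * msq M f + 2 * msq M g"
  using msq_add_le[OF assms(1) L2_uminus[OF assms(2)]] by simp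

lemma msq_mono:
  assumes "g \<in> L2 M" "AE x in M. norm (f x) \<le> norm (g x)"
  shows "msq M f \<le> msq M g"
proof (cases "integrable M (\<lambda>x. (norm (f x))\<^sup>2)")
  case True
  then show ?thesis
    unfolding msq_def using assms
    by (intro integral_mono_AE) (auto simp: L2_def elim!: eventually_mono intro: power_mono)
next
  case False
  then show ?thesis
    by (simp add: msq_def not_integrable_integral_eq)
qed

lemma msq_cong_AE:
  assumes "f \<in> borel_measurable M" "g \<in> borel_measurable M" "AE x in M. f x = g x"
  shows "msq M f = msq M g"
  unfolding msq_def using assms by (intro integral_cong_AE) (auto elim!: eventually_mono)

lemma msq_triangle3:
  assumes "f \<in> L2 M" "g \<in> L2 M" "h \<in> L2 M"
  shows "msq M (\<lambda>x. f x - h x) \<le> 2 * msq M (\<lambda>x. f x - g x) + 2 * msq M (\<lambda>x. g x - h x)"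
  using msq_add_le[OF L2_diff[OF assms(1,2)] L2_diff[OF assms(2,3)]] by simp

lemma msq_zero_AE:
  assumes "f \<in> L2 M" "msq M f = 0"
  shows "AE x in M. f x = 0"
proof -
  have "AE x in M. (norm (f x))\<^sup>2 = 0"
    using assms(2) integral_nonneg_eq_0_iff_AE[OF L2_integrable_sq[OF assms(1)]]
    by (simp add: msq_def)
  then show ?thesis
    by (rule eventually_mono) simp
qed

lemma msq_sum_orthogonal:
  assumes "finite I" "\<And>i. i \<in> I \<Longrightarrow> f i \<in> L2 M"
    "\<And>i j. i \<in> I \<Longrightarrow> j \<in> I \<Longrightarrow> i \<noteq> j \<Longrightarrow> (\<integral>x. f i x \<bullet> f j x \<partial>M) = 0"
  shows "msq M (\<lambda>x. \<Sum>i\<in>I. f i x) = (\<Sum>i\<in>I. msq M (f i))"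
proof -
  have "msq M (\<lambda>x. \<Sum>i\<in>I. f i x) = (\<integral>x. (\<Sum>i\<in>I. \<Sum>j\<in>I. f i x \<bullet> f j x) \<partial>M)"
    unfolding msq_def power2_norm_eq_inner by (simp only: inner_sum_left) (simp only: inner_sum_right)
  also have "\<dots> = (\<Sum>i\<in>I. \<Sum>j\<in>I. \<integral>x. f i x \<bullet> f j x \<partial>M)"
    using L2_inner_integrable[OF assms(2) assms(2)]
    by (simp add: Bochner_Integration.integral_sum Bochner_Integration.integrable_sum)
  also have "\<dots> = (\<Sum>i\<in>I. \<Sum>j\<in>I. if j = i then msq M (f i) else 0)"
    using assms(3) by (intro sum.cong) (auto simp: msq_def power2_norm_eq_inner)
  also have "\<dots> = (\<Sum>i\<in>I. msq M (f i))"
    using assms(1) by simp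
  finally show ?thesis .
qed

lemma L2_tendsto_AE_subseq:
  assumes "\<And>n. X n \<in> L2 M" "Y \<in> L2 M" "(\<lambda>n. msq M (\<lambda>x. X n x - Y x)) \<longlonglongrightarrow> 0"
  obtains r :: "nat \<Rightarrow> nat" where "strict_mono r" "AE x in M. (\<lambda>n. X (r n) x) \<longlonglongrightarrow> Y x"
proof -
  have "\<exists>r::nat\<Rightarrow>nat. strict_mono r \<and> (AE x in M. (\<lambda>n. (norm (X (r n) x - Y x))\<^sup>2) \<longlonglongrightarrow> 0)"
    using L2_integrable_sq[OF L2_diff[OF assms(1,2)]] assms(3)
    by (intro tendsto_L1_AE_subseq) (auto simp: msq_def)
  then obtain r :: "nat \<Rightarrow> nat" where r: "strict_mono r"
      "AE x in M. (\<lambda>n. (norm (X (r n) x - Y x))\<^sup>2) \<longlonglongrightarrow> 0"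
    by auto
  have "(\<lambda>n. X (r n) x) \<longlonglongrightarrow> Y x" if "(\<lambda>n. (norm (X (r n) x - Y x))\<^sup>2) \<longlonglongrightarrow> 0" for x
  proof -
    have "(\<lambda>n. sqrt ((norm (X (r n) x - Y x))\<^sup>2)) \<longlonglongrightarrow> sqrt 0"
      using that by (intro tendsto_real_sqrt)
    then show ?thesis
      by (simp add: LIM_zero_iff tendsto_norm_zero_iff)
  qed
  then show ?thesis
    using r by (intro that[of r]) (auto elim!: eventually_mono)
qed

lemma L2_dominated_convergence:
  assumes "\<And>n. X n \<in> borel_measurable M" "Y \<in> borel_measurable M" "w \<in> L2 M"
    "AE x in M. (\<lambda>n. X n x) \<longlonglongrightarrow> Y x"
    "\<And>n. AE x in M. norm (X n x) \<le> norm (w x)"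
    "AE x in M. norm (Y x) \<le> norm (w x)"
  shows "(\<lambda>n. msq M (\<lambda>x. X n x - Y x)) \<longlonglongrightarrow> 0"
proof -
  note [measurable] = assms(1,2)
  have "(\<lambda>n. \<integral>x. (norm (X n x - Y x))\<^sup>2 \<partial>M) \<longlonglongrightarrow> (\<integral>x. 0 \<partial>M)"
  proof (rule integral_dominated_convergence[where w="\<lambda>x. 4 * (norm (w x))\<^sup>2"])
    show "integrable M (\<lambda>x. 4 * (norm (w x))\<^sup>2)"
      using assms(3) by (auto simp: L2_def)
    show "AE x in M. (\<lambda>n. (norm (X n x - Y x))\<^sup>2) \<longlonglongrightarrow> 0"
      using assms(4)
    proof eventually_elim
      case (elim x)
      then have "(\<lambda>n. (norm (X n x - Y x))\<^sup>2) \<longlonglongrightarrow> (norm (Y x - Y x))\<^sup>2"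
        by (intro tendsto_intros)
      then show ?case by simp
    qed
    show "AE x in M. norm ((norm (X n x - Y x))\<^sup>2) \<le> 4 * (norm (w x))\<^sup>2" for n
      using assms(5)[of n] assms(6)
    proof eventually_elim
      case (elim x)
      then have "norm (X n x - Y x) \<le> 2 * norm (w x)"
        using norm_triangle_ineq4[of "X n x" "Y x"] by linarith
      then have "(norm (X n x - Y x))\<^sup>2 \<le> (2 * norm (w x))\<^sup>2"
        by (intro power_mono) auto
      then show ?case by (simp add: power_mult_distrib)
    qed
  qed measurable
  then show ?thesis by (simp add: msq_def)
qed

section \<open>Completeness in mean square\<close>

lemma L2_nn_integral:
  assumes "f \<in> borel_measurable M"
  shows "f \<in> L2 M \<longleftrightarrow> (\<integral>\<^sup>+x. ennreal ((norm (f x))\<^sup>2) \<partial>M) < \<infinity>"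
  using assms by (auto simp: L2_def integrable_iff_bounded)

text \<open>On a finite measure space a mean-square Cauchy sequence is Cauchy in the mean, hence has
  a subsequence converging almost everywhere; Fatou's lemma turns the Cauchy bound into a bound on
  the distance to the limit. The limit is an explicit pointwise \<open>lim\<close>, so that its
  measurability with respect to smaller sigma-fields can be read off later.\<close>

lemma L2_complete:
  fixes s :: "nat \<Rightarrow> 'a \<Rightarrow> 'b::euclidean_space"
  assumes fin: "finite_measure M" and s: "\<And>n. s n \<in> L2 M"
    and cauchy: "\<And>e. e > 0 \<Longrightarrow> \<exists>N. \<forall>i\<ge>N. \<forall>j\<ge>N. msq M (\<lambda>x. s i x - s j x) < e"
  obtains r :: "nat \<Rightarrow> nat" where "strict_mono r" "(\<lambda>x. lim (\<lambda>k. s (r k) x)) \<in> L2 M"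
    "(\<lambda>k. msq M (\<lambda>x. s (r k) x - lim (\<lambda>k. s (r k) x))) \<longlonglongrightarrow> 0"
proof -
  have [measurable]: "s n \<in> borel_measurable M" for n
    using s by (auto simp: L2_def)
  have L1: "\<exists>N. \<forall>i\<ge>N. \<forall>j\<ge>N. (LINT x|M. norm (s i x - s j x)) < e" if "e > 0" for e
  proof -
    \<comment> \<open>Young's inequality g <= d / 2 + g^2 / (2 d) bounds the mean by the mean
      square. With \<open>d = e / m\<close> the two contributions add up to at most
      \<open>m * d / 2 = e / 2\<close>; the summand 1 in \<open>m\<close> pays for the second of
      them and keeps \<open>m\<close> positive.\<close>
    define m where "m = measure M (space M) + 1"
    have "m > 0" by (simp add: m_def add_nonneg_pos)
    define d where "d = e / m"
    have "d > 0" using \<open>m > 0\<close> that by (simp add: d_def)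
    obtain N where N: "\<And>i j. i \<ge> N \<Longrightarrow> j \<ge> N \<Longrightarrow> msq M (\<lambda>x. s i x - s j x) < d * d"
      using cauchy[of "d * d"] \<open>d > 0\<close> by auto
    have "(LINT x|M. norm (s i x - s j x)) < e" if ij: "i \<ge> N" "j \<ge> N" for i j
    proof -
      let ?g = "\<lambda>x. norm (s i x - s j x)"
      have sq: "integrable M (\<lambda>x. (?g x)\<^sup>2)"
        using L2_diff[OF s s] by (rule L2_integrable_sq)
      have "(LINT x|M. ?g x) \<le> (LINT x|M. d / 2 + (?g x)\<^sup>2 / (2 * d))"
      proof (rule integral_mono)
        show "integrable M ?g"
          using L2_integrable[OF fin L2_diff[OF s s]] by (rule integrable_norm)
        show "integrable M (\<lambda>x. d / 2 + (?g x)\<^sup>2 / (2 * d))"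
          using sq by (auto intro!: finite_measure.integrable_const[OF fin])
        fix x
        have "0 \<le> (?g x - d)\<^sup>2" by simp
        then show "?g x \<le> d / 2 + (?g x)\<^sup>2 / (2 * d)"
          using \<open>d > 0\<close> by (simp add: field_simps power2_eq_square)
      qed
      also have "\<dots> = measure M (space M) * (d / 2) + msq M (\<lambda>x. s i x - s j x) / (2 * d)"
        using sq by (subst Bochner_Integration.integral_add)
          (auto simp: msq_def intro!: finite_measure.integrable_const[OF fin])
      also have "\<dots> \<le> measure M (space M) * (d / 2) + d / 2"
        using N[OF ij] \<open>d > 0\<close> by (simp add: field_simps)
      also have "\<dots> = m * d / 2"
        by (simp add: m_def field_simps)
      also have "\<dots> < e"
        using \<open>m > 0\<close> \<open>e > 0\<close> by (simp add: d_def)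
      finally show ?thesis .
    qed
    then show ?thesis by blast
  qed
  obtain r where r: "strict_mono r" "AE x in M. Cauchy (\<lambda>i. s (r i) x)"
    using cauchy_L1_AE_cauchy_subseq[OF L2_integrable[OF fin s] L1] by blast
  define z where "z x = lim (\<lambda>k. s (r k) x)" for x
  have [measurable]: "z \<in> borel_measurable M"
    unfolding z_def by measurable
  have conv: "AE x in M. (\<lambda>k. s (r k) x) \<longlonglongrightarrow> z x"
    using r(2) by eventually_elim (auto simp: z_def dest!: Cauchy_convergent convergent_LIMSEQ_iff[THEN iffD1])
  have bound: "\<exists>N. \<forall>k\<ge>N. (\<integral>\<^sup>+x. ennreal ((norm (s (r k) x - z x))\<^sup>2) \<partial>M) \<le> ennreal e" if e: "e > 0" for e
  proof -
    obtain N where N: "\<And>i j. i \<ge> N \<Longrightarrow> j \<ge> N \<Longrightarrow> msq M (\<lambda>x. s i x - s j x) < e"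
      using cauchy[OF e] by blast
    have "(\<integral>\<^sup>+x. ennreal ((norm (s (r k) x - z x))\<^sup>2) \<partial>M) \<le> ennreal e" if "k \<ge> N" for k
    proof -
      have "(\<integral>\<^sup>+x. ennreal ((norm (s (r k) x - z x))\<^sup>2) \<partial>M)
          = (\<integral>\<^sup>+x. liminf (\<lambda>j. ennreal ((norm (s (r k) x - s (r j) x))\<^sup>2)) \<partial>M)"
      proof (rule nn_integral_cong_AE)
        show "AE x in M. ennreal ((norm (s (r k) x - z x))\<^sup>2)
            = liminf (\<lambda>j. ennreal ((norm (s (r k) x - s (r j) x))\<^sup>2))"
          using conv
        proof eventually_elim
          case (elim x)
          have "(\<lambda>j. ennreal ((norm (s (r k) x - s (r j) x))\<^sup>2))
              \<longlonglongrightarrow> ennreal ((norm (s (r k) x - z x))\<^sup>2)"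
            using elim by (intro tendsto_intros)
          then show ?case
            using lim_imp_Liminf[OF sequentially_bot] by metis
        qed
      qed
      also have "\<dots> \<le> liminf (\<lambda>j. \<integral>\<^sup>+x. ennreal ((norm (s (r k) x - s (r j) x))\<^sup>2) \<partial>M)"
        by (rule nn_integral_liminf) measurable
      also have "\<dots> \<le> ennreal e"
      proof (rule Liminf_le)
        show "\<forall>\<^sub>F j in sequentially. (\<integral>\<^sup>+x. ennreal ((norm (s (r k) x - s (r j) x))\<^sup>2) \<partial>M) \<le> ennreal e"
          using eventually_ge_at_top[of N]
        proof eventually_elim
          case (elim j)
          have "r k \<ge> N" "r j \<ge> N"
            using \<open>k \<ge> N\<close> elim seq_suble[OF r(1)] le_trans by blast+
          then have "msq M (\<lambda>x. s (r k) x - s (r j) x) \<le> e"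
            using N by (simp add: less_imp_le)
          moreover have "(\<integral>\<^sup>+x. ennreal ((norm (s (r k) x - s (r j) x))\<^sup>2) \<partial>M)
              = ennreal (msq M (\<lambda>x. s (r k) x - s (r j) x))"
            unfolding msq_def using L2_integrable_sq[OF L2_diff[OF s s]]
            by (intro nn_integral_eq_integral) auto
          ultimately show ?case
            by (simp add: ennreal_leI)
        qed
      qed simp
      finally show ?thesis .
    qed
    then show ?thesis by blast
  qed
  have diff: "\<exists>N. \<forall>k\<ge>N. (\<lambda>x. s (r k) x - z x) \<in> L2 M \<and> msq M (\<lambda>x. s (r k) x - z x) \<le> e" if e: "e > 0" for e
  proof -
    obtain N where N: "\<And>k. k \<ge> N \<Longrightarrow> (\<integral>\<^sup>+x. ennreal ((norm (s (r k) x - z x))\<^sup>2) \<partial>M) \<le> ennreal e"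
      using bound[OF e] by auto
    have "(\<lambda>x. s (r k) x - z x) \<in> L2 M \<and> msq M (\<lambda>x. s (r k) x - z x) \<le> e" if "k \<ge> N" for k
    proof
      show *: "(\<lambda>x. s (r k) x - z x) \<in> L2 M"
        using N[OF that] by (subst L2_nn_integral) (auto simp: less_top[symmetric] top_unique)
      have "ennreal (msq M (\<lambda>x. s (r k) x - z x)) \<le> ennreal e"
        using N[OF that] L2_integrable_sq[OF *]
        unfolding msq_def by (subst nn_integral_eq_integral[symmetric]) auto
      then show "msq M (\<lambda>x. s (r k) x - z x) \<le> e"
        using \<open>e > 0\<close> by (simp add: ennreal_le_iff)
    qed
    then show ?thesis by blast
  qed
  show ?thesis
  proof (rule that[OF r(1)])
    obtain N where "(\<lambda>x. s (r N) x - z x) \<in> L2 M"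
      using diff[of 1] by auto
    \<comment> \<open>The limit is \<open>s (r N)\<close> minus \<open>s (r N) - z\<close>, and both
      are square-integrable.\<close>
    from L2_diff[OF s[of "r N"] this]
    show "(\<lambda>x. lim (\<lambda>k. s (r k) x)) \<in> L2 M"
      by (simp add: z_def[symmetric])
    show "(\<lambda>k. msq M (\<lambda>x. s (r k) x - lim (\<lambda>k. s (r k) x))) \<longlonglongrightarrow> 0"
      unfolding z_def[symmetric]
    proof (rule LIMSEQ_I)
      fix e :: real assume "e > 0"
      then obtain N where "\<forall>k\<ge>N. msq M (\<lambda>x. s (r k) x - z x) \<le> e / 2"
        using diff[of "e / 2"] by auto
      then have "\<forall>k\<ge>N. norm (msq M (\<lambda>x. s (r k) x - z x) - 0) < e"
        using \<open>e > 0\<close> by (auto intro: le_less_trans)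
      then show "\<exists>N. \<forall>k\<ge>N. norm (msq M (\<lambda>x. s (r k) x - z x) - 0) < e"
        by blast
    qed
  qed
qed

section \<open>Brownian increments and the augmented filtration\<close>

locale brownian = prob_space P for P :: "'a measure" +
  fixes T :: real and B :: "real \<Rightarrow> 'a \<Rightarrow> real^'m" and F :: "real \<Rightarrow> 'a measure"
  assumes bm: "brownian_motion P T B"
    and F_eq: "F = augmented_filtration P B"
    and T_pos: "0 < T"
begin

abbreviation Fgen :: "real \<Rightarrow> 'a set set" where
  "Fgen t \<equiv> {B s -` A \<inter> space P | s A. s \<in> {0..t} \<and> A \<in> sets borel} \<union> null_sets P"

lemma B_measurable: "0 \<le> t \<Longrightarrow> t \<le> T \<Longrightarrow> B t \<in> borel_measurable P"
  using bm by (auto simp: brownian_motion_def)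

lemma B_0: "AE \<omega> in P. B 0 \<omega> = 0"
  using bm by (auto simp: brownian_motion_def)

lemma Fgen_subset_Pow: "Fgen t \<subseteq> Pow (space P)"
  by (auto dest: sets.sets_into_space)

lemma space_F [simp]: "space (F t) = space P"
  by (simp add: F_eq augmented_filtration_def space_measure_of_conv)

lemma sets_F: "sets (F t) = sigma_sets (space P) (Fgen t)"
  unfolding F_eq augmented_filtration_def by (rule sets_measure_of[OF Fgen_subset_Pow])

lemma sets_F_mono: "s \<le> t \<Longrightarrow> sets (F s) \<subseteq> sets (F t)"
  unfolding sets_F by (intro sigma_sets_mono') (fastforce intro: order_trans)

lemma sets_F_subset:
  assumes "t \<le> T"
  shows "sets (F t) \<subseteq> sets P"
  unfolding sets_F using B_measurable assms
  by (intro sets.sigma_sets_subset) (auto simp: in_borel_measurable_borel)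

lemma subalgebra_F: "t \<le> T \<Longrightarrow> subalgebra P (F t)"
  by (simp add: subalgebra_def sets_F_subset)

lemma subalgebra_F_F: "s \<le> t \<Longrightarrow> subalgebra (F t) (F s)"
  by (simp add: subalgebra_def sets_F_mono)

lemma measurable_F_mono: "f \<in> borel_measurable (F s) \<Longrightarrow> s \<le> t \<Longrightarrow> f \<in> borel_measurable (F t)"
  by (rule measurable_from_subalg[OF subalgebra_F_F])

lemma measurable_F_P: "f \<in> borel_measurable (F s) \<Longrightarrow> s \<le> T \<Longrightarrow> f \<in> borel_measurable P"
  by (rule measurable_from_subalg[OF subalgebra_F])

lemma sigma_finite_F: "t \<le> T \<Longrightarrow> sigma_finite_subalgebra P (F t)"
  by (intro finite_measure_subalgebra_is_sigma_finite)
    (simp add: finite_measure_subalgebra_def finite_measure_subalgebra_axioms_def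
      subalgebra_F finite_measure_axioms)

lemma B_adapted: "0 \<le> s \<Longrightarrow> s \<le> t \<Longrightarrow> B s \<in> borel_measurable (F t)"
  by (rule measurableI) (auto simp: sets_F intro!: sigma_sets.Basic)

section \<open>Independence of increments from the past\<close>

definition rect :: "real set \<Rightarrow> (real \<Rightarrow> (real^'m) set) \<Rightarrow> 'a set" where
  "rect J C = {\<omega>\<in>space P. \<forall>r\<in>J. B r \<omega> \<in> C r}"

lemma rect_sets:
  assumes "finite J" "J \<subseteq> {0..T}" "\<And>r. r \<in> J \<Longrightarrow> C r \<in> sets borel"
  shows "rect J C \<in> sets P"
proof -
  have "rect J C = space P \<inter> (\<Inter>r\<in>J. B r -` C r \<inter> space P)" if "J \<noteq> {}"
    using that by (auto simp: rect_def)
  moreover have "(\<Inter>r\<in>J. B r -` C r \<inter> space P) \<in> sets P" if "J \<noteq> {}"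
    using assms that by (intro sets.finite_INT measurable_sets[OF B_measurable]) auto
  ultimately show ?thesis
    by (cases "J = {}") (auto simp: rect_def)
qed

text \<open>Independence is given for increments along one grid, so a cylinder event over
  \<open>J\<close> has to be expressed through increments: on a grid from 0 through the points of
  \<open>J\<close> to \<open>s\<close>, each value of \<open>B\<close> is a partial sum of
  increments, and \<open>B t - B s\<close> is one further increment, independent of all of
  those.\<close>

lemma prob_rect_increment:
  assumes J: "finite J" "J \<subseteq> {0..s}" and C: "\<And>r. r \<in> J \<Longrightarrow> C r \<in> sets borel"
    and st: "0 \<le> s" "s \<le> t" "t \<le> T" and E: "E \<in> sets borel"
  shows "prob (rect J C \<inter> ((\<lambda>\<omega>. B t \<omega> - B s \<omega>) -` E \<inter> space P))
    = prob (rect J C) * prob ((\<lambda>\<omega>. B t \<omega> - B s \<omega>) -` E \<inter> space P)"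
proof -
  \<comment> \<open>Inserting 0 and \<open>s\<close> makes the grid start at 0 and end at
    \<open>s\<close>; the point of index \<open>Suc N\<close> is then \<open>t\<close>. For
    \<open>s = t\<close> the last step has length 0, which weakly increasing grids permit.\<close>
  define xs where "xs = sorted_list_of_set (insert 0 (insert s J))"
  define N where "N = length xs - 1"
  define \<tau> where "\<tau> i = (if i \<le> N then xs ! i else t)" for i
  define D where "D i \<omega> = B (\<tau> (Suc i)) \<omega> - B (\<tau> i) \<omega>" for i \<omega>
  have fin: "finite (insert 0 (insert s J))"
    using J by simp
  have set_xs: "set xs = insert 0 (insert s J)" and srt: "sorted xs"
    unfolding xs_def using fin by (simp_all only: set_sorted_list_of_set sorted_sorted_list_of_set)
  have len: "length xs = Suc N"
    using set_xs by (cases xs) (auto simp: N_def)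
  have range: "0 \<le> xs ! i" "xs ! i \<le> s" if "i \<le> N" for i
    using nth_mem[of i xs] that set_xs J st len by auto
  have xs_0: "xs ! 0 = 0"
  proof -
    obtain i where i: "i \<le> N" "xs ! i = 0"
      using set_xs len by (metis in_set_conv_nth insertCI less_Suc_eq_le)
    then have "xs ! 0 \<le> xs ! i"
      using srt len by (intro sorted_nth_mono) auto
    then show ?thesis
      using i range[of 0] by auto
  qed
  have xs_N: "xs ! N = s"
  proof -
    obtain i where i: "i \<le> N" "xs ! i = s"
      using set_xs len by (metis in_set_conv_nth insertCI less_Suc_eq_le)
    then have "xs ! i \<le> xs ! N"
      using srt len by (intro sorted_nth_mono) auto
    then show ?thesis
      using i range[of N] by auto
  qed
  have "\<forall>r\<in>J. \<exists>k\<le>N. xs ! k = r"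
    using set_xs len by (metis in_set_conv_nth insertCI less_Suc_eq_le)
  then obtain k where k: "\<And>r. r \<in> J \<Longrightarrow> k r \<le> N \<and> xs ! k r = r"
    by metis
  have "\<forall>i\<le>Suc N. \<tau> i \<in> {0..T}"
    using range(1) order_trans[OF range(2) order_trans[OF st(2,3)]] st by (auto simp: \<tau>_def)
  moreover have "\<forall>i<Suc N. \<tau> i \<le> \<tau> (Suc i)"
    using range(1) order_trans[OF range(2) st(2)] st srt len by (auto simp: \<tau>_def intro: sorted_nth_mono)
  ultimately have "indep_vars (\<lambda>_. borel) D {..<Suc N}"
    using bm unfolding brownian_motion_def D_def by blast
  \<comment> \<open>The increments are grouped into the block of the past, with indices below
    \<open>N\<close>, and the single index \<open>N\<close>.\<close>
  then have ind: "indep_var (PiM {..<N} (\<lambda>_. borel)) (\<lambda>\<omega>. restrict (\<lambda>i. D i \<omega>) {..<N})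
      (PiM {N} (\<lambda>_. borel)) (\<lambda>\<omega>. restrict (\<lambda>i. D i \<omega>) {N})"
    by (rule indep_var_restrict) auto
  define Z1 where "Z1 f \<longleftrightarrow> (\<forall>r\<in>J. (\<Sum>i<k r. f i) \<in> C r)" for f :: "nat \<Rightarrow> real^'m"
  define Z2 where "Z2 f \<longleftrightarrow> f N \<in> E" for f :: "nat \<Rightarrow> real^'m"
  have Z1: "Z1 \<in> measurable (PiM {..<N} (\<lambda>_. borel)) (count_space UNIV)"
    unfolding Z1_def
  proof (intro pred_intros_finite(3) J)
    fix r assume r: "r \<in> J"
    have "(\<lambda>f. \<Sum>i<k r. f i) \<in> borel_measurable (PiM {..<N} (\<lambda>_. borel :: (real^'m) measure))"
      using k[OF r] by (intro borel_measurable_sum measurable_component_singleton) auto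
    from measurable_sets[OF this C[OF r]]
    show "Measurable.pred (PiM {..<N} (\<lambda>_. borel)) (\<lambda>f. (\<Sum>i<k r. f i) \<in> C r)"
      by (simp add: pred_def vimage_def Int_def conj_commute)
  qed
  have Z2: "Z2 \<in> measurable (PiM {N} (\<lambda>_. borel)) (count_space UNIV)"
    unfolding Z2_def using E by measurable
  let ?Y = "(\<lambda>\<omega>. B t \<omega> - B s \<omega>) -` E \<inter> space P"
  \<comment> \<open>Sums of increments give \<open>B r - B 0\<close> rather than \<open>B r\<close>,
    so the product rule is first shown for this variant of the cylinder; \<open>B 0 = 0\<close>
    almost surely identifies the two events up to null sets.\<close>
  let ?R = "{\<omega> \<in> space P. \<forall>r\<in>J. B r \<omega> - B 0 \<omega> \<in> C r}"
  have tel: "(\<Sum>i<k r. D i \<omega>) = B r \<omega> - B 0 \<omega>" if "r \<in> J" for r \<omega>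
    unfolding D_def using sum_lessThan_telescope[of "\<lambda>i. B (\<tau> i) \<omega>" "k r"] k[OF that] xs_0
    by (simp add: \<tau>_def)
  have DN: "D N \<omega> = B t \<omega> - B s \<omega>" for \<omega>
    by (simp add: D_def \<tau>_def xs_N)
  have Z1_eq: "Z1 (restrict (\<lambda>i. D i \<omega>) {..<N}) \<longleftrightarrow> (\<forall>r\<in>J. B r \<omega> - B 0 \<omega> \<in> C r)" for \<omega>
  proof -
    have "(\<Sum>i<k r. restrict (\<lambda>i. D i \<omega>) {..<N} i) = B r \<omega> - B 0 \<omega>" if "r \<in> J" for r
      using k[OF that] by (subst tel[OF that, symmetric], intro sum.cong) auto
    then show ?thesis
      by (simp add: Z1_def)
  qed
  define U1 where "U1 = Z1 \<circ> (\<lambda>\<omega>. restrict (\<lambda>i. D i \<omega>) {..<N})"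
  define U2 where "U2 = Z2 \<circ> (\<lambda>\<omega>. restrict (\<lambda>i. D i \<omega>) {N})"
  have U1: "U1 \<omega> \<longleftrightarrow> (\<forall>r\<in>J. B r \<omega> - B 0 \<omega> \<in> C r)" for \<omega>
    by (simp add: U1_def Z1_eq)
  have U2: "U2 \<omega> \<longleftrightarrow> B t \<omega> - B s \<omega> \<in> E" for \<omega>
    by (simp add: U2_def Z2_def DN)
  have "prob ((\<lambda>\<omega>. (U1 \<omega>, U2 \<omega>)) -` ({True} \<times> {True}) \<inter> space P)
      = prob (U1 -` {True} \<inter> space P) * prob (U2 -` {True} \<inter> space P)"
    unfolding U1_def U2_def by (rule indep_varD[OF indep_var_compose[OF ind Z1 Z2]]) auto
  moreover have "(\<lambda>\<omega>. (U1 \<omega>, U2 \<omega>)) -` ({True} \<times> {True}) \<inter> space P = ?R \<inter> ?Y"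
    unfolding U1 U2 by blast
  moreover have "U1 -` {True} \<inter> space P = ?R"
    unfolding U1 by blast
  moreover have "U2 -` {True} \<inter> space P = ?Y"
    unfolding U2 by blast
  ultimately have main: "prob (?R \<inter> ?Y) = prob ?R * prob ?Y"
    by simp
  have [measurable]: "B s \<in> borel_measurable P" "B t \<in> borel_measurable P"
      "B 0 \<in> borel_measurable P"
    using st by (auto intro!: B_measurable)
  have Y: "?Y \<in> sets P"
    using E by measurable
  have R: "?R \<in> sets P"
  proof -
    have "Measurable.pred P (\<lambda>\<omega>. \<forall>r\<in>J. B r \<omega> - B 0 \<omega> \<in> C r)"
    proof (intro pred_intros_finite(3) J)
      fix r assume r: "r \<in> J"
      then have [measurable]: "B r \<in> borel_measurable P" "C r \<in> sets borel"
        using J st C by (auto intro!: B_measurable)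
      show "Measurable.pred P (\<lambda>\<omega>. B r \<omega> - B 0 \<omega> \<in> C r)"
        by measurable
    qed
    then show ?thesis by (simp add: pred_def)
  qed
  have rect: "rect J C \<in> sets P"
    using J C st by (intro rect_sets) auto
  have "prob (rect J C \<inter> ?Y) = prob (?R \<inter> ?Y)"
    using B_0 rect Y R by (intro finite_measure_eq_AE) (auto simp: rect_def elim!: eventually_mono)
  moreover have "prob (rect J C) = prob ?R"
    using B_0 rect Y R by (intro finite_measure_eq_AE) (auto simp: rect_def elim!: eventually_mono)
  ultimately show ?thesis
    using main by simp
qed

text \<open>A pi-system argument. Null sets are independent of everything, and a null set
  intersected with a measurable set is null, so adding the null sets to the cylinders up to
  \<open>s\<close> keeps the family intersection-stable. This is why augmenting the filtration does
  not spoil independence.\<close>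

lemma indep_set_F_increment:
  assumes st: "0 \<le> s" "s \<le> t" "t \<le> T"
  shows "indep_set (sets (F s)) {(\<lambda>\<omega>. B t \<omega> - B s \<omega>) -` A \<inter> space P | A. A \<in> sets borel}"
proof -
  define Y where "Y \<omega> = B t \<omega> - B s \<omega>" for \<omega>
  have Y [measurable]: "Y \<in> borel_measurable P"
    unfolding Y_def using st by (intro borel_measurable_diff B_measurable) auto
  let ?Y = "{Y -` A \<inter> space P | A. A \<in> sets borel}"
  define R where "R = {rect J C | J C. finite J \<and> J \<subseteq> {0..s} \<and> (\<forall>r\<in>J. C r \<in> sets borel)}"
  let ?G = "R \<union> null_sets P"
  have R_sets: "R \<subseteq> sets P"
    using st by (auto simp: R_def intro!: rect_sets)
  have "indep_set ?G ?Y"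
  proof (rule indep_setI)
    fix a b assume a: "a \<in> ?G" and b: "b \<in> ?Y"
    then obtain E where E: "E \<in> sets borel" "b = Y -` E \<inter> space P"
      by auto
    then have bP: "b \<in> sets P"
      by auto
    show "prob (a \<inter> b) = prob a * prob b"
    proof (cases "a \<in> R")
      case True
      then show ?thesis
        unfolding R_def E(2) Y_def using prob_rect_increment[OF _ _ _ st E(1)] by blast
    next
      case False
      then have "a \<in> null_sets P"
        using a by simp
      then have "a \<inter> b \<in> null_sets P"
        using bP by (rule null_set_Int2)
      then show ?thesis
        using \<open>a \<in> null_sets P\<close> by (simp add: measure_def null_setsD1)
    qed
  qed (use R_sets in auto)
  moreover have "Int_stable ?G"
  proof (rule Int_stableI)
    fix a b assume ab: "a \<in> ?G" "b \<in> ?G"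
    have sets: "a \<in> sets P" "b \<in> sets P"
      using ab R_sets by auto
    show "a \<inter> b \<in> ?G"
    proof (cases "a \<in> R \<and> b \<in> R")
      case True
      then obtain J C J' C' where *: "a = rect J C" "finite J" "J \<subseteq> {0..s}" "\<forall>r\<in>J. C r \<in> sets borel"
          "b = rect J' C'" "finite J'" "J' \<subseteq> {0..s}" "\<forall>r\<in>J'. C' r \<in> sets borel"
        unfolding R_def by blast
      define C'' where "C'' r = (if r \<in> J then C r else UNIV) \<inter> (if r \<in> J' then C' r else UNIV)" for r
      have "a \<inter> b = rect (J \<union> J') C''"
        unfolding *(1,5) rect_def C''_def by (auto split: if_splits)
      moreover have "\<forall>r\<in>J \<union> J'. C'' r \<in> sets borel"
        using *(4,8) unfolding C''_def by (intro ballI sets.Int) auto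
      ultimately have "a \<inter> b \<in> R"
        unfolding R_def using * by blast
      then show ?thesis by simp
    next
      case False
      then show ?thesis
        using ab sets by (auto intro: null_set_Int1 null_set_Int2)
    qed
  qed
  moreover have "Int_stable ?Y"
  proof (rule Int_stableI, clarify)
    fix A A' :: "(real^'m) set" assume "A \<in> sets borel" "A' \<in> sets borel"
    then show "\<exists>A''. Y -` A \<inter> space P \<inter> (Y -` A' \<inter> space P) = Y -` A'' \<inter> space P \<and> A'' \<in> sets borel"
      by (intro exI[of _ "A \<inter> A'"]) auto
  qed
  ultimately have ind: "indep_set (sigma_sets (space P) ?G) (sigma_sets (space P) ?Y)"
    by (rule indep_set_sigma_sets)
  have "Fgen s \<subseteq> ?G"
  proof -
    have "B r -` A \<inter> space P \<in> R" if "r \<in> {0..s}" "A \<in> sets borel" for r A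
      unfolding R_def using that
      by (intro CollectI exI[of _ "{r}"] exI[of _ "\<lambda>_. A"]) (auto simp: rect_def)
    then show ?thesis by auto
  qed
  then have "sets (F s) \<subseteq> sigma_sets (space P) ?G"
    unfolding sets_F by (rule sigma_sets_mono')
  moreover have "?Y \<subseteq> sigma_sets (space P) ?Y"
    by (auto intro: sigma_sets.Basic)
  ultimately have "indep_set (sets (F s)) ?Y"
    unfolding indep_set_def
    by (intro indep_sets_mono_sets[OF ind[unfolded indep_set_def]]) (simp split: bool.split)
  then show ?thesis
    by (simp add: Y_def[abs_def])
qed

lemma indep_var_F_increment:
  fixes V :: "'a \<Rightarrow> 'b::topological_space"
  assumes st: "0 \<le> s" "s \<le> t" "t \<le> T" and V: "V \<in> borel_measurable (F s)"
    and g: "g \<in> borel_measurable borel"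
  shows "indep_var borel V borel (\<lambda>\<omega>. g (B t \<omega> - B s \<omega>))"
proof -
  define Y where "Y \<omega> = B t \<omega> - B s \<omega>" for \<omega>
  have Y [measurable]: "Y \<in> borel_measurable P"
    unfolding Y_def using st by (intro borel_measurable_diff B_measurable) auto
  have gY: "(\<lambda>\<omega>. g (Y \<omega>)) \<in> borel_measurable P"
    using g by measurable
  have sets: "sigma_sets (space P) {V -` A \<inter> space P |A. A \<in> sets borel} \<subseteq> sets (F s)"
    using measurable_sets[OF V] sets.sigma_sets_subset[of "{V -` A \<inter> space P |A. A \<in> sets borel}" "F s"]
    by auto
  have Ys: "sigma_sets (space P) {Y -` A \<inter> space P |A. A \<in> sets borel} = {Y -` A \<inter> space P |A. A \<in> sets borel}"
    using sigma_sets_vimage_commute[of Y "space P" UNIV "sets borel"]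
      sets.sigma_sets_eq[of "borel :: (real^'m) measure"] by simp
  have "{(\<lambda>\<omega>. g (Y \<omega>)) -` A \<inter> space P |A. A \<in> sets borel} \<subseteq> {Y -` A \<inter> space P |A. A \<in> sets borel}"
  proof clarify
    fix A :: "'b set" assume "A \<in> sets borel"
    then have "g -` A \<in> sets borel"
      using measurable_sets[OF g] by simp
    then show "\<exists>A'. (\<lambda>\<omega>. g (Y \<omega>)) -` A \<inter> space P = Y -` A' \<inter> space P \<and> A' \<in> sets borel"
      by (intro exI[of _ "g -` A"]) auto
  qed
  then have sub: "sigma_sets (space P) {(\<lambda>\<omega>. g (Y \<omega>)) -` A \<inter> space P |A. A \<in> sets borel}
      \<subseteq> {Y -` A \<inter> space P |A. A \<in> sets borel}"
    using sigma_sets_mono'[of _ "{Y -` A \<inter> space P |A. A \<in> sets borel}" "space P"] unfolding Ys by blast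
  have "indep_set (sigma_sets (space P) {V -` A \<inter> space P |A. A \<in> sets borel})
      (sigma_sets (space P) {(\<lambda>\<omega>. g (Y \<omega>)) -` A \<inter> space P |A. A \<in> sets borel})"
    using indep_set_F_increment[OF st] sets sub unfolding indep_set_def Y_def
    by (elim indep_sets_mono_sets) (simp split: bool.split)
  then show ?thesis
    using measurable_F_P[OF V] st gY unfolding indep_var_eq by (auto simp: Y_def)
qed

text \<open>Values in a normed field cover both the real coordinates in the isometry and the complex
  exponentials in the density argument.\<close>

lemma
  fixes V :: "'a \<Rightarrow> 'b::{real_normed_field, banach, second_countable_topology}"
  assumes st: "0 \<le> s" "s \<le> t" "t \<le> T" and V: "V \<in> borel_measurable (F s)" "integrable P V"
    and g: "g \<in> borel_measurable borel" "integrable P (\<lambda>\<omega>. g (B t \<omega> - B s \<omega>))"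
  shows integrable_F_increment: "integrable P (\<lambda>\<omega>. V \<omega> * g (B t \<omega> - B s \<omega>))"
    and integral_F_increment: "(\<integral>\<omega>. V \<omega> * g (B t \<omega> - B s \<omega>) \<partial>P)
      = (\<integral>\<omega>. V \<omega> \<partial>P) * (\<integral>\<omega>. g (B t \<omega> - B s \<omega>) \<partial>P)"
  using indep_var_integrable[OF indep_var_F_increment[OF st V(1) g(1)] V(2) g(2)]
    indep_var_lebesgue_integral[OF indep_var_F_increment[OF st V(1) g(1)] V(2) g(2)] by auto

section \<open>Moments of the increments up to order four\<close>

lemma
  assumes st: "0 \<le> s" "s \<le> t" "t \<le> T"
  shows integrable_increment: "integrable P (\<lambda>\<omega>. (B t \<omega> - B s \<omega>) $ j)"
    and integral_increment: "(\<integral>\<omega>. (B t \<omega> - B s \<omega>) $ j \<partial>P) = 0"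
    and integrable_increment_sq: "integrable P (\<lambda>\<omega>. ((B t \<omega> - B s \<omega>) $ j)\<^sup>2)"
    and integral_increment_sq: "(\<integral>\<omega>. ((B t \<omega> - B s \<omega>) $ j)\<^sup>2 \<partial>P) = t - s"
    and integrable_increment_4: "integrable P (\<lambda>\<omega>. ((B t \<omega> - B s \<omega>) $ j) ^ 4)"
    and integral_increment_4: "(\<integral>\<omega>. ((B t \<omega> - B s \<omega>) $ j) ^ 4 \<partial>P) = 3 * (t - s)\<^sup>2"
proof -
  let ?X = "\<lambda>\<omega>. (B t \<omega> - B s \<omega>) $ j"
  have "integrable P ?X \<and> (\<integral>\<omega>. ?X \<omega> \<partial>P) = 0 \<and> integrable P (\<lambda>\<omega>. (?X \<omega>)\<^sup>2) \<and> (\<integral>\<omega>. (?X \<omega>)\<^sup>2 \<partial>P) = t - s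
      \<and> integrable P (\<lambda>\<omega>. ?X \<omega> ^ 4) \<and> (\<integral>\<omega>. ?X \<omega> ^ 4 \<partial>P) = 3 * (t - s)\<^sup>2"
  \<comment> \<open>The normal density is prescribed only for \<open>s < t\<close>; for
    \<open>s = t\<close> the increment vanishes identically and all six claims are trivial.\<close>
  proof (cases "s = t")
    case False
    let ?d = "normal_density 0 (sqrt (t - s))"
    have pos: "0 < sqrt (t - s)"
      using st False by simp
    have D: "distributed P lborel ?X ?d"
      using bm st False unfolding brownian_motion_def by (auto simp: less_le)
    have int: "integrable P (\<lambda>\<omega>. g (?X \<omega>)) \<and> (\<integral>\<omega>. g (?X \<omega>) \<partial>P) = c"
      if "g \<in> borel_measurable borel" "has_bochner_integral lborel (\<lambda>x. ?d x * g x) c" for g :: "real \<Rightarrow> real" and c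
      using distributed_integrable[OF D, of g] distributed_integral[OF D, of g] that
      by (auto simp: has_bochner_integral_iff)
    have 1: "has_bochner_integral lborel (\<lambda>x. ?d x * x) 0"
      using normal_moment_odd[OF pos, of 0 0] by simp
    define v where "v = t - s"
    have v: "0 < v"
      using pos by (simp add: v_def)
    \<comment> \<open>The moment formula (2k)! / ((2 / sigma^2)^k k!) evaluated for k = 1 and k = 2
      with sigma^2 = v.\<close>
    have eq: "fact (2 * 1) / ((2 / (sqrt v)\<^sup>2) ^ 1 * fact 1) = v"
        "fact (2 * 2) / ((2 / (sqrt v)\<^sup>2) ^ 2 * fact 2) = 3 * v\<^sup>2"
      using v by (simp_all add: fact_numeral power2_eq_square field_simps)
    have 2: "has_bochner_integral lborel (\<lambda>x. ?d x * x\<^sup>2) (t - s)"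
      using normal_moment_even[OF pos, of 0 1] unfolding eq[unfolded v_def] by simp
    have 4: "has_bochner_integral lborel (\<lambda>x. ?d x * x ^ 4) (3 * (t - s)\<^sup>2)"
      using normal_moment_even[OF pos, of 0 2] unfolding eq[unfolded v_def] by simp
    show ?thesis
      using int[OF _ 1] int[OF _ 2] int[OF _ 4] by auto
  qed auto
  then show "integrable P ?X" and "(\<integral>\<omega>. ?X \<omega> \<partial>P) = 0" "integrable P (\<lambda>\<omega>. (?X \<omega>)\<^sup>2)"
      "(\<integral>\<omega>. (?X \<omega>)\<^sup>2 \<partial>P) = t - s" "integrable P (\<lambda>\<omega>. ?X \<omega> ^ 4)" "(\<integral>\<omega>. ?X \<omega> ^ 4 \<partial>P) = 3 * (t - s)\<^sup>2"
    by blast+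
qed

lemma increment_L2:
  assumes "0 \<le> s" "s \<le> t" "t \<le> T"
  shows "(\<lambda>\<omega>. B t \<omega> - B s \<omega>) \<in> L2 P"
proof (rule L2I)
  show "(\<lambda>\<omega>. B t \<omega> - B s \<omega>) \<in> borel_measurable P"
    using assms by (intro borel_measurable_diff B_measurable) auto
  show "integrable P (\<lambda>\<omega>. (norm (B t \<omega> - B s \<omega>))\<^sup>2)"
    unfolding norm_vec_def L2_set_def using integrable_increment_sq[OF assms]
    by (simp add: sum_nonneg)
qed

lemma integral_increment_mult:
  assumes "0 \<le> s" "s \<le> t" "t \<le> T"
  shows "(\<integral>\<omega>. (B t \<omega> - B s \<omega>) $ j * (B t \<omega> - B s \<omega>) $ k \<partial>P) = (if j = k then t - s else 0)"
proof (cases "j = k \<or> s = t")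
  case True
  then show ?thesis
    using integral_increment_sq[OF assms] by (auto simp: power2_eq_square)
next
  case False
  then have "indep_vars (\<lambda>_. borel) (\<lambda>j \<omega>. (B t \<omega> - B s \<omega>) $ j) UNIV"
    using bm assms unfolding brownian_motion_def by (auto simp: less_le)
  then have "indep_vars (\<lambda>_. borel) (\<lambda>j \<omega>. (B t \<omega> - B s \<omega>) $ j) {j, k}"
    by (rule indep_vars_subset) simp
  from indep_vars_lebesgue_integral[OF _ this integrable_increment[OF assms]]
  show ?thesis
    using False integral_increment[OF assms] by simp
qed

text \<open>Cauchy-Schwarz over the coordinates bounds the fourth power of the norm by
  \<open>CARD('m)\<close> times the sum of fourth powers, each of which has mean
  \<open>3 * (t - s)\<^sup>2\<close>. The order \<open>(t - s)\<^sup>2\<close> is what later makes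
  the accumulated linearisation error vanish with the mesh.\<close>

lemma
  assumes st: "0 \<le> s" "s \<le> t" "t \<le> T"
  shows integrable_norm_increment_4: "integrable P (\<lambda>\<omega>. norm (B t \<omega> - B s \<omega>) ^ 4)"
    and integral_norm_increment_4: "(\<integral>\<omega>. norm (B t \<omega> - B s \<omega>) ^ 4 \<partial>P) \<le> 3 * real CARD('m)^2 * (t - s)\<^sup>2"
proof -
  let ?g = "\<lambda>\<omega>. real CARD('m) * (\<Sum>j\<in>UNIV. ((B t \<omega> - B s \<omega>) $ j) ^ 4)"
  have [measurable]: "B s \<in> borel_measurable P" "B t \<in> borel_measurable P"
    using st by (auto intro!: B_measurable)
  have g: "integrable P ?g"
    using integrable_increment_4[OF st] by auto
  have le: "norm (B t \<omega> - B s \<omega>) ^ 4 \<le> ?g \<omega>" for \<omega>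
  proof -
    have "norm (B t \<omega> - B s \<omega>) ^ 4 = ((norm (B t \<omega> - B s \<omega>))\<^sup>2)\<^sup>2"
      by simp
    also have "\<dots> = (\<Sum>j\<in>UNIV. ((B t \<omega> - B s \<omega>) $ j)\<^sup>2)\<^sup>2"
      by (simp add: norm_vec_def L2_set_def sum_nonneg)
    also have "\<dots> \<le> (\<Sum>j\<in>UNIV. (((B t \<omega> - B s \<omega>) $ j)\<^sup>2)\<^sup>2) * real CARD('m)"
      by (rule sum_squared_le_sum_of_squares)
    finally show ?thesis
      by (simp add: mult.commute)
  qed
  show int: "integrable P (\<lambda>\<omega>. norm (B t \<omega> - B s \<omega>) ^ 4)"
    using order_trans[OF le abs_ge_self]
    by (intro Bochner_Integration.integrable_bound[OF g] AE_I2) simp_all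
  have "(\<integral>\<omega>. norm (B t \<omega> - B s \<omega>) ^ 4 \<partial>P) \<le> (\<integral>\<omega>. ?g \<omega> \<partial>P)"
    by (rule integral_mono[OF int g le])
  also have "\<dots> = real CARD('m) * (\<Sum>j::'m\<in>UNIV. 3 * (t - s)\<^sup>2)"
    using integrable_increment_4[OF st] integral_increment_4[OF st] by (simp add: Bochner_Integration.integral_sum)
  also have "\<dots> = 3 * real CARD('m)^2 * (t - s)\<^sup>2"
    by (simp add: power2_eq_square)
  finally show "(\<integral>\<omega>. norm (B t \<omega> - B s \<omega>) ^ 4 \<partial>P) \<le> 3 * real CARD('m)^2 * (t - s)\<^sup>2" .
qed

end

section \<open>Integrals of simple processes\<close>

lemma norm_matrix_vector_mult_le:
  fixes A :: "real^'m^'d"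
  shows "norm (A *v x) \<le> norm A * norm x"
proof (rule power2_le_imp_le)
  have "(norm (A *v x))\<^sup>2 = (\<Sum>i\<in>UNIV. (A $ i \<bullet> x)\<^sup>2)"
    by (simp add: norm_vec_def L2_set_def sum_nonneg matrix_vector_mul_component)
  also have "\<dots> \<le> (\<Sum>i\<in>UNIV. (norm (A $ i))\<^sup>2 * (norm x)\<^sup>2)"
    using Cauchy_Schwarz_ineq by (intro sum_mono) (simp add: power2_norm_eq_inner)
  also have "\<dots> = (\<Sum>i\<in>UNIV. (norm (A $ i))\<^sup>2) * (norm x)\<^sup>2"
    by (simp add: sum_distrib_right)
  also have "(\<Sum>i\<in>UNIV. (norm (A $ i))\<^sup>2) = (norm A)\<^sup>2"
    by (simp add: norm_vec_def[of A] L2_set_def sum_nonneg)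
  finally show "(norm (A *v x))\<^sup>2 \<le> (norm A * norm x)\<^sup>2"
    by (simp add: power_mult_distrib)
qed simp

lemma borel_measurable_matrix_vector_mult [measurable]:
  fixes A :: "'a \<Rightarrow> real^'m^'d"
  assumes "A \<in> borel_measurable M" "x \<in> borel_measurable M"
  shows "(\<lambda>\<omega>. A \<omega> *v x \<omega>) \<in> borel_measurable M"
proof -
  have "continuous_on UNIV (\<lambda>p. fst p *v snd p :: real^'d)"
    unfolding matrix_vector_mult_def by (intro continuous_intros)
  from borel_measurable_continuous_on[OF this borel_measurable_Pair[OF assms]] show ?thesis
    by simp
qed

lemma borel_measurable_vec_nth2 [measurable]:
  "(\<lambda>A::real^'m^'d. A $ i) \<in> borel_measurable borel"
  by (intro borel_measurable_continuous_onI continuous_intros)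

text \<open>The condition stands inside a sum over all cells of the fine grid, so that sums over
  cells and over coarse intervals can be exchanged. Arbitrary \<open>H\<close> covers both uses:
  \<open>H x = B x \<omega>\<close> for the integral and \<open>H x = of_bool (s \<le> x)\<close>
  for the process.\<close>

lemma sorted_grid_telescope:
  fixes H :: "real \<Rightarrow> 'v::ab_group_add"
  assumes srt: "sorted_wrt (<) xs" and len: "length xs = Suc N"
    and a: "a \<in> set xs" and b: "b \<in> set xs" and "a \<le> b"
  shows "(\<Sum>k<N. if a \<le> xs ! k \<and> xs ! Suc k \<le> b then H (xs ! Suc k) - H (xs ! k) else 0) = H b - H a"
proof -
  obtain p q where p: "p \<le> N" "a = xs ! p" and q: "q \<le> N" "b = xs ! q"
    using a b len by (metis in_set_conv_nth less_Suc_eq_le)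
  have less: "xs ! i < xs ! j \<longleftrightarrow> i < j" if "i \<le> N" "j \<le> N" for i j
    using sorted_wrt_nth_less[OF srt, of i j] sorted_wrt_nth_less[OF srt, of j i] that len
    by (metis less_Suc_eq_le less_asym nat_neq_iff order_less_irrefl)
  have "p \<le> q"
    using less[OF q(1) p(1)] \<open>a \<le> b\<close> p q by force
  have "(\<Sum>k<N. if a \<le> xs ! k \<and> xs ! Suc k \<le> b then H (xs ! Suc k) - H (xs ! k) else 0)
      = (\<Sum>k\<in>{k\<in>{..<N}. a \<le> xs ! k \<and> xs ! Suc k \<le> b}. H (xs ! Suc k) - H (xs ! k))"
    by (rule sum.inter_filter[symmetric]) simp
  also have "{k\<in>{..<N}. a \<le> xs ! k \<and> xs ! Suc k \<le> b} = {p..<q}"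
  proof -
    have "a \<le> xs ! k \<and> xs ! Suc k \<le> b \<longleftrightarrow> p \<le> k \<and> k < q" if "k < N" for k
      using less[of k p] less[of q "Suc k"] that p q by (auto simp: not_less[symmetric])
    then have "k \<in> {k\<in>{..<N}. a \<le> xs ! k \<and> xs ! Suc k \<le> b} \<longleftrightarrow> k \<in> {p..<q}" for k
      using q(1) by (cases "k < N") auto
    then show ?thesis
      by blast
  qed
  also have "(\<Sum>k\<in>{p..<q}. H (xs ! Suc k) - H (xs ! k)) = H b - H a"
    unfolding p q using sum_Suc_diff'[OF \<open>p \<le> q\<close>, of "\<lambda>k. H (xs ! k)"] by simp
  finally show ?thesis .
qed

text \<open>Writes an interval indicator as a difference of values of one function of the endpoint,
  the form to which \<open>sorted_grid_telescope\<close> applies.\<close>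

lemma indicator_Ioc_diff:
  fixes a b s :: real
  assumes "a \<le> b"
  shows "indicator {a<..b} s = of_bool (s \<le> b) - (of_bool (s \<le> a) :: real)"
  using assms by (auto simp: indicator_def)

lemma bounded_mult_L2:
  fixes c :: "'a \<Rightarrow> real^'m^'d"
  assumes "c \<in> borel_measurable P" "\<forall>\<omega>\<in>space P. norm (c \<omega>) \<le> C" "X \<in> L2 P"
  shows "(\<lambda>\<omega>. c \<omega> *v X \<omega>) \<in> L2 P"
proof (rule L2_dominated[OF _ L2_scale[OF assms(3), of C]])
  show "(\<lambda>\<omega>. c \<omega> *v X \<omega>) \<in> borel_measurable P"
    using assms L2_measurable by measurable
  show "AE \<omega> in P. norm (c \<omega> *v X \<omega>) \<le> norm (C *\<^sub>R X \<omega>)"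
  proof (rule AE_I2)
    fix \<omega> assume "\<omega> \<in> space P"
    then have "norm (c \<omega>) * norm (X \<omega>) \<le> \<bar>C\<bar> * norm (X \<omega>)"
      using assms(2) by (intro mult_right_mono) force+
    then show "norm (c \<omega> *v X \<omega>) \<le> norm (C *\<^sub>R X \<omega>)"
      using norm_matrix_vector_mult_le[of "c \<omega>" "X \<omega>"] by simp
  qed
qed

lemma finite_restrict_lborel: "finite_measure (restrict_space lborel {t..u::real})"
  by (rule finite_measureI)
    (auto simp: space_restrict_space emeasure_restrict_space emeasure_lborel_Icc_eq)

section \<open>Linear structure of simple processes and their integrals\<close>

context brownian
begin

text \<open>The integrand and its integral are kept together as a pair, because the integral is
  defined from a representation and not from the process. Linear operations then act on both
  components at once.\<close>

definition simple_pairs :: "real \<Rightarrow> real \<Rightarrow> ((real \<Rightarrow> 'a \<Rightarrow> real^'m^'d) \<times> ('a \<Rightarrow> real^'d)) set" where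
  "simple_pairs t u = {(\<phi>, I). \<exists>n \<tau> c. simple_integrand P F t u n \<tau> c \<and>
     \<phi> = simple_process n \<tau> c \<and> I = simple_integral B n \<tau> c}"

lemma simple_pairsI:
  "simple_integrand P F t u n \<tau> c \<Longrightarrow> (simple_process n \<tau> c, simple_integral B n \<tau> c) \<in> simple_pairs t u"
  by (auto simp: simple_pairs_def)

lemma simple_pairsE:
  assumes "(\<phi>, I) \<in> simple_pairs t u"
  obtains n \<tau> c where "simple_integrand P F t u n \<tau> c" "\<phi> = simple_process n \<tau> c"
    "I = simple_integral B n \<tau> c"
  using assms by (auto simp: simple_pairs_def)

text \<open>On a cell of the fine grid the new coefficient is the sum of those \<open>c i\<close>
  whose interval contains the cell; it is measurable at the left end of the cell because
  \<open>\<tau> i\<close> lies no later. Strict sorting ensures that an empty interval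
  \<open>\<tau> i = \<tau> (Suc i)\<close> contains no cell.\<close>

lemma simple_integrand_refine:
  fixes c :: "nat \<Rightarrow> 'a \<Rightarrow> real^'m^'d"
  assumes si: "simple_integrand P F t u n \<tau> c"
    and srt: "sorted_wrt (<) xs" and len: "length xs = Suc N"
    and xs: "\<tau> ` {..n} \<subseteq> set xs" "set xs \<subseteq> {t..u}"
  obtains c' :: "nat \<Rightarrow> 'a \<Rightarrow> real^'m^'d" where
    "simple_integrand P F t u N ((!) xs) c'"
    "simple_process N ((!) xs) c' = simple_process n \<tau> c"
    "simple_integral B N ((!) xs) c' = simple_integral B n \<tau> c"
proof
  let ?Q = "\<lambda>i k. \<tau> i \<le> xs ! k \<and> xs ! Suc k \<le> \<tau> (Suc i)"
  define c' where "c' k \<omega> = (\<Sum>i<n. if ?Q i k then c i \<omega> else 0)" for k \<omega>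
  have mono: "\<tau> i \<le> \<tau> (Suc i)" if "i < n" for i
    using si that by (auto simp: simple_integrand_def)
  have mem: "\<tau> i \<in> set xs" if "i \<le> n" for i
    using xs that by auto
  have tel: "(\<Sum>k<N. if ?Q i k then H (xs ! Suc k) - H (xs ! k) else 0) = H (\<tau> (Suc i)) - H (\<tau> i)"
    if "i < n" for i and H :: "real \<Rightarrow> 'v::ab_group_add"
    using that by (intro sorted_grid_telescope[OF srt len] mem mono) auto
  show "simple_integrand P F t u N ((!) xs) c'"
    unfolding simple_integrand_def
  proof (intro conjI allI impI)
    fix i assume "i \<le> N"
    then show "xs ! i \<in> {t..u}"
      using subsetD[OF xs(2) nth_mem[of i xs]] len by simp
  next
    fix i assume "i < N"
    then show "xs ! i \<le> xs ! Suc i"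
      using sorted_wrt_nth_less[OF srt, of i "Suc i"] len by simp
  next
    fix k assume "k < N"
    have "(\<lambda>\<omega>. if ?Q i k then c i \<omega> else 0) \<in> borel_measurable (F (xs ! k))" if "i < n" for i
      using si that by (cases "?Q i k") (auto simp: simple_integrand_def intro: measurable_F_mono)
    then show "c' k \<in> borel_measurable (F (xs ! k))"
      unfolding c'_def[abs_def] by (intro borel_measurable_sum) auto
    have "\<exists>C. \<forall>i<n. \<forall>\<omega>\<in>space P. norm (c i \<omega>) \<le> C i"
      using si unfolding simple_integrand_def bounded_iff by (simp add: ball_simps) metis
    then obtain C where C: "\<And>i \<omega>. i < n \<Longrightarrow> \<omega> \<in> space P \<Longrightarrow> norm (c i \<omega>) \<le> C i"
      by blast
    have "norm (c' k \<omega>) \<le> (\<Sum>i<n. \<bar>C i\<bar>)" if "\<omega> \<in> space P" for \<omega>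
      unfolding c'_def using C[OF _ that] by (intro sum_norm_le) (force intro: order_trans[OF _ abs_ge_self])
    then show "bounded (c' k ` space P)"
      unfolding bounded_iff by blast
  qed
  show "simple_process N ((!) xs) c' = simple_process n \<tau> c"
  proof (intro ext)
    fix s \<omega>
    have xsmono: "xs ! k \<le> xs ! Suc k" if "k < N" for k
      using sorted_wrt_nth_less[OF srt, of k "Suc k"] len that by simp
    have "simple_process N ((!) xs) c' s \<omega>
        = (\<Sum>k<N. \<Sum>i<n. (if ?Q i k then of_bool (s \<le> xs ! Suc k) - of_bool (s \<le> xs ! k) else 0) *\<^sub>R c i \<omega>)"
      unfolding simple_process_def c'_def scaleR_sum_right
      by (intro sum.cong refl) (auto simp: indicator_Ioc_diff[OF xsmono])
    also have "\<dots> = (\<Sum>i<n. (\<Sum>k<N. if ?Q i k then of_bool (s \<le> xs ! Suc k) - of_bool (s \<le> xs ! k) else 0) *\<^sub>R c i \<omega>)"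
      by (subst sum.swap) (simp add: scaleR_sum_left)
    also have "\<dots> = simple_process n \<tau> c s \<omega>"
      unfolding simple_process_def using tel[of _ "\<lambda>x. of_bool (s \<le> x) :: real"]
      by (intro sum.cong refl) (simp add: indicator_Ioc_diff[OF mono])
    finally show "simple_process N ((!) xs) c' s \<omega> = simple_process n \<tau> c s \<omega>" .
  qed
  show "simple_integral B N ((!) xs) c' = simple_integral B n \<tau> c"
  proof (intro ext)
    fix \<omega>
    have "simple_integral B N ((!) xs) c' \<omega>
        = (\<Sum>k<N. \<Sum>i<n. c i \<omega> *v (if ?Q i k then B (xs ! Suc k) \<omega> - B (xs ! k) \<omega> else 0))"
      unfolding simple_integral_def c'_def
    proof (intro sum.cong refl)
      fix k
      have "(\<Sum>i<n. if ?Q i k then c i \<omega> else 0) *v v = (\<Sum>i<n. c i \<omega> *v (if ?Q i k then v else 0))" for v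
        by (induction n) (auto simp: matrix_vector_mult_add_rdistrib)
      then show "(\<Sum>i<n. if ?Q i k then c i \<omega> else 0) *v (B (xs ! Suc k) \<omega> - B (xs ! k) \<omega>)
          = (\<Sum>i<n. c i \<omega> *v (if ?Q i k then B (xs ! Suc k) \<omega> - B (xs ! k) \<omega> else 0))" .
    qed
    also have "\<dots> = (\<Sum>i<n. c i \<omega> *v (\<Sum>k<N. if ?Q i k then B (xs ! Suc k) \<omega> - B (xs ! k) \<omega> else 0))"
      by (subst sum.swap) (simp only: linear_sum[OF matrix_vector_mul_linear])
    also have "\<dots> = simple_integral B n \<tau> c \<omega>"
      unfolding simple_integral_def using tel[of _ "\<lambda>x. B x \<omega>"] by (intro sum.cong refl) simp
    finally show "simple_integral B N ((!) xs) c' \<omega> = simple_integral B n \<tau> c \<omega>" .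
  qed
qed

text \<open>The two grids differ, so both pairs are rewritten over the union of their grid points;
  there the coefficients add.\<close>

lemma simple_pairs_add:
  assumes "(\<phi>, I) \<in> simple_pairs t u" "(\<psi>, J) \<in> simple_pairs t u"
  shows "(\<lambda>s \<omega>. \<phi> s \<omega> + \<psi> s \<omega>, \<lambda>\<omega>. I \<omega> + J \<omega>) \<in> simple_pairs t u"
proof -
  obtain n \<tau> c where 1: "simple_integrand P F t u n \<tau> c" "\<phi> = simple_process n \<tau> c"
      "I = simple_integral B n \<tau> c"
    using assms(1) by (rule simple_pairsE)
  obtain n' \<tau>' c' where 2: "simple_integrand P F t u n' \<tau>' c'" "\<psi> = simple_process n' \<tau>' c'"
      "J = simple_integral B n' \<tau>' c'"
    using assms(2) by (rule simple_pairsE)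
  define S where "S = \<tau> ` {..n} \<union> \<tau>' ` {..n'}"
  define xs where "xs = sorted_list_of_set S"
  have S: "finite S" "S \<noteq> {}" "S \<subseteq> {t..u}"
    using 1(1) 2(1) by (auto simp: S_def simple_integrand_def)
  have set_xs: "set xs = S" and srt: "sorted_wrt (<) xs"
    unfolding xs_def using S by (simp_all add: strict_sorted_list_of_set)
  obtain N where len: "length xs = Suc N"
    using set_xs S(2) by (cases xs) auto
  have sub: "\<tau> ` {..n} \<subseteq> set xs" "\<tau>' ` {..n'} \<subseteq> set xs" "set xs \<subseteq> {t..u}"
    using S set_xs by (auto simp: S_def)
  obtain d where d: "simple_integrand P F t u N ((!) xs) d"
      "simple_process N ((!) xs) d = \<phi>" "simple_integral B N ((!) xs) d = I"
    using simple_integrand_refine[OF 1(1) srt len sub(1,3)] 1(2,3) by metis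
  obtain d' where d': "simple_integrand P F t u N ((!) xs) d'"
      "simple_process N ((!) xs) d' = \<psi>" "simple_integral B N ((!) xs) d' = J"
    using simple_integrand_refine[OF 2(1) srt len sub(2,3)] 2(2,3) by metis
  have "simple_integrand P F t u N ((!) xs) (\<lambda>i \<omega>. d i \<omega> + d' i \<omega>)"
    using d(1) d'(1) unfolding simple_integrand_def
    by (auto intro!: borel_measurable_add bounded_plus_comp)
  from simple_pairsI[OF this] show ?thesis
    unfolding d(2,3)[symmetric] d'(2,3)[symmetric] simple_process_def simple_integral_def
    by (simp add: scaleR_add_right sum.distrib matrix_vector_mult_add_rdistrib)
qed

lemma simple_pairs_scale:
  assumes "(\<phi>, I) \<in> simple_pairs t u"
  shows "(\<lambda>s \<omega>. r *\<^sub>R \<phi> s \<omega>, \<lambda>\<omega>. r *\<^sub>R I \<omega>) \<in> simple_pairs t u"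
proof -
  obtain n \<tau> c where 1: "simple_integrand P F t u n \<tau> c" "\<phi> = simple_process n \<tau> c"
      "I = simple_integral B n \<tau> c"
    using assms(1) by (rule simple_pairsE)
  have "simple_integrand P F t u n \<tau> (\<lambda>i \<omega>. r *\<^sub>R c i \<omega>)"
    using 1(1) unfolding simple_integrand_def by (auto intro!: borel_measurable_scaleR bounded_scaleR_comp)
  moreover have "simple_process n \<tau> (\<lambda>i \<omega>. r *\<^sub>R c i \<omega>) = (\<lambda>s \<omega>. r *\<^sub>R \<phi> s \<omega>)"
    unfolding 1(2) simple_process_def scaleR_sum_right
    by (intro ext sum.cong refl) (simp only: scaleR_scaleR mult.commute)
  moreover have "simple_integral B n \<tau> (\<lambda>i \<omega>. r *\<^sub>R c i \<omega>) = (\<lambda>\<omega>. r *\<^sub>R I \<omega>)"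
    unfolding 1(3) simple_integral_def scaleR_sum_right
    by (intro ext sum.cong refl) (simp only: scaleR_matrix_vector_assoc[symmetric])
  ultimately show ?thesis
    using simple_pairsI by (metis (no_types, lifting))
qed

lemma simple_pairs_zero: "t \<le> u \<Longrightarrow> (\<lambda>s \<omega>. 0, \<lambda>\<omega>. 0) \<in> simple_pairs t u"
  unfolding simple_pairs_def simple_integrand_def simple_process_def simple_integral_def
  by (intro CollectI case_prodI exI[of _ 0] exI[of _ "\<lambda>_. t"] exI[of _ "\<lambda>_ _. 0"]) simp

lemma simple_pairs_diff:
  assumes "(\<phi>, I) \<in> simple_pairs t u" "(\<psi>, J) \<in> simple_pairs t u"
  shows "(\<lambda>s \<omega>. \<phi> s \<omega> - \<psi> s \<omega>, \<lambda>\<omega>. I \<omega> - J \<omega>) \<in> simple_pairs t u"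
  using simple_pairs_add[OF assms(1) simple_pairs_scale[OF assms(2), of "-1"]]
  by (simp only: scaleR_minus1_left add_uminus_conv_diff)

lemma simple_pairs_single:
  fixes c :: "'a \<Rightarrow> real^'m^'d"
  assumes "t \<le> a" "a \<le> b" "b \<le> u" "c \<in> borel_measurable (F a)" "bounded (c ` space P)"
  shows "(\<lambda>s \<omega>. indicator {a<..b} s *\<^sub>R c \<omega>, \<lambda>\<omega>. c \<omega> *v (B b \<omega> - B a \<omega>)) \<in> simple_pairs t u"
proof -
  let ?\<tau> = "\<lambda>i::nat. if i = 0 then a else b"
  have "simple_integrand P F t u 1 ?\<tau> (\<lambda>_. c)"
    using assms by (auto simp: simple_integrand_def)
  note si = this
  have p: "simple_process 1 ?\<tau> (\<lambda>_. c) = (\<lambda>s \<omega>. indicator {a<..b} s *\<^sub>R c \<omega>)"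
    unfolding simple_process_def One_nat_def lessThan_Suc lessThan_0
    by (subst sum.insert) (simp_all add: fun_eq_iff)
  have i: "simple_integral B 1 ?\<tau> (\<lambda>_. c) = (\<lambda>\<omega>. c \<omega> *v (B b \<omega> - B a \<omega>))"
    unfolding simple_integral_def One_nat_def lessThan_Suc lessThan_0
    by (subst sum.insert) (simp_all add: fun_eq_iff)
  show ?thesis
    using simple_pairsI[OF si] unfolding p i .
qed

subsection \<open>The isometry\<close>

lemma simple_grid:
  assumes "simple_integrand P F t u n \<tau> c"
  shows "i \<le> n \<Longrightarrow> t \<le> \<tau> i" "i \<le> n \<Longrightarrow> \<tau> i \<le> u" "i < n \<Longrightarrow> \<tau> i \<le> \<tau> (Suc i)"
    "i < n \<Longrightarrow> c i \<in> borel_measurable (F (\<tau> i))"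
  using assms by (auto simp: simple_integrand_def)

lemma simple_grid_mono:
  assumes "simple_integrand P F t u n \<tau> c" "i \<le> j" "j \<le> n"
  shows "\<tau> i \<le> \<tau> j"
  using assms(2,3)
proof (induction j rule: dec_induct)
  case (step k)
  then show ?case
    using simple_grid(3)[OF assms(1), of k] by simp
qed simp

lemma simple_coeff_L2:
  assumes "simple_integrand P F t u n \<tau> c" "0 \<le> t" "u \<le> T" "i < n"
  shows "c i \<in> borel_measurable P" "\<exists>C\<ge>0. \<forall>\<omega>\<in>space P. norm (c i \<omega>) \<le> C" "c i \<in> L2 P"
proof -
  show 1: "c i \<in> borel_measurable P"
    using simple_grid(2,4)[OF assms(1), of i] assms(3,4) by (intro measurable_F_P[of _ "\<tau> i"]) auto
  show "\<exists>C\<ge>0. \<forall>\<omega>\<in>space P. norm (c i \<omega>) \<le> C"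
  proof -
    have "bounded (c i ` space P)"
      using assms by (simp add: simple_integrand_def)
    then obtain C where "0 < C" "\<forall>x\<in>c i ` space P. norm x \<le> C"
      unfolding bounded_pos by blast
    then show ?thesis
      by (intro exI[of _ C]) auto
  qed
  then obtain C where "\<And>\<omega>. \<omega> \<in> space P \<Longrightarrow> norm (c i \<omega>) \<le> C"
    by auto
  then show "c i \<in> L2 P"
    by (intro L2_bounded[OF finite_measure_axioms 1])
qed

lemma simple_term_L2:
  assumes si: "simple_integrand P F t u n \<tau> c" and tu: "0 \<le> t" "u \<le> T" and i: "i < n"
  shows "(\<lambda>\<omega>. c i \<omega> *v (B (\<tau> (Suc i)) \<omega> - B (\<tau> i) \<omega>)) \<in> L2 P"
proof -
  obtain C where "\<forall>\<omega>\<in>space P. norm (c i \<omega>) \<le> C"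
    using simple_coeff_L2[OF si tu i] by blast
  then show ?thesis
    using simple_grid(1)[OF si, of i] simple_grid(2)[OF si, of "Suc i"] simple_grid(3)[OF si i] tu i
      simple_coeff_L2(1)[OF si tu i]
    by (intro bounded_mult_L2 increment_L2) auto
qed

lemma simple_pairs_integral_L2:
  assumes "(\<phi>, I) \<in> simple_pairs t u" "0 \<le> t" "u \<le> T"
  shows "I \<in> L2 P"
proof -
  obtain n \<tau> c where "simple_integrand P F t u n \<tau> c" and I: "I = simple_integral B n \<tau> c"
    using assms(1) by (rule simple_pairsE)
  then show ?thesis
    unfolding I simple_integral_def[abs_def] using assms(2,3) by (intro L2_sum simple_term_L2) auto
qed

text \<open>Coordinatewise, \<open>V\<close> times an entry of \<open>c\<close> is
  \<open>F s\<close>-measurable, and the increment is independent of \<open>F s\<close> with mean 0.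
  Boundedness of \<open>c\<close> keeps that product integrable.\<close>

lemma integral_inner_increment_zero:
  fixes c :: "'a \<Rightarrow> real^'m^'d"
  assumes st: "0 \<le> s" "s \<le> t" "t \<le> T" and V: "V \<in> borel_measurable (F s)" "V \<in> L2 P"
    and c: "c \<in> borel_measurable (F s)" "\<forall>\<omega>\<in>space P. norm (c \<omega>) \<le> C"
  shows "(\<integral>\<omega>. V \<omega> \<bullet> (c \<omega> *v (B t \<omega> - B s \<omega>)) \<partial>P) = 0"
proof -
  have cP: "c \<in> borel_measurable P"
    using c(1) st by (auto intro: measurable_F_P)
  have [measurable]: "V \<in> borel_measurable (F s)" "c \<in> borel_measurable (F s)"
      "V \<in> borel_measurable P" "c \<in> borel_measurable P"
    using V c cP by (auto simp: L2_def)
  let ?W = "\<lambda>p k \<omega>. V \<omega> $ p * c \<omega> $ p $ k"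
  have W: "?W p k \<in> borel_measurable (F s)" "integrable P (?W p k)" for p k
  proof -
    show "?W p k \<in> borel_measurable (F s)"
      by measurable
    have "(\<lambda>\<omega>. C *\<^sub>R V \<omega>) \<in> L2 P"
      by (rule L2_scale[OF V(2)])
    then have "?W p k \<in> L2 P"
    proof (rule L2_dominated[rotated])
      show "AE \<omega> in P. norm (?W p k \<omega>) \<le> norm (C *\<^sub>R V \<omega>)"
      proof (rule AE_I2)
        fix \<omega> assume "\<omega> \<in> space P"
        then have "\<bar>c \<omega> $ p $ k\<bar> \<le> \<bar>C\<bar>"
          using c(2) component_le_norm_cart[of "c \<omega> $ p" k] Finite_Cartesian_Product.norm_nth_le[of "c \<omega>" p] by force
        then have "\<bar>V \<omega> $ p\<bar> * \<bar>c \<omega> $ p $ k\<bar> \<le> norm (V \<omega>) * \<bar>C\<bar>"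
          using component_le_norm_cart[of "V \<omega>" p] by (intro mult_mono) auto
        then show "norm (?W p k \<omega>) \<le> norm (C *\<^sub>R V \<omega>)"
          by (simp add: abs_mult mult.commute)
      qed
    qed measurable
    then show "integrable P (?W p k)"
      by (rule L2_integrable[OF finite_measure_axioms])
  qed
  have g: "(\<lambda>x::real^'m. x $ k) \<in> borel_measurable borel" for k
    by measurable
  have "(\<integral>\<omega>. V \<omega> \<bullet> (c \<omega> *v (B t \<omega> - B s \<omega>)) \<partial>P)
      = (\<integral>\<omega>. (\<Sum>p\<in>UNIV. \<Sum>k\<in>UNIV. ?W p k \<omega> * (B t \<omega> - B s \<omega>) $ k) \<partial>P)"
    by (simp add: inner_vec_def matrix_vector_mult_def sum_distrib_left mult.assoc)
  also have "\<dots> = (\<Sum>p\<in>UNIV. \<Sum>k\<in>UNIV. \<integral>\<omega>. ?W p k \<omega> * (B t \<omega> - B s \<omega>) $ k \<partial>P)"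
    using integrable_F_increment[OF st W g integrable_increment[OF st]]
    by (simp add: Bochner_Integration.integral_sum Bochner_Integration.integrable_sum)
  also have "\<dots> = 0"
    using integral_F_increment[OF st W g integrable_increment[OF st]] integral_increment[OF st]
    by simp
  finally show ?thesis .
qed

text \<open>Independence factorises the expectation. Products of different coordinates of the
  increment have mean 0 and squares have mean \<open>t - s\<close>, so only the squared entries of
  \<open>c\<close> survive; their sum is the squared Frobenius norm.\<close>

lemma msq_simple_term:
  fixes c :: "'a \<Rightarrow> real^'m^'d"
  assumes st: "0 \<le> s" "s \<le> t" "t \<le> T"
    and c: "c \<in> borel_measurable (F s)" "\<forall>\<omega>\<in>space P. norm (c \<omega>) \<le> C"
  shows "msq P (\<lambda>\<omega>. c \<omega> *v (B t \<omega> - B s \<omega>)) = (t - s) * msq P c"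
proof -
  have [measurable]: "c \<in> borel_measurable (F s)" "c \<in> borel_measurable P"
    using c st by (auto intro: measurable_F_P)
  let ?W = "\<lambda>p k l \<omega>. c \<omega> $ p $ k * c \<omega> $ p $ l"
  have bnd: "\<bar>c \<omega> $ p $ k\<bar> \<le> \<bar>C\<bar>" if "\<omega> \<in> space P" for \<omega> p k
    using c(2) that component_le_norm_cart[of "c \<omega> $ p" k] Finite_Cartesian_Product.norm_nth_le[of "c \<omega>" p] by force
  have W: "?W p k l \<in> borel_measurable (F s)" "integrable P (?W p k l)" for p k l
  proof -
    show "?W p k l \<in> borel_measurable (F s)"
      by measurable
    have "AE \<omega> in P. norm (?W p k l \<omega>) \<le> \<bar>C\<bar> * \<bar>C\<bar>"
      unfolding real_norm_def abs_mult using bnd by (intro AE_I2 mult_mono) simp_all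
    then show "integrable P (?W p k l)"
      by (intro integrable_const_bound) measurable
  qed
  let ?g = "\<lambda>k l (x::real^'m). x $ k * x $ l"
  have g: "?g k l \<in> borel_measurable borel" for k l
    by measurable
  have gi: "integrable P (\<lambda>\<omega>. ?g k l (B t \<omega> - B s \<omega>))" for k l
    using L2_inner_integrable[OF L2_vec_nth[OF increment_L2[OF st]] L2_vec_nth[OF increment_L2[OF st]]]
    by simp
  have "msq P (\<lambda>\<omega>. c \<omega> *v (B t \<omega> - B s \<omega>))
      = (\<integral>\<omega>. (\<Sum>p\<in>UNIV. \<Sum>k\<in>UNIV. \<Sum>l\<in>UNIV. ?W p k l \<omega> * ?g k l (B t \<omega> - B s \<omega>)) \<partial>P)"
    by (simp add: msq_def power2_norm_eq_inner inner_vec_def matrix_vector_mult_def sum_product ac_simps)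
  also have "\<dots> = (\<Sum>p\<in>UNIV. \<Sum>k\<in>UNIV. \<Sum>l\<in>UNIV. \<integral>\<omega>. ?W p k l \<omega> * ?g k l (B t \<omega> - B s \<omega>) \<partial>P)"
    using integrable_F_increment[OF st W g gi]
    by (simp add: Bochner_Integration.integral_sum Bochner_Integration.integrable_sum)
  also have "\<dots> = (\<Sum>p\<in>UNIV. \<Sum>k\<in>UNIV. \<Sum>l\<in>UNIV. (\<integral>\<omega>. ?W p k l \<omega> \<partial>P) * (if k = l then t - s else 0))"
    using integral_F_increment[OF st W g gi] integral_increment_mult[OF st] by simp
  also have "\<dots> = (\<Sum>p\<in>UNIV. \<Sum>k\<in>UNIV. (\<integral>\<omega>. ?W p k k \<omega> \<partial>P) * (t - s))"
    by (intro sum.cong refl) (simp add: if_distrib cong: if_cong)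
  also have "\<dots> = (t - s) * (\<Sum>p\<in>UNIV. \<Sum>k\<in>UNIV. \<integral>\<omega>. ?W p k k \<omega> \<partial>P)"
    by (simp add: sum_distrib_left mult.commute)
  also have "(\<Sum>p\<in>UNIV. \<Sum>k\<in>UNIV. \<integral>\<omega>. ?W p k k \<omega> \<partial>P) = msq P c"
    unfolding msq_def power2_norm_eq_inner inner_vec_def
    using W by (simp add: Bochner_Integration.integral_sum Bochner_Integration.integrable_sum)
  finally show ?thesis .
qed

lemma msq_simple_integral:
  assumes si: "simple_integrand P F t u n \<tau> c" and tu: "0 \<le> t" "u \<le> T"
  shows "msq P (simple_integral B n \<tau> c) = (\<Sum>i<n. (\<tau> (Suc i) - \<tau> i) * msq P (c i))"
proof -
  let ?f = "\<lambda>i \<omega>. c i \<omega> *v (B (\<tau> (Suc i)) \<omega> - B (\<tau> i) \<omega>)"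
  have \<tau>: "0 \<le> \<tau> i" "\<tau> i \<le> T" if "i \<le> n" for i
    using si tu that by (force simp: simple_integrand_def)+
  have mono: "\<tau> i \<le> \<tau> (Suc i)" if "i < n" for i
    using si that by (auto simp: simple_integrand_def)
  note mono2 = simple_grid_mono[OF si]
  \<comment> \<open>The earlier term and the later coefficient are both known at
    \<open>\<tau> j\<close>, where the later increment starts.\<close>
  have orth: "(\<integral>\<omega>. ?f i \<omega> \<bullet> ?f j \<omega> \<partial>P) = 0" if "i < j" and j: "j < n" for i j
  proof -
    have ij: "i < n" "\<tau> (Suc i) \<le> \<tau> j"
      using that mono2 by auto
    obtain C where C: "\<forall>\<omega>\<in>space P. norm (c j \<omega>) \<le> C"
      using simple_coeff_L2(2)[OF si tu j] by blast
    have "?f i \<in> borel_measurable (F (\<tau> j))"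
      using ij \<tau> mono that
      by (intro borel_measurable_matrix_vector_mult borel_measurable_diff B_adapted
          measurable_F_mono[OF simple_grid(4)[OF si ij(1)]] mono2) auto
    then show ?thesis
      using \<tau> mono that si
      by (intro integral_inner_increment_zero[OF _ _ _ _ simple_term_L2[OF si tu ij(1)] _ C])
        (auto simp: simple_integrand_def)
  qed
  have "msq P (simple_integral B n \<tau> c) = (\<Sum>i<n. msq P (?f i))"
    unfolding simple_integral_def[abs_def]
  proof (rule msq_sum_orthogonal)
    fix i j assume "i \<in> {..<n}" "j \<in> {..<n}" "i \<noteq> j"
    then show "(\<integral>\<omega>. ?f i \<omega> \<bullet> ?f j \<omega> \<partial>P) = 0"
      using orth[of i j] orth[of j i] by (cases "i < j") (auto simp: inner_commute)
  qed (auto intro: simple_term_L2[OF si tu])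
  also have "\<dots> = (\<Sum>i<n. (\<tau> (Suc i) - \<tau> i) * msq P (c i))"
  proof (intro sum.cong refl)
    fix i assume "i \<in> {..<n}"
    then have i: "i < n" by simp
    obtain C where C: "\<forall>\<omega>\<in>space P. norm (c i \<omega>) \<le> C"
      using simple_coeff_L2(2)[OF si tu i] by blast
    show "msq P (?f i) = (\<tau> (Suc i) - \<tau> i) * msq P (c i)"
      using \<tau> mono i si by (intro msq_simple_term[OF _ _ _ _ C]) (auto simp: simple_integrand_def)
  qed
  finally show ?thesis .
qed

abbreviation PQ :: "real \<Rightarrow> real \<Rightarrow> (real \<times> 'a) measure" where
  "PQ t u \<equiv> restrict_space lborel {t..u} \<Otimes>\<^sub>M P"

lemma finite_PQ: "finite_measure (PQ t u)"
  by (rule finite_measure_pair_measure[OF finite_measure_axioms finite_restrict_lborel])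

lemma
  fixes c :: "'a \<Rightarrow> real^'m^'d"
  assumes ab: "t \<le> a" "a \<le> b" "b \<le> u"
    and c: "c \<in> borel_measurable P" "\<forall>\<omega>\<in>space P. norm (c \<omega>) \<le> C"
  shows simple_process_term_L2: "(\<lambda>(s, \<omega>). indicator {a<..b} s *\<^sub>R c \<omega>) \<in> L2 (PQ t u)"
    and msq_simple_process_term: "msq (PQ t u) (\<lambda>(s, \<omega>). indicator {a<..b} s *\<^sub>R c \<omega>) = (b - a) * msq P c"
proof -
  interpret R: finite_measure "restrict_space lborel {t..u}"
    by (rule finite_restrict_lborel)
  interpret pair_sigma_finite "restrict_space lborel {t..u}" P ..
  have [measurable]: "c \<in> borel_measurable P"
    by (rule c)
  have [measurable]: "(\<lambda>p. indicator {a<..b} (fst p) :: real) \<in> borel_measurable (PQ t u)"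
  proof -
    have "(\<lambda>s. indicator {a<..b} s :: real) \<in> borel_measurable (restrict_space lborel {t..u})"
      by (intro measurable_restrict_space1) measurable
    then show ?thesis
      by measurable
  qed
  show L2: "(\<lambda>(s, \<omega>). indicator {a<..b} s *\<^sub>R c \<omega>) \<in> L2 (PQ t u)"
  proof (rule L2_bounded[OF finite_PQ, where C="\<bar>C\<bar>"])
    show "(\<lambda>(s, \<omega>). indicator {a<..b} s *\<^sub>R c \<omega>) \<in> borel_measurable (PQ t u)"
      unfolding case_prod_beta by measurable
  next
    fix p assume "p \<in> space (PQ t u)"
    then have "norm (c (snd p)) \<le> \<bar>C\<bar>"
      using c(2) by (force simp: space_pair_measure)
    then show "norm (case p of (s, \<omega>) \<Rightarrow> indicator {a<..b} s *\<^sub>R c \<omega>) \<le> \<bar>C\<bar>"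
      by (auto simp: indicator_def split: prod.split)
  qed
  have "msq (PQ t u) (\<lambda>(s, \<omega>). indicator {a<..b} s *\<^sub>R c \<omega>)
      = (\<integral>s. (\<integral>\<omega>. (norm (indicator {a<..b} s *\<^sub>R c \<omega>))\<^sup>2 \<partial>P) \<partial>restrict_space lborel {t..u})"
    unfolding msq_def using integral_fst'[OF L2_integrable_sq[OF L2]] by simp
  also have "\<dots> = (\<integral>s. indicator {a<..b} s * msq P c \<partial>restrict_space lborel {t..u})"
    by (intro Bochner_Integration.integral_cong) (auto simp: msq_def indicator_def)
  also have "\<dots> = (\<integral>s. indicator {a<..b} s * msq P c \<partial>lborel)"
  proof -
    have "indicator {t..u} s *\<^sub>R (indicator {a<..b} s * msq P c) = indicator {a<..b} s * msq P c" for s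
      using ab by (auto simp: indicator_def)
    then show ?thesis
      by (subst integral_restrict_space) (simp, simp only:)
  qed
  also have "\<dots> = (b - a) * msq P c"
    using ab by (subst integral_mult_left_zero) simp
  finally show "msq (PQ t u) (\<lambda>(s, \<omega>). indicator {a<..b} s *\<^sub>R c \<omega>) = (b - a) * msq P c" .
qed

text \<open>Both sides equal the sum of \<open>(\<tau> (Suc i) - \<tau> i) * msq P (c i)\<close>.
  For the process, orthogonality is pointwise, since the half-open cells of a monotone grid are
  disjoint. Applied to differences of pairs, the isometry makes the integral depend on the process
  alone, up to null sets.\<close>

lemma simple_pairs_isometry:
  assumes e: "(\<phi>, I) \<in> simple_pairs t u" and tu: "0 \<le> t" "u \<le> T"
  shows "(\<lambda>(s, \<omega>). \<phi> s \<omega>) \<in> L2 (PQ t u)" "msq (PQ t u) (\<lambda>(s, \<omega>). \<phi> s \<omega>) = msq P I"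
proof -
  obtain n \<tau> c where si: "simple_integrand P F t u n \<tau> c" and \<phi>: "\<phi> = simple_process n \<tau> c"
      and I: "I = simple_integral B n \<tau> c"
    using e by (rule simple_pairsE)
  let ?g = "\<lambda>i (s, \<omega>). indicator {\<tau> i<..\<tau> (Suc i)} s *\<^sub>R c i \<omega>"
  have eq: "(\<lambda>(s, \<omega>). \<phi> s \<omega>) = (\<lambda>p. \<Sum>i<n. ?g i p)"
    by (auto simp: \<phi> simple_process_def)
  have \<tau>: "t \<le> \<tau> i" "\<tau> i \<le> \<tau> (Suc i)" "\<tau> (Suc i) \<le> u" if "i < n" for i
    using si that by (auto simp: simple_integrand_def)
  note mono2 = simple_grid_mono[OF si]
  have g: "?g i \<in> L2 (PQ t u)" "msq (PQ t u) (?g i) = (\<tau> (Suc i) - \<tau> i) * msq P (c i)" if i: "i < n" for i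
  proof -
    obtain C where C: "\<forall>\<omega>\<in>space P. norm (c i \<omega>) \<le> C"
      using simple_coeff_L2(2)[OF si tu i] by blast
    show "?g i \<in> L2 (PQ t u)" "msq (PQ t u) (?g i) = (\<tau> (Suc i) - \<tau> i) * msq P (c i)"
      using simple_process_term_L2[OF \<tau>[OF i] simple_coeff_L2(1)[OF si tu i] C]
        msq_simple_process_term[OF \<tau>[OF i] simple_coeff_L2(1)[OF si tu i] C] by auto
  qed
  show "(\<lambda>(s, \<omega>). \<phi> s \<omega>) \<in> L2 (PQ t u)"
    unfolding eq by (intro L2_sum g) auto
  have "msq (PQ t u) (\<lambda>(s, \<omega>). \<phi> s \<omega>) = (\<Sum>i<n. msq (PQ t u) (?g i))"
    unfolding eq
  proof (rule msq_sum_orthogonal)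
    fix i j assume ij: "i \<in> {..<n}" "j \<in> {..<n}" "i \<noteq> j"
    have disj: "\<not> (\<tau> k < s \<and> s \<le> \<tau> (Suc k) \<and> \<tau> l < s \<and> s \<le> \<tau> (Suc l))" if "k < l" "l < n" for k l s
      using mono2[of "Suc k" l] that by auto
    have "?g i p \<bullet> ?g j p = 0" for p
      using disj[of i j "fst p"] disj[of j i "fst p"] ij
      by (cases p, cases "i < j") (auto simp: indicator_def)
    then show "(\<integral>p. ?g i p \<bullet> ?g j p \<partial>PQ t u) = 0"
      by simp
  qed (auto intro: g)
  then show "msq (PQ t u) (\<lambda>(s, \<omega>). \<phi> s \<omega>) = msq P I"
    using g(2) unfolding I msq_simple_integral[OF si tu] by simp
qed

end

section \<open>Conditional expectation\<close>

lemma norm_vec_sq: "(norm (x::real^'d))\<^sup>2 = (\<Sum>i\<in>UNIV. (x $ i)\<^sup>2)"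
  by (simp add: norm_vec_def L2_set_def sum_nonneg)

lemma integrable_vec_nth:
  fixes f :: "'a \<Rightarrow> real^'d"
  assumes "integrable P f"
  shows "integrable P (\<lambda>\<omega>. f \<omega> $ i)"
proof -
  have "integrable P (\<lambda>\<omega>. f \<omega> \<bullet> axis i 1)"
    using assms by simp
  then show ?thesis
    by (simp add: inner_axis)
qed

lemma integrable_vecI:
  fixes f :: "'a \<Rightarrow> real^'d"
  assumes "\<And>i. integrable P (\<lambda>\<omega>. f \<omega> $ i)"
  shows "integrable P f"
proof -
  have "integrable P (\<lambda>\<omega>. \<Sum>i\<in>UNIV. f \<omega> $ i *\<^sub>R axis i 1)"
    using assms by (intro Bochner_Integration.integrable_sum integrable_scaleR_left) auto
  also have "(\<lambda>\<omega>. \<Sum>i\<in>UNIV. f \<omega> $ i *\<^sub>R axis i 1) = f"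
    by (auto simp: vec_eq_iff axis_def if_distrib cong: if_cong)
  finally show ?thesis .
qed

lemma AE_vec_eqI:
  fixes f g :: "'a \<Rightarrow> real^'d"
  assumes "\<And>i. AE \<omega> in P. f \<omega> $ i = g \<omega> $ i"
  shows "AE \<omega> in P. f \<omega> = g \<omega>"
proof -
  have "AE \<omega> in P. \<forall>i\<in>UNIV. f \<omega> $ i = g \<omega> $ i"
    using assms by (subst AE_finite_all) auto
  then show ?thesis
    by eventually_elim (simp add: vec_eq_iff)
qed

locale prob_subalgebra = prob_space P + sigma_finite_subalgebra P G
  for P G :: "'a measure"
begin

lemma vec_cond_exp_nth: "vec_cond_exp P G f \<omega> $ i = real_cond_exp P G (\<lambda>\<omega>. f \<omega> $ i) \<omega>"
  by (simp add: vec_cond_exp_def)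

lemma vec_cond_exp_measurable:
  fixes f :: "'a \<Rightarrow> real^'d"
  shows "vec_cond_exp P G f \<in> borel_measurable G"
proof (rule borel_measurable_euclidean_space[THEN iffD2], intro ballI)
  fix b :: "real^'d" assume "b \<in> Basis"
  then obtain i where b: "b = axis i 1"
    by (auto simp: Basis_vec_def)
  show "(\<lambda>x. vec_cond_exp P G f x \<bullet> b) \<in> borel_measurable G"
    unfolding b inner_axis by (simp add: vec_cond_exp_nth)
qed

lemma vec_cond_exp_measurable_P [measurable]: "vec_cond_exp P G f \<in> borel_measurable P"
  by (rule measurable_from_subalg[OF subalg vec_cond_exp_measurable])

lemma vec_cond_exp_charact:
  assumes "integrable P f" "integrable P g" "g \<in> borel_measurable G"
    and "\<And>A i. A \<in> sets G \<Longrightarrow> (\<integral>\<omega>. indicator A \<omega> * f \<omega> $ i \<partial>P) = (\<integral>\<omega>. indicator A \<omega> * g \<omega> $ i \<partial>P)"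
  shows "AE \<omega> in P. vec_cond_exp P G f \<omega> = g \<omega>"
proof (rule AE_vec_eqI)
  fix i
  have [measurable]: "g \<in> borel_measurable G"
    by (rule assms)
  show "AE \<omega> in P. vec_cond_exp P G f \<omega> $ i = g \<omega> $ i"
    unfolding vec_cond_exp_nth
    using assms by (intro real_cond_exp_charact integrable_vec_nth) (auto simp: set_lebesgue_integral_def)
qed

lemma vec_cond_exp_integrable: "integrable P f \<Longrightarrow> integrable P (vec_cond_exp P G f)"
  by (intro integrable_vecI) (auto simp: vec_cond_exp_nth intro!: real_cond_exp_int integrable_vec_nth)

lemma vec_cond_exp_cong:
  assumes "AE \<omega> in P. f \<omega> = g \<omega>" "f \<in> borel_measurable P" "g \<in> borel_measurable P"
  shows "AE \<omega> in P. vec_cond_exp P G f \<omega> = vec_cond_exp P G g \<omega>"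
proof (rule AE_vec_eqI)
  fix i
  have [measurable]: "f \<in> borel_measurable P" "g \<in> borel_measurable P"
    by (rule assms)+
  show "AE \<omega> in P. vec_cond_exp P G f \<omega> $ i = vec_cond_exp P G g \<omega> $ i"
    unfolding vec_cond_exp_nth using assms(1) by (intro real_cond_exp_cong) auto
qed

lemma vec_cond_exp_diff:
  assumes "integrable P f" "integrable P g"
  shows "AE \<omega> in P. vec_cond_exp P G (\<lambda>\<omega>. f \<omega> - g \<omega>) \<omega> = vec_cond_exp P G f \<omega> - vec_cond_exp P G g \<omega>"
  using real_cond_exp_diff[OF integrable_vec_nth[OF assms(1)] integrable_vec_nth[OF assms(2)]]
  by (intro AE_vec_eqI) (simp add: vec_cond_exp_nth)

lemma vec_cond_exp_F_meas:
  assumes "integrable P f" "f \<in> borel_measurable G"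
  shows "AE \<omega> in P. vec_cond_exp P G f \<omega> = f \<omega>"
  using assms by (intro vec_cond_exp_charact) auto

lemma vec_cond_exp_nested:
  assumes "subalgebra P H" "subalgebra H G" "integrable P f"
  shows "AE \<omega> in P. vec_cond_exp P G (vec_cond_exp P H f) \<omega> = vec_cond_exp P G f \<omega>"
proof (rule AE_vec_eqI)
  fix i
  show "AE \<omega> in P. vec_cond_exp P G (vec_cond_exp P H f) \<omega> $ i = vec_cond_exp P G f \<omega> $ i"
    unfolding vec_cond_exp_nth using assms
    by (simp add: vec_cond_exp_def real_cond_exp_nested_subalg[OF assms(1,2)] integrable_vec_nth)
qed

text \<open>Jensen's inequality for the square. The vector version follows by summing over
  coordinates.\<close>

lemma real_cond_exp_L2:
  fixes f :: "'a \<Rightarrow> real"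
  assumes f: "f \<in> L2 P"
  shows "real_cond_exp P G f \<in> L2 P" "msq P (real_cond_exp P G f) \<le> msq P f"
proof -
  have int: "integrable P f" "integrable P (\<lambda>\<omega>. (f \<omega>)\<^sup>2)"
    using L2_integrable[OF finite_measure_axioms f] f by (auto simp: L2_def)
  have cvx: "convex_on UNIV (\<lambda>x::real. x\<^sup>2)"
    using convex_power2 .
  have J: "AE \<omega> in P. (real_cond_exp P G f \<omega>)\<^sup>2 \<le> real_cond_exp P G (\<lambda>\<omega>. (f \<omega>)\<^sup>2) \<omega>"
      "integrable P (\<lambda>\<omega>. (real_cond_exp P G f \<omega>)\<^sup>2)"
    using real_cond_exp_jensens_inequality(2)[OF int(1), where I=UNIV and q="\<lambda>x. x\<^sup>2"]
      integrable_convex_cond_exp[OF int(1), where I=UNIV and q="\<lambda>x. x\<^sup>2"] int(2) cvx by auto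
  show "real_cond_exp P G f \<in> L2 P"
    using J(2) by (intro L2I) auto
  have "msq P (real_cond_exp P G f) \<le> (\<integral>\<omega>. real_cond_exp P G (\<lambda>\<omega>. (f \<omega>)\<^sup>2) \<omega> \<partial>P)"
    unfolding msq_def using J real_cond_exp_int(1)[OF int(2)] by (intro integral_mono_AE) auto
  also have "\<dots> = msq P f"
    unfolding msq_def using real_cond_exp_int(2)[OF int(2)] by simp
  finally show "msq P (real_cond_exp P G f) \<le> msq P f" .
qed

lemma vec_cond_exp_L2:
  fixes f :: "'a \<Rightarrow> real^'d"
  assumes f: "f \<in> L2 P"
  shows "vec_cond_exp P G f \<in> L2 P" "msq P (vec_cond_exp P G f) \<le> msq P f"
proof -
  have sq: "integrable P (\<lambda>\<omega>. (real_cond_exp P G (\<lambda>\<omega>. f \<omega> $ i) \<omega>)\<^sup>2)" for i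
    using real_cond_exp_L2(1)[OF L2_vec_nth[OF f]] by (simp add: L2_def)
  have sqf: "integrable P (\<lambda>\<omega>. (f \<omega> $ i)\<^sup>2)" for i
    using L2_vec_nth[OF f, of i] by (simp add: L2_def)
  show "vec_cond_exp P G f \<in> L2 P"
    using sq by (intro L2I) (auto simp: norm_vec_sq vec_cond_exp_nth)
  have "msq P (vec_cond_exp P G f) = (\<Sum>i\<in>UNIV. msq P (real_cond_exp P G (\<lambda>\<omega>. f \<omega> $ i)))"
    using sq by (simp add: msq_def norm_vec_sq vec_cond_exp_nth Bochner_Integration.integral_sum)
  also have "\<dots> \<le> (\<Sum>i\<in>UNIV. msq P (\<lambda>\<omega>. f \<omega> $ i))"
    by (intro sum_mono real_cond_exp_L2(2) L2_vec_nth f)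
  also have "\<dots> = msq P f"
    using sqf by (simp add: msq_def norm_vec_sq Bochner_Integration.integral_sum)
  finally show "msq P (vec_cond_exp P G f) \<le> msq P f" .
qed

end

context brownian
begin

lemma prob_subalgebra_F: "t \<le> T \<Longrightarrow> prob_subalgebra P (F t)"
  using sigma_finite_F by (intro prob_subalgebra.intro prob_space_axioms)

subsection \<open>Simple integrals are martingales\<close>

text \<open>The martingale property tested against an event of \<open>F r\<close>. The weight
  \<open>indicator A \<omega> * V \<omega>\<close> is known from time \<open>max a r\<close> on, so
  the part of the increment after that time integrates to 0; what remains is the increment stopped
  at \<open>r\<close>.\<close>

lemma integral_increment_stopped:
  fixes V :: "'a \<Rightarrow> real"
  assumes ab: "0 \<le> a" "a \<le> b" "b \<le> T" and r: "0 \<le> r" "r \<le> T"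
    and V: "V \<in> borel_measurable (F a)" "\<And>\<omega>. \<omega> \<in> space P \<Longrightarrow> \<bar>V \<omega>\<bar> \<le> C" and A: "A \<in> sets (F r)"
  shows "(\<integral>\<omega>. indicator A \<omega> * (V \<omega> * (B b \<omega> - B a \<omega>) $ k) \<partial>P)
    = (\<integral>\<omega>. indicator A \<omega> * (V \<omega> * (B (min b r) \<omega> - B (min a r) \<omega>) $ k) \<partial>P)"
proof -
  define W where "W \<omega> = indicator A \<omega> * V \<omega>" for \<omega>
  have WF: "W \<in> borel_measurable (F s)" if "a \<le> s" "r \<le> s" for s
  proof -
    have "A \<in> sets (F s)"
      using A sets_F_mono[OF that(2)] by auto
    then show ?thesis
      unfolding W_def using measurable_F_mono[OF V(1) that(1)]
      by (intro borel_measurable_times borel_measurable_indicator)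
  qed
  have WP: "W \<in> borel_measurable P"
    using WF[of "max a r"] ab r by (intro measurable_F_P[of W "max a r"]) auto
  have WL2: "W \<in> L2 P"
    using V(2) by (intro L2_bounded[OF finite_measure_axioms WP, of "\<bar>C\<bar>"])
      (force simp: W_def indicator_def)
  have int: "integrable P (\<lambda>\<omega>. W \<omega> * (B y \<omega> - B x \<omega>) $ k)" if "0 \<le> x" "x \<le> y" "y \<le> T" for x y
    using L2_inner_integrable[OF WL2 L2_vec_nth[OF increment_L2[OF that]]] by simp
  have g: "(\<lambda>x::real^'m. x $ k) \<in> borel_measurable borel"
    by measurable
  have zero: "(\<integral>\<omega>. W \<omega> * (B b \<omega> - B s \<omega>) $ k \<partial>P) = 0" if "a \<le> s" "r \<le> s" "s \<le> b" for s
  proof -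
    have "0 \<le> s" using that ab by simp
    then show ?thesis
      using integral_F_increment[OF _ that(3) ab(3) WF[OF that(1,2)]
          L2_integrable[OF finite_measure_axioms WL2] g] integrable_increment[OF _ that(3) ab(3)]
        integral_increment[OF _ that(3) ab(3)] by simp
  qed
  have "(\<integral>\<omega>. W \<omega> * (B b \<omega> - B a \<omega>) $ k \<partial>P)
      = (\<integral>\<omega>. W \<omega> * (B (min b r) \<omega> - B (min a r) \<omega>) $ k \<partial>P)"
  proof (cases "r \<le> a")
    case True
    then have "min b r = r" "min a r = r"
      using ab by auto
    then show ?thesis
      using zero[of a] True ab by simp
  next
    case False
    show ?thesis
    proof (cases "b \<le> r")
      case True
      then have "min b r = b" "min a r = a"
        using ab by auto
      then show ?thesis
        by simp
    next
      case b: False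
      have "(\<integral>\<omega>. W \<omega> * (B b \<omega> - B a \<omega>) $ k \<partial>P)
          = (\<integral>\<omega>. W \<omega> * (B b \<omega> - B r \<omega>) $ k + W \<omega> * (B r \<omega> - B a \<omega>) $ k \<partial>P)"
        by (simp add: algebra_simps)
      also have "\<dots> = (\<integral>\<omega>. W \<omega> * (B r \<omega> - B a \<omega>) $ k \<partial>P)"
        using int[of r b] int[of a r] zero[of r] False b ab r
        by (subst Bochner_Integration.integral_add) auto
      finally show ?thesis
        using False b by (simp add: min_absorb1 min_absorb2)
    qed
  qed
  then show ?thesis
    by (simp add: W_def mult.assoc)
qed

text \<open>If \<open>r < a\<close>, the coefficient need not be \<open>F r\<close>-measurable, but
  then both stopped times equal \<open>r\<close> and the increment vanishes.\<close>

lemma simple_term_stopped_measurable: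
  fixes c :: "'a \<Rightarrow> real^'m^'d"
  assumes "0 \<le> a" "a \<le> b" "0 \<le> r" "c \<in> borel_measurable (F a)"
  shows "(\<lambda>\<omega>. c \<omega> *v (B (min b r) \<omega> - B (min a r) \<omega>)) \<in> borel_measurable (F r)"
proof (cases "a \<le> r")
  case True
  then show ?thesis
    using assms by (intro borel_measurable_matrix_vector_mult borel_measurable_diff B_adapted
        measurable_F_mono[OF assms(4)]) auto
next
  case False
  then have "(\<lambda>\<omega>. c \<omega> *v (B (min b r) \<omega> - B (min a r) \<omega>)) = (\<lambda>_. 0)"
    using assms by (auto simp: min_def)
  then show ?thesis by simp
qed

lemma simple_integral_stopped_L2:
  assumes si: "simple_integrand P F t u n \<tau> c" and tu: "0 \<le> t" "u \<le> T" and r: "0 \<le> r" "r \<le> T"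
  shows "simple_integral B n (\<lambda>i. min (\<tau> i) r) c \<in> L2 P"
  unfolding simple_integral_def[abs_def]
proof (rule L2_sum)
  fix i assume "i \<in> {..<n}"
  then have i: "i < n" by simp
  obtain C where C: "\<forall>\<omega>\<in>space P. norm (c i \<omega>) \<le> C"
    using simple_coeff_L2(2)[OF si tu i] by blast
  show "(\<lambda>\<omega>. c i \<omega> *v (B (min (\<tau> (Suc i)) r) \<omega> - B (min (\<tau> i) r) \<omega>)) \<in> L2 P"
    using simple_grid(1)[OF si, of i] simple_grid(2)[OF si, of "Suc i"] simple_grid(3)[OF si i] tu i r
    by (intro bounded_mult_L2[OF simple_coeff_L2(1)[OF si tu i] C] increment_L2) auto
qed

lemma integral_double_sum:
  fixes f :: "nat \<Rightarrow> 'k::finite \<Rightarrow> 'a \<Rightarrow> real"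
  assumes "\<And>i k. i < n \<Longrightarrow> integrable P (f i k)"
  shows "(\<integral>\<omega>. (\<Sum>i<n. \<Sum>k\<in>UNIV. f i k \<omega>) \<partial>P) = (\<Sum>i<n. \<Sum>k\<in>UNIV. \<integral>\<omega>. f i k \<omega> \<partial>P)"
  using assms by (simp add: Bochner_Integration.integral_sum Bochner_Integration.integrable_sum)

lemma cond_exp_simple_integral:
  fixes c :: "nat \<Rightarrow> 'a \<Rightarrow> real^'m^'d"
  assumes si: "simple_integrand P F t u n \<tau> c" and tu: "0 \<le> t" "u \<le> T" and r: "0 \<le> r" "r \<le> T"
  shows "AE \<omega> in P. vec_cond_exp P (F r) (simple_integral B n \<tau> c) \<omega>
    = simple_integral B n (\<lambda>i. min (\<tau> i) r) c \<omega>"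
proof -
  interpret S: prob_subalgebra P "F r"
    by (rule prob_subalgebra_F[OF r(2)])
  have \<tau>: "0 \<le> \<tau> i" "\<tau> i \<le> \<tau> (Suc i)" "\<tau> (Suc i) \<le> T" if "i < n" for i
    using simple_grid(1)[OF si, of i] simple_grid(2)[OF si, of "Suc i"] simple_grid(3)[OF si, of i] tu that
    by auto
  show ?thesis
  proof (rule S.vec_cond_exp_charact)
    show "integrable P (simple_integral B n \<tau> c)"
      using simple_pairs_integral_L2[OF simple_pairsI[OF si] tu] by (rule L2_integrable[OF finite_measure_axioms])
    show "integrable P (simple_integral B n (\<lambda>i. min (\<tau> i) r) c)"
      using simple_integral_stopped_L2[OF si tu r] by (rule L2_integrable[OF finite_measure_axioms])
    show "simple_integral B n (\<lambda>i. min (\<tau> i) r) c \<in> borel_measurable (F r)"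
      unfolding simple_integral_def[abs_def] using \<tau> r simple_grid(4)[OF si]
      by (intro borel_measurable_sum simple_term_stopped_measurable) auto
    fix A and j :: 'd assume A: "A \<in> sets (F r)"
    then have AP: "A \<in> sets P"
      using sets_F_subset[OF r(2)] by auto
    \<comment> \<open>Expanded for an arbitrary monotone grid \<open>\<tau>'\<close>, because it is
      applied both to the given grid and to the grid stopped at \<open>r\<close>.\<close>
    have *: "(\<integral>\<omega>. indicator A \<omega> * simple_integral B n \<tau>' c \<omega> $ j \<partial>P)
        = (\<Sum>i<n. \<Sum>k\<in>UNIV. \<integral>\<omega>. indicator A \<omega> * (c i \<omega> $ j $ k * (B (\<tau>' (Suc i)) \<omega> - B (\<tau>' i) \<omega>) $ k) \<partial>P)"
      if \<tau>': "\<And>i. i < n \<Longrightarrow> 0 \<le> \<tau>' i \<and> \<tau>' i \<le> \<tau>' (Suc i) \<and> \<tau>' (Suc i) \<le> T" for \<tau>'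
    proof -
      have "integrable P (\<lambda>\<omega>. indicator A \<omega> * (c i \<omega> $ j $ k * (B (\<tau>' (Suc i)) \<omega> - B (\<tau>' i) \<omega>) $ k))"
        if i: "i < n" for i k
      proof -
        have "(\<lambda>\<omega>. c i \<omega> $ j $ k) \<in> L2 P"
        proof (rule L2_dominated[OF _ simple_coeff_L2(3)[OF si tu i]])
          show "(\<lambda>\<omega>. c i \<omega> $ j $ k) \<in> borel_measurable P"
            using simple_coeff_L2(1)[OF si tu i] by measurable
          show "AE \<omega> in P. norm (c i \<omega> $ j $ k) \<le> norm (c i \<omega>)"
            using component_le_norm_cart[of "c i _ $ j" k] Finite_Cartesian_Product.norm_nth_le[of "c i _" j]
            by (intro AE_I2) (auto intro: order_trans)
        qed
        moreover have "(\<lambda>\<omega>. (B (\<tau>' (Suc i)) \<omega> - B (\<tau>' i) \<omega>) $ k) \<in> L2 P"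
          using \<tau>'[OF i] by (intro L2_vec_nth increment_L2) auto
        ultimately have "integrable P (\<lambda>\<omega>. c i \<omega> $ j $ k * (B (\<tau>' (Suc i)) \<omega> - B (\<tau>' i) \<omega>) $ k)"
          by (rule L2_inner_integrable[where 'b=real, unfolded inner_real_def])
        from integrable_mult_indicator[OF AP this] show ?thesis
          by (simp only: real_scaleR_def)
      qed
      then have "(\<integral>\<omega>. (\<Sum>i<n. \<Sum>k\<in>UNIV. indicator A \<omega> * (c i \<omega> $ j $ k * (B (\<tau>' (Suc i)) \<omega> - B (\<tau>' i) \<omega>) $ k)) \<partial>P)
        = (\<Sum>i<n. \<Sum>k\<in>UNIV. \<integral>\<omega>. indicator A \<omega> * (c i \<omega> $ j $ k * (B (\<tau>' (Suc i)) \<omega> - B (\<tau>' i) \<omega>) $ k) \<partial>P)"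
        by (rule integral_double_sum)
      moreover have "x * simple_integral B n \<tau>' c \<omega> $ j
          = (\<Sum>i<n. \<Sum>k\<in>UNIV. x * (c i \<omega> $ j $ k * (B (\<tau>' (Suc i)) \<omega> - B (\<tau>' i) \<omega>) $ k))" for x \<omega>
        by (simp add: simple_integral_def matrix_vector_mult_def sum_distrib_left)
      ultimately show ?thesis
        by (simp only:)
    qed
    have "(\<integral>\<omega>. indicator A \<omega> * (c i \<omega> $ j $ k * (B (\<tau> (Suc i)) \<omega> - B (\<tau> i) \<omega>) $ k) \<partial>P)
        = (\<integral>\<omega>. indicator A \<omega> * (c i \<omega> $ j $ k * (B (min (\<tau> (Suc i)) r) \<omega> - B (min (\<tau> i) r) \<omega>) $ k) \<partial>P)"
      if i: "i < n" for i k
    proof -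
      have [measurable]: "c i \<in> borel_measurable (F (\<tau> i))"
        using simple_grid(4)[OF si] i by auto
      obtain C where C: "\<forall>\<omega>\<in>space P. norm (c i \<omega>) \<le> C"
        using simple_coeff_L2(2)[OF si tu i] by blast
      have "\<bar>c i \<omega> $ j $ k\<bar> \<le> C" if "\<omega> \<in> space P" for \<omega>
        using C that component_le_norm_cart[of "c i \<omega> $ j" k]
          Finite_Cartesian_Product.norm_nth_le[of "c i \<omega>" j] by force
      then show ?thesis
        by (intro integral_increment_stopped[OF \<tau>[OF i] r _ _ A]) measurable
    qed
    note stopped = this
    show "(\<integral>\<omega>. indicator A \<omega> * simple_integral B n \<tau> c \<omega> $ j \<partial>P)
        = (\<integral>\<omega>. indicator A \<omega> * simple_integral B n (\<lambda>i. min (\<tau> i) r) c \<omega> $ j \<partial>P)"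
    proof -
      have "0 \<le> min (\<tau> i) r \<and> min (\<tau> i) r \<le> min (\<tau> (Suc i)) r \<and> min (\<tau> (Suc i)) r \<le> T" if "i < n" for i
        using \<tau>[OF that] r by (auto intro: min.mono min.coboundedI2)
      then show ?thesis
        using \<tau> stopped by (subst (1 2) *) auto
    qed
  qed
qed

text \<open>Lets a single approximation on \<open>[0, T]\<close> serve every subinterval: by the
  martingale property the integral of the truncated process is a difference of conditional
  expectations of the one global integral.\<close>

lemma simple_pairs_restrict:
  fixes I :: "'a \<Rightarrow> real^'d"
  assumes e: "(\<phi>, I) \<in> simple_pairs t u" and tu: "0 \<le> t" "u \<le> T" and ab: "t \<le> a" "a \<le> b" "b \<le> u"
  obtains J where "(\<lambda>s \<omega>. indicator {a<..b} s *\<^sub>R \<phi> s \<omega>, J) \<in> simple_pairs a b"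
    "AE \<omega> in P. J \<omega> = vec_cond_exp P (F b) I \<omega> - vec_cond_exp P (F a) I \<omega>"
proof -
  obtain n \<tau> c where si: "simple_integrand P F t u n \<tau> c" and \<phi>: "\<phi> = simple_process n \<tau> c"
      and I: "I = simple_integral B n \<tau> c"
    using e by (rule simple_pairsE)
  \<comment> \<open>Clipping moves grid points beyond \<open>b\<close> back to \<open>b\<close>,
    where their coefficients need not be measurable yet. Setting those coefficients to 0 changes
    nothing, since the clipped intervals have length 0.\<close>
  define \<tau>' where "\<tau>' i = max a (min b (\<tau> i))" for i
  define c' where "c' i \<omega> = (if \<tau> i < b then c i \<omega> else 0)" for i \<omega>
  have si': "simple_integrand P F a b n \<tau>' c'"
    unfolding simple_integrand_def
  proof (intro conjI allI impI)
    fix i assume i: "i < n"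
    show "c' i \<in> borel_measurable (F (\<tau>' i))"
    proof (cases "\<tau> i < b")
      case True
      then have "c' i = c i" "\<tau> i \<le> \<tau>' i"
        by (auto simp: c'_def \<tau>'_def)
      then show ?thesis
        using simple_grid(4)[OF si i] measurable_F_mono by metis
    next
      case False
      then have "c' i = (\<lambda>_. 0)"
        by (auto simp: c'_def)
      then show ?thesis by simp
    qed
    have "bounded (c i ` space P)"
      using si i by (auto simp: simple_integrand_def)
    then have "bounded (insert 0 (c i ` space P))"
      by simp
    then show "bounded (c' i ` space P)"
      by (rule bounded_subset) (auto simp: c'_def)
  next
    fix i assume "i < n"
    then show "\<tau>' i \<le> \<tau>' (Suc i)"
      unfolding \<tau>'_def using simple_grid(3)[OF si] by (intro max.mono min.mono order_refl)
  qed (use ab in \<open>auto simp: \<tau>'_def\<close>)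
  have "simple_process n \<tau>' c' = (\<lambda>s \<omega>. indicator {a<..b} s *\<^sub>R \<phi> s \<omega>)"
    unfolding \<phi> simple_process_def scaleR_sum_right scaleR_scaleR
  proof (intro ext sum.cong refl)
    fix s \<omega> i assume "i \<in> {..<n}"
    then have "\<tau> i \<le> \<tau> (Suc i)"
      using simple_grid(3)[OF si, of i] by simp
    then show "indicator {\<tau>' i<..\<tau>' (Suc i)} s *\<^sub>R c' i \<omega>
        = (indicator {a<..b} s * indicator {\<tau> i<..\<tau> (Suc i)} s) *\<^sub>R c i \<omega>"
      using ab by (auto simp: c'_def \<tau>'_def indicator_def min_def max_def)
  qed
  then have p: "(\<lambda>s \<omega>. indicator {a<..b} s *\<^sub>R \<phi> s \<omega>, simple_integral B n \<tau>' c') \<in> simple_pairs a b"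
    using simple_pairsI[OF si'] by simp
  have J: "simple_integral B n \<tau>' c' \<omega>
      = simple_integral B n (\<lambda>i. min (\<tau> i) b) c \<omega> - simple_integral B n (\<lambda>i. min (\<tau> i) a) c \<omega>" for \<omega>
    unfolding simple_integral_def sum_subtractf[symmetric]
  proof (intro sum.cong refl)
    fix i assume "i \<in> {..<n}"
    then have "\<tau> i \<le> \<tau> (Suc i)"
      using simple_grid(3)[OF si, of i] by simp
    then show "c' i \<omega> *v (B (\<tau>' (Suc i)) \<omega> - B (\<tau>' i) \<omega>)
        = c i \<omega> *v (B (min (\<tau> (Suc i)) b) \<omega> - B (min (\<tau> i) b) \<omega>)
          - c i \<omega> *v (B (min (\<tau> (Suc i)) a) \<omega> - B (min (\<tau> i) a) \<omega>)"
      using ab unfolding matrix_vector_mult_diff_distrib[symmetric]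
      by (auto simp: c'_def \<tau>'_def min_def max_def algebra_simps)
  qed
  have "0 \<le> a" "a \<le> T" "0 \<le> b" "b \<le> T"
    using tu ab by auto
  then have "AE \<omega> in P. simple_integral B n \<tau>' c' \<omega> = vec_cond_exp P (F b) I \<omega> - vec_cond_exp P (F a) I \<omega>"
    using cond_exp_simple_integral[OF si tu, of b] cond_exp_simple_integral[OF si tu, of a]
    unfolding I J by auto
  then show ?thesis
    by (rule that[OF p])
qed

section \<open>The Ito integral as an \<open>L2\<close> limit\<close>

lemma is_ito_integral_iff:
  fixes z :: "real \<Rightarrow> 'a \<Rightarrow> real^'m^'d"
  shows "is_ito_integral P F B t u z I \<longleftrightarrow> I \<in> Lp P (F u) 2 \<and>
    (\<exists>\<phi> J. (\<forall>k::nat. (\<phi> k, J k) \<in> simple_pairs t u) \<and>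
      (\<lambda>k. msq (PQ t u) (\<lambda>(s, \<omega>). \<phi> k s \<omega> - z s \<omega>)) \<longlonglongrightarrow> 0 \<and>
      (\<lambda>k. msq P (\<lambda>\<omega>. J k \<omega> - I \<omega>)) \<longlonglongrightarrow> 0)" (is "?L \<longleftrightarrow> ?R")
proof
  assume ?L
  then obtain n \<tau> c where *: "I \<in> Lp P (F u) 2" "\<And>k. simple_integrand P F t u (n k) (\<tau> k) (c k)"
    "(\<lambda>k. \<integral>(s, \<omega>). (norm (simple_process (n k) (\<tau> k) (c k) s \<omega> - z s \<omega>))\<^sup>2 \<partial>PQ t u) \<longlonglongrightarrow> 0"
    "(\<lambda>k. \<integral>\<omega>. (norm (simple_integral B (n k) (\<tau> k) (c k) \<omega> - I \<omega>))\<^sup>2 \<partial>P) \<longlonglongrightarrow> 0"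
    unfolding is_ito_integral_def by blast
  then show ?R
    by (intro conjI exI[of _ "\<lambda>k. simple_process (n k) (\<tau> k) (c k)"]
        exI[of _ "\<lambda>k. simple_integral B (n k) (\<tau> k) (c k)"] allI simple_pairsI)
      (simp_all add: msq_def case_prod_unfold)
next
  assume ?R
  then obtain \<phi> J where *: "I \<in> Lp P (F u) 2" "\<And>k. (\<phi> k, J k) \<in> simple_pairs t u"
    "(\<lambda>k. msq (PQ t u) (\<lambda>(s, \<omega>). \<phi> k s \<omega> - z s \<omega>)) \<longlonglongrightarrow> 0"
    "(\<lambda>k. msq P (\<lambda>\<omega>. J k \<omega> - I \<omega>)) \<longlonglongrightarrow> 0"
    by blast
  then have "\<exists>n \<tau> c. simple_integrand P F t u n \<tau> c \<and> \<phi> k = simple_process n \<tau> c \<and> J k = simple_integral B n \<tau> c" for k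
    using *(2)[of k] by (auto simp: simple_pairs_def)
  then obtain n \<tau> c where "\<And>k. simple_integrand P F t u (n k) (\<tau> k) (c k)"
      "\<And>k. \<phi> k = simple_process (n k) (\<tau> k) (c k)" "\<And>k. J k = simple_integral B (n k) (\<tau> k) (c k)"
    by metis
  then show ?L
    using * unfolding is_ito_integral_def
    by (intro conjI exI[of _ n] exI[of _ \<tau>] exI[of _ c]) (simp_all add: msq_def case_prod_unfold)
qed

lemma is_ito_integral_unique:
  fixes z :: "real \<Rightarrow> 'a \<Rightarrow> real^'m^'d"
  assumes z: "(\<lambda>(s, \<omega>). z s \<omega>) \<in> L2 (PQ t u)" and tu: "0 \<le> t" "u \<le> T"
    and I: "is_ito_integral P F B t u z I" and I': "is_ito_integral P F B t u z I'"
  shows "AE \<omega> in P. I \<omega> = I' \<omega>"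
proof -
  obtain \<phi> J where 1: "I \<in> Lp P (F u) 2" "\<And>k. (\<phi> k, J k) \<in> simple_pairs t u"
    "(\<lambda>k::nat. msq (PQ t u) (\<lambda>(s, \<omega>). \<phi> k s \<omega> - z s \<omega>)) \<longlonglongrightarrow> 0" "(\<lambda>k. msq P (\<lambda>\<omega>. J k \<omega> - I \<omega>)) \<longlonglongrightarrow> 0"
    using I unfolding is_ito_integral_iff by blast
  obtain \<psi> K where 2: "I' \<in> Lp P (F u) 2" "\<And>k. (\<psi> k, K k) \<in> simple_pairs t u"
    "(\<lambda>k::nat. msq (PQ t u) (\<lambda>(s, \<omega>). \<psi> k s \<omega> - z s \<omega>)) \<longlonglongrightarrow> 0" "(\<lambda>k. msq P (\<lambda>\<omega>. K k \<omega> - I' \<omega>)) \<longlonglongrightarrow> 0"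
    using I' unfolding is_ito_integral_iff by blast
  have L2: "I \<in> L2 P" "I' \<in> L2 P" "J k \<in> L2 P" "K k \<in> L2 P" for k
    using 1(1) 2(1) simple_pairs_integral_L2[OF 1(2) tu] simple_pairs_integral_L2[OF 2(2) tu] tu
    by (auto simp: Lp_2_iff L2_def intro: measurable_F_P)
  let ?a = "\<lambda>k. 4 * (msq (PQ t u) (\<lambda>(s, \<omega>). \<phi> k s \<omega> - z s \<omega>) + msq (PQ t u) (\<lambda>(s, \<omega>). \<psi> k s \<omega> - z s \<omega>)
      + msq P (\<lambda>\<omega>. J k \<omega> - I \<omega>) + msq P (\<lambda>\<omega>. K k \<omega> - I' \<omega>))"
  have "?a \<longlonglongrightarrow> 4 * (0 + 0 + 0 + 0)"
    by (intro tendsto_intros 1 2)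
  then have lim: "?a \<longlonglongrightarrow> 0" by simp
  \<comment> \<open>Chains three quadratic triangle inequalities along I, J, K, I', where the
    isometry replaces the distance of J and K by that of \<open>\<phi> k\<close> and
    \<open>\<psi> k\<close>: x <= 2a + 2y <= 2a + 4w + 4c <= 2a + 8p + 8q + 4c.\<close>
  have arith: "x \<le> 2 * (4 * (p + q + a + c))"
    if "w \<le> 2 * p + 2 * q" "x \<le> 2 * a + 2 * y" "y \<le> 2 * w + 2 * c" "0 \<le> a" "0 \<le> c" for a c p q w x y :: real
    using that by (simp add: algebra_simps)
  have le: "msq P (\<lambda>\<omega>. I \<omega> - I' \<omega>) \<le> 2 * ?a k" for k
  proof -
    have iso: "msq P (\<lambda>\<omega>. J k \<omega> - K k \<omega>) = msq (PQ t u) (\<lambda>(s, \<omega>). \<phi> k s \<omega> - \<psi> k s \<omega>)"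
      using simple_pairs_isometry(2)[OF simple_pairs_diff[OF 1(2) 2(2)] tu] by simp
    also have "\<dots> \<le> 2 * msq (PQ t u) (\<lambda>(s, \<omega>). \<phi> k s \<omega> - z s \<omega>) + 2 * msq (PQ t u) (\<lambda>(s, \<omega>). \<psi> k s \<omega> - z s \<omega>)"
      using msq_triangle3[OF simple_pairs_isometry(1)[OF 1(2) tu] z simple_pairs_isometry(1)[OF 2(2) tu], of k k]
        msq_minus_commute[of "PQ t u" "\<lambda>(s, \<omega>). z s \<omega>" "\<lambda>(s, \<omega>). \<psi> k s \<omega>"]
      by (simp add: case_prod_unfold)
    finally have "msq P (\<lambda>\<omega>. J k \<omega> - K k \<omega>) \<le> \<dots>" .
    moreover have "msq P (\<lambda>\<omega>. I \<omega> - I' \<omega>) \<le> 2 * msq P (\<lambda>\<omega>. J k \<omega> - I \<omega>) + 2 * msq P (\<lambda>\<omega>. J k \<omega> - I' \<omega>)"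
      using msq_triangle3[OF L2(1) L2(3)[of k] L2(2)] msq_minus_commute[of P I "J k"] by simp
    moreover have "msq P (\<lambda>\<omega>. J k \<omega> - I' \<omega>) \<le> 2 * msq P (\<lambda>\<omega>. J k \<omega> - K k \<omega>) + 2 * msq P (\<lambda>\<omega>. K k \<omega> - I' \<omega>)"
      by (rule msq_triangle3[OF L2(3,4,2)])
    moreover have "0 \<le> msq P (\<lambda>\<omega>. J k \<omega> - I \<omega>)" "0 \<le> msq P (\<lambda>\<omega>. K k \<omega> - I' \<omega>)"
      by simp_all
    ultimately show ?thesis
      by (rule arith)
  qed
  have "(\<lambda>k. 2 * ?a k) \<longlonglongrightarrow> 2 * 0"
    by (intro tendsto_intros lim)
  then have "msq P (\<lambda>\<omega>. I \<omega> - I' \<omega>) \<le> 2 * 0"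
    using le by (intro LIMSEQ_le_const) auto
  then have "msq P (\<lambda>\<omega>. I \<omega> - I' \<omega>) = 0"
    using msq_nonneg[of P "\<lambda>\<omega>. I \<omega> - I' \<omega>"] by linarith
  then show ?thesis
    using msq_zero_AE[OF L2_diff[OF L2(1,2)]] by simp
qed

text \<open>\<open>PQ a b\<close> and \<open>PQ t u\<close> live on different spaces, so restricting
  a function in time means composing it with the identity.\<close>

lemma PQ_ident_measurable:
  assumes "t \<le> a" "b \<le> u"
  shows "(\<lambda>p. p) \<in> measurable (PQ a b) (PQ t u)"
proof -
  have "(\<lambda>s. s) \<in> measurable (restrict_space lborel {a..b}) (restrict_space lborel {t..u})"
    using assms by (intro measurable_restrict_space2 measurable_restrict_space1)
      (auto simp: space_restrict_space)
  then have "(\<lambda>p. (fst p, snd p)) \<in> measurable (PQ a b) (PQ t u)"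
    by (intro measurable_Pair measurable_snd measurable_compose[OF measurable_fst])
  then show ?thesis by simp
qed

text \<open>Fubini's theorem moves the time restriction into an indicator on the line, where the two
  intervals can be compared.\<close>

lemma PQ_nn_integral_mono:
  assumes ab: "t \<le> a" "b \<le> u" and f: "f \<in> borel_measurable (PQ t u)"
  shows "(\<integral>\<^sup>+p. f p \<partial>PQ a b) \<le> (\<integral>\<^sup>+p. f p \<partial>PQ t u)"
proof -
  have eq: "(\<integral>\<^sup>+p. f p \<partial>PQ x y) = (\<integral>\<^sup>+s. (\<integral>\<^sup>+\<omega>. f (s, \<omega>) \<partial>P) * indicator {x..y} s \<partial>lborel)"
    if "f \<in> borel_measurable (PQ x y)" for x y
    using nn_integral_fst[OF that] by (subst (asm) nn_integral_restrict_space) auto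
  have "f \<in> borel_measurable (PQ a b)"
    using measurable_compose[OF PQ_ident_measurable[OF ab] f] .
  then show ?thesis
    using eq[OF f] eq[of a b] ab by (auto intro!: nn_integral_mono simp: indicator_def)
qed

lemma L2_PQ_mono:
  fixes f :: "real \<times> 'a \<Rightarrow> 'b::euclidean_space"
  assumes ab: "t \<le> a" "b \<le> u" and f: "f \<in> L2 (PQ t u)"
  shows "f \<in> L2 (PQ a b)" "msq (PQ a b) f \<le> msq (PQ t u) f"
proof -
  have m: "f \<in> borel_measurable (PQ t u)" "f \<in> borel_measurable (PQ a b)"
    using f measurable_compose[OF PQ_ident_measurable[OF ab]] by (auto simp: L2_def)
  have [measurable]: "(\<lambda>p. ennreal ((norm (f p))\<^sup>2)) \<in> borel_measurable (PQ t u)"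
    using m(1) by measurable
  have le: "(\<integral>\<^sup>+p. ennreal ((norm (f p))\<^sup>2) \<partial>PQ a b) \<le> (\<integral>\<^sup>+p. ennreal ((norm (f p))\<^sup>2) \<partial>PQ t u)"
    by (rule PQ_nn_integral_mono[OF ab]) measurable
  then show L2: "f \<in> L2 (PQ a b)"
    using f m by (simp add: L2_nn_integral le_less_trans)
  have "ennreal (msq (PQ a b) f) \<le> ennreal (msq (PQ t u) f)"
    using le L2_integrable_sq[OF L2] L2_integrable_sq[OF f]
    by (simp add: msq_def nn_integral_eq_integral)
  then show "msq (PQ a b) f \<le> msq (PQ t u) f"
    by (simp add: ennreal_le_iff)
qed

lemma progressive_ident_measurable:
  assumes "u \<le> T"
  shows "(\<lambda>p. p) \<in> measurable (PQ t u) (restrict_space borel {t..u} \<Otimes>\<^sub>M F u)"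
proof -
  have "(\<lambda>s. s) \<in> measurable (restrict_space lborel {t..u}) (restrict_space borel {t..u})"
    by (intro measurable_restrict_space2 measurable_restrict_space1) (auto simp: space_restrict_space)
  moreover have "(\<lambda>\<omega>. \<omega>) \<in> measurable P (F u)"
    by (rule measurable_from_subalg[OF subalgebra_F[OF assms]]) simp
  ultimately have "(\<lambda>p. (fst p, snd p)) \<in> measurable (PQ t u) (restrict_space borel {t..u} \<Otimes>\<^sub>M F u)"
    by (intro measurable_Pair measurable_compose[OF measurable_fst] measurable_compose[OF measurable_snd])
  then show ?thesis by simp
qed

lemma L2_progressive_L2:
  assumes z: "z \<in> L2_progressive P F t T" and u: "t \<le> u" "u \<le> T"
  shows "(\<lambda>(s, \<omega>). z s \<omega>) \<in> L2 (PQ t u)"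
proof (rule L2_PQ_mono(1)[of t t u T])
  have "(\<lambda>(s, \<omega>). z s \<omega>) \<in> borel_measurable (restrict_space borel {t..T} \<Otimes>\<^sub>M F T)"
    using z u by (auto simp: L2_progressive_def)
  from measurable_compose[OF progressive_ident_measurable this]
  show "(\<lambda>(s, \<omega>). z s \<omega>) \<in> L2 (PQ t T)"
    using z by (auto simp: L2_progressive_def L2_def case_prod_unfold)
qed (use u in auto)

text \<open>The choice in \<open>ito_integral\<close> carries information only once some version is
  known to exist, hence the last hypothesis; uniqueness then identifies the choice with that
  version.\<close>

lemma ito_integral_eq:
  fixes z :: "real \<Rightarrow> 'a \<Rightarrow> real^'m^'d"
  assumes "z \<in> L2_progressive P F t T" "0 \<le> t" "t \<le> u" "u \<le> T" "is_ito_integral P F B t u z I"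
  shows "ito_integral P F B t u z \<in> Lp P (F u) 2" "AE \<omega> in P. ito_integral P F B t u z \<omega> = I \<omega>"
proof -
  have *: "is_ito_integral P F B t u z (ito_integral P F B t u z)"
    unfolding ito_integral_def by (rule someI[of "\<lambda>I. is_ito_integral P F B t u z I", OF assms(5)])
  then show "ito_integral P F B t u z \<in> Lp P (F u) 2"
    by (simp add: is_ito_integral_def)
  show "AE \<omega> in P. ito_integral P F B t u z \<omega> = I \<omega>"
    by (rule is_ito_integral_unique[OF L2_progressive_L2[OF assms(1,3,4)] assms(2,4) * assms(5)])
qed

end

section \<open>Density of the simple integrals\<close>

lemma L2_scaleR_left:
  assumes "f \<in> L2 P"
  shows "(\<lambda>\<omega>. f \<omega> *\<^sub>R v) \<in> L2 P"
  using assms by (auto simp: L2_def power_mult_distrib)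

lemma msq_scaleR_left: "msq P (\<lambda>\<omega>. f \<omega> *\<^sub>R v) = (norm v)\<^sup>2 * msq P (f :: 'a \<Rightarrow> real)"
  by (simp add: msq_def power_mult_distrib mult.commute)

lemma bounded_mult_L2_complex:
  fixes w X :: "'a \<Rightarrow> complex"
  assumes "w \<in> borel_measurable P" "\<And>\<omega>. norm (w \<omega>) \<le> 1" "X \<in> L2 P"
  shows "(\<lambda>\<omega>. w \<omega> * X \<omega>) \<in> L2 P" "msq P (\<lambda>\<omega>. w \<omega> * X \<omega>) \<le> msq P X"
proof -
  have le: "norm (w \<omega> * X \<omega>) \<le> norm (X \<omega>)" for \<omega>
    using assms(2)[of \<omega>] mult_right_mono[of "norm (w \<omega>)" 1 "norm (X \<omega>)"] by (simp add: norm_mult)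
  show "(\<lambda>\<omega>. w \<omega> * X \<omega>) \<in> L2 P"
    using assms(1) L2_measurable[OF assms(3)] le by (intro L2_dominated[OF _ assms(3)]) auto
  show "msq P (\<lambda>\<omega>. w \<omega> * X \<omega>) \<le> msq P X"
    using le by (intro msq_mono assms) auto
qed

text \<open>A hybrid argument: the factors \<open>z j\<close> are exchanged for \<open>q j\<close>
  one at a time, and \<open>a i\<close> is the product in which the first \<open>i\<close> factors
  are still of the first kind.\<close>

lemma prod_diff_telescope:
  fixes z q :: "nat \<Rightarrow> 'c::comm_ring_1"
  shows "(\<Prod>j<N. z j) - (\<Prod>j<N. q j) = (\<Sum>i<N. (\<Prod>j<i. z j) * (\<Prod>j\<in>{Suc i..<N}. q j) * (z i - q i))"
proof -
  define a where "a i = (\<Prod>j<i. z j) * (\<Prod>j\<in>{i..<N}. q j)" for i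
  have "a (Suc i) - a i = (\<Prod>j<i. z j) * (\<Prod>j\<in>{Suc i..<N}. q j) * (z i - q i)" if "i < N" for i
    using that by (simp add: a_def prod.atLeast_Suc_lessThan[of i N q] algebra_simps)
  then have "(\<Sum>i<N. (\<Prod>j<i. z j) * (\<Prod>j\<in>{Suc i..<N}. q j) * (z i - q i)) = (\<Sum>i<N. a (Suc i) - a i)"
    by (intro sum.cong) auto
  also have "\<dots> = a N - a 0"
    by (rule sum_lessThan_telescope)
  finally show ?thesis
    by (simp add: a_def atLeast0LessThan)
qed

lemma cis_linear_error: "norm (cis x - 1 - \<i> * x) \<le> x\<^sup>2 / 2"
  using iexp_approx1[of x 1] by (simp add: cis_conv_exp algebra_simps power2_eq_square)

lemma cis_sum: "finite A \<Longrightarrow> cis (\<Sum>i\<in>A. f i) = (\<Prod>i\<in>A. cis (f i))"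
  by (induction A rule: finite_induct) (auto simp: cis_mult[symmetric])

text \<open>The derivative of the sine at 0. It recovers an unbounded linear function from bounded
  trigonometric ones, which is how \<open>B\<close> itself becomes measurable for the sigma-field
  they generate.\<close>

lemma scaled_sin_tendsto:
  fixes x :: real
  shows "(\<lambda>n. real (Suc n) * sin (x / real (Suc n))) \<longlonglongrightarrow> x"
proof -
  have "((\<lambda>h. sin (x * h)) has_real_derivative cos (x * 0) * x) (at 0)"
    by (auto intro!: derivative_eq_intros)
  then have "((\<lambda>h. (sin (x * (0 + h)) - sin (x * 0)) / h) \<longlongrightarrow> x) (at 0)"
    using DERIV_D by fastforce
  moreover have "filterlim (\<lambda>n. inverse (real (Suc n))) (at 0) sequentially"
    using LIMSEQ_inverse_real_of_nat by (auto simp: filterlim_at intro!: always_eventually)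
  ultimately have "(\<lambda>n. (sin (x * (0 + inverse (real (Suc n)))) - sin (x * 0)) / inverse (real (Suc n))) \<longlonglongrightarrow> x"
    by (rule filterlim_compose)
  then show ?thesis
    by (simp add: divide_inverse mult.commute)
qed

section \<open>The mean-square closure of constants plus simple integrals\<close>

context brownian
begin

definition ito_closure :: "('a \<Rightarrow> real^'d) set" where
  "ito_closure = {X \<in> L2 P. \<forall>e>0. \<exists>x \<phi> I. (\<phi>, I) \<in> simple_pairs 0 T \<and> msq P (\<lambda>\<omega>. X \<omega> - (x + I \<omega>)) < e}"

lemma ito_closure_L2: "X \<in> ito_closure \<Longrightarrow> X \<in> L2 P"
  by (simp add: ito_closure_def)

lemma const_L2: "(\<lambda>_. x) \<in> L2 P"
  by (rule L2_bounded[OF finite_measure_axioms, of _ "norm x"]) simp_all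

lemma simple_pairs_L2: "(\<phi>, I) \<in> simple_pairs 0 T \<Longrightarrow> I \<in> L2 P"
  by (rule simple_pairs_integral_L2[OF _ order_refl order_refl])

lemma ito_closureE:
  assumes "X \<in> ito_closure" "0 < e"
  obtains x \<phi> I where "(\<phi>, I) \<in> simple_pairs 0 T" "msq P (\<lambda>\<omega>. X \<omega> - (x + I \<omega>)) < e"
  using assms by (auto simp: ito_closure_def)

lemma ito_closureI:
  assumes "X \<in> L2 P"
    and "\<And>e. 0 < e \<Longrightarrow> \<exists>x \<phi> I. (\<phi>, I) \<in> simple_pairs 0 T \<and> msq P (\<lambda>\<omega>. X \<omega> - (x + I \<omega>)) < e"
  shows "X \<in> ito_closure"
  using assms by (auto simp: ito_closure_def)

lemma ito_closure_elem:
  assumes "(\<phi>, I) \<in> simple_pairs 0 T"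
  shows "(\<lambda>\<omega>. x + I \<omega>) \<in> ito_closure"
proof (rule ito_closureI)
  show "(\<lambda>\<omega>. x + I \<omega>) \<in> L2 P"
    by (intro L2_add const_L2 simple_pairs_L2[OF assms])
  fix e :: real assume "0 < e"
  then show "\<exists>y \<psi> J. (\<psi>, J) \<in> simple_pairs 0 T \<and> msq P (\<lambda>\<omega>. x + I \<omega> - (y + J \<omega>)) < e"
    using assms by (intro exI[of _ x] exI[of _ \<phi>] exI[of _ I]) (simp add: msq_def)
qed

lemma ito_closure_limit:
  assumes X: "X \<in> L2 P" and lim: "\<And>e. 0 < e \<Longrightarrow> \<exists>Y\<in>ito_closure. msq P (\<lambda>\<omega>. X \<omega> - Y \<omega>) < e"
  shows "X \<in> ito_closure"
proof (rule ito_closureI[OF X])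
  fix e :: real assume "0 < e"
  then obtain Y where Y: "Y \<in> ito_closure" "msq P (\<lambda>\<omega>. X \<omega> - Y \<omega>) < e / 4"
    using lim[of "e / 4"] by auto
  have "0 < e / 4"
    using \<open>0 < e\<close> by simp
  obtain x \<phi> I where I: "(\<phi>, I) \<in> simple_pairs 0 T" "msq P (\<lambda>\<omega>. Y \<omega> - (x + I \<omega>)) < e / 4"
    using ito_closureE[OF Y(1) \<open>0 < e / 4\<close>] by blast
  have "msq P (\<lambda>\<omega>. X \<omega> - (x + I \<omega>)) \<le> 2 * msq P (\<lambda>\<omega>. X \<omega> - Y \<omega>) + 2 * msq P (\<lambda>\<omega>. Y \<omega> - (x + I \<omega>))"
    by (intro msq_triangle3 X ito_closure_L2[OF Y(1)] L2_add const_L2 simple_pairs_L2[OF I(1)])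
  also have "\<dots> < e"
    using Y(2) I(2) by simp
  finally show "\<exists>x \<phi> I. (\<phi>, I) \<in> simple_pairs 0 T \<and> msq P (\<lambda>\<omega>. X \<omega> - (x + I \<omega>)) < e"
    using I(1) by blast
qed

lemma ito_closure_AE:
  fixes X Y :: "'a \<Rightarrow> real^'d"
  assumes "Y \<in> ito_closure" "X \<in> borel_measurable P" "AE \<omega> in P. X \<omega> = Y \<omega>"
  shows "X \<in> ito_closure"
proof (rule ito_closure_limit)
  have Y: "Y \<in> L2 P" and [measurable]: "Y \<in> borel_measurable P" "X \<in> borel_measurable P"
    using assms ito_closure_L2 L2_measurable by auto
  show "X \<in> L2 P"
    using assms by (intro L2_dominated[OF _ Y]) auto
  have "msq P (\<lambda>\<omega>. X \<omega> - Y \<omega>) = msq P (\<lambda>\<omega>. 0::real^'d)"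
    using assms(3) by (intro msq_cong_AE) auto
  then show "\<exists>Y\<in>ito_closure. msq P (\<lambda>\<omega>. X \<omega> - Y \<omega>) < e" if "0 < e" for e
    using assms(1) that by (intro bexI[of _ Y]) (simp_all add: msq_def)
qed

lemma ito_closure_add:
  assumes "X \<in> ito_closure" "Y \<in> ito_closure"
  shows "(\<lambda>\<omega>. X \<omega> + Y \<omega>) \<in> ito_closure"
proof (rule ito_closure_limit)
  show "(\<lambda>\<omega>. X \<omega> + Y \<omega>) \<in> L2 P"
    using assms by (intro L2_add ito_closure_L2)
  fix e :: real assume "0 < e"
  then have "0 < e / 4" by simp
  obtain x \<phi> I where I: "(\<phi>, I) \<in> simple_pairs 0 T" "msq P (\<lambda>\<omega>. X \<omega> - (x + I \<omega>)) < e / 4"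
    using ito_closureE[OF assms(1) \<open>0 < e / 4\<close>] by blast
  obtain y \<psi> J where J: "(\<psi>, J) \<in> simple_pairs 0 T" "msq P (\<lambda>\<omega>. Y \<omega> - (y + J \<omega>)) < e / 4"
    using ito_closureE[OF assms(2) \<open>0 < e / 4\<close>] by blast
  have "msq P (\<lambda>\<omega>. (X \<omega> - (x + I \<omega>)) + (Y \<omega> - (y + J \<omega>)))
      \<le> 2 * msq P (\<lambda>\<omega>. X \<omega> - (x + I \<omega>)) + 2 * msq P (\<lambda>\<omega>. Y \<omega> - (y + J \<omega>))"
    by (intro msq_add_le L2_diff L2_add const_L2 simple_pairs_L2[OF I(1)] simple_pairs_L2[OF J(1)] ito_closure_L2 assms)
  also have "\<dots> < e"
    using I(2) J(2) by simp
  finally have "msq P (\<lambda>\<omega>. X \<omega> + Y \<omega> - ((x + y) + (I \<omega> + J \<omega>))) < e"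
    by (simp add: algebra_simps)
  then show "\<exists>Z\<in>ito_closure. msq P (\<lambda>\<omega>. X \<omega> + Y \<omega> - Z \<omega>) < e"
    by (rule bexI[OF _ ito_closure_elem[OF simple_pairs_add[OF I(1) J(1)]]])
qed

lemma ito_closure_scale:
  assumes "X \<in> ito_closure"
  shows "(\<lambda>\<omega>. r *\<^sub>R X \<omega>) \<in> ito_closure"
proof (rule ito_closure_limit)
  show "(\<lambda>\<omega>. r *\<^sub>R X \<omega>) \<in> L2 P"
    using assms by (intro L2_scale ito_closure_L2)
  fix e :: real assume "0 < e"
  then have "0 < e / (r\<^sup>2 + 1)"
    by (simp add: add_nonneg_pos)
  then obtain x \<phi> I where I: "(\<phi>, I) \<in> simple_pairs 0 T" "msq P (\<lambda>\<omega>. X \<omega> - (x + I \<omega>)) < e / (r\<^sup>2 + 1)"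
    using ito_closureE[OF assms] by blast
  have "msq P (\<lambda>\<omega>. r *\<^sub>R X \<omega> - (r *\<^sub>R x + r *\<^sub>R I \<omega>)) = r\<^sup>2 * msq P (\<lambda>\<omega>. X \<omega> - (x + I \<omega>))"
    by (simp only: scaleR_add_right[symmetric] scaleR_diff_right[symmetric] msq_scale)
  also have "\<dots> \<le> (r\<^sup>2 + 1) * msq P (\<lambda>\<omega>. X \<omega> - (x + I \<omega>))"
    by (intro mult_right_mono) auto
  also have "\<dots> < e"
    using I(2) by (simp add: pos_less_divide_eq add_nonneg_pos mult.commute)
  finally show "\<exists>Y\<in>ito_closure. msq P (\<lambda>\<omega>. r *\<^sub>R X \<omega> - Y \<omega>) < e"
    by (rule bexI[OF _ ito_closure_elem[OF simple_pairs_scale[OF I(1)]]])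
qed

lemma ito_closure_const: "(\<lambda>\<omega>. x) \<in> ito_closure"
  using ito_closure_elem[OF simple_pairs_zero] T_pos by simp

lemma ito_closure_sum: "finite A \<Longrightarrow> (\<And>i. i \<in> A \<Longrightarrow> X i \<in> ito_closure) \<Longrightarrow> (\<lambda>\<omega>. \<Sum>i\<in>A. X i \<omega>) \<in> ito_closure"
  by (induction A rule: finite_induct) (auto intro: ito_closure_add ito_closure_const)

text \<open>Reduces density for vector values to real functions: \<open>v\<close> is a fixed
  direction, in the end a coordinate axis.\<close>

definition scalar_closure :: "real^'d \<Rightarrow> ('a \<Rightarrow> real) set" where
  "scalar_closure v = {f. (\<lambda>\<omega>. f \<omega> *\<^sub>R v) \<in> ito_closure}"

lemma scalar_closure_add: "f \<in> scalar_closure v \<Longrightarrow> g \<in> scalar_closure v \<Longrightarrow> (\<lambda>\<omega>. f \<omega> + g \<omega>) \<in> scalar_closure v"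
  unfolding scalar_closure_def using ito_closure_add by (auto simp: scaleR_add_left)

lemma scalar_closure_cmult: "f \<in> scalar_closure v \<Longrightarrow> (\<lambda>\<omega>. r * f \<omega>) \<in> scalar_closure v"
  unfolding scalar_closure_def using ito_closure_scale by (fastforce simp: scaleR_scaleR[symmetric] simp del: scaleR_scaleR)

lemma scalar_closure_diff: "f \<in> scalar_closure v \<Longrightarrow> g \<in> scalar_closure v \<Longrightarrow> (\<lambda>\<omega>. f \<omega> - g \<omega>) \<in> scalar_closure v"
  using scalar_closure_add[of f v "\<lambda>\<omega>. -1 * g \<omega>"] scalar_closure_cmult[of g v "-1"] by simp

lemma scalar_closure_const: "(\<lambda>\<omega>. r) \<in> scalar_closure v"
  unfolding scalar_closure_def by (simp add: ito_closure_const)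

lemma scalar_closure_sum: "finite A \<Longrightarrow> (\<And>i. i \<in> A \<Longrightarrow> f i \<in> scalar_closure v) \<Longrightarrow> (\<lambda>\<omega>. \<Sum>i\<in>A. f i \<omega>) \<in> scalar_closure v"
  by (induction A rule: finite_induct) (auto intro: scalar_closure_add scalar_closure_const)

lemma scalar_closure_AE:
  assumes "g \<in> scalar_closure v" "f \<in> borel_measurable P" "AE \<omega> in P. f \<omega> = g \<omega>"
  shows "f \<in> scalar_closure v"
  using assms unfolding scalar_closure_def by (auto intro!: ito_closure_AE[of "\<lambda>\<omega>. g \<omega> *\<^sub>R v"])

lemma scalar_closure_limit:
  assumes f: "f \<in> L2 P" and lim: "\<And>e. 0 < e \<Longrightarrow> \<exists>g\<in>scalar_closure v. msq P (\<lambda>\<omega>. f \<omega> - g \<omega>) < e"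
  shows "f \<in> scalar_closure v"
  unfolding scalar_closure_def
proof (intro CollectI ito_closure_limit L2_scaleR_left f)
  fix e :: real assume "0 < e"
  then have "0 < e / ((norm v)\<^sup>2 + 1)"
    by (simp add: add_nonneg_pos)
  then obtain g where g: "g \<in> scalar_closure v" "msq P (\<lambda>\<omega>. f \<omega> - g \<omega>) < e / ((norm v)\<^sup>2 + 1)"
    using lim by blast
  have "msq P (\<lambda>\<omega>. f \<omega> *\<^sub>R v - g \<omega> *\<^sub>R v) = (norm v)\<^sup>2 * msq P (\<lambda>\<omega>. f \<omega> - g \<omega>)"
    by (simp only: scaleR_diff_left[symmetric] msq_scaleR_left)
  also have "\<dots> \<le> ((norm v)\<^sup>2 + 1) * msq P (\<lambda>\<omega>. f \<omega> - g \<omega>)"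
    by (intro mult_right_mono) auto
  also have "\<dots> < e"
    using g(2) by (simp add: pos_less_divide_eq add_nonneg_pos mult.commute)
  finally show "\<exists>Y\<in>ito_closure. msq P (\<lambda>\<omega>. f \<omega> *\<^sub>R v - Y \<omega>) < e"
    using g(1) unfolding scalar_closure_def by (intro bexI[of _ "\<lambda>\<omega>. g \<omega> *\<^sub>R v"]) auto
qed

lemma scalar_closure_dominated_limit:
  assumes "\<And>n. f n \<in> scalar_closure v" "\<And>n. f n \<in> borel_measurable P" "g \<in> borel_measurable P" "w \<in> L2 P"
    and "\<And>\<omega>. \<omega> \<in> space P \<Longrightarrow> (\<lambda>n. f n \<omega>) \<longlonglongrightarrow> g \<omega>"
    and "\<And>n \<omega>. \<omega> \<in> space P \<Longrightarrow> \<bar>f n \<omega>\<bar> \<le> \<bar>w \<omega>\<bar>" "\<And>\<omega>. \<omega> \<in> space P \<Longrightarrow> \<bar>g \<omega>\<bar> \<le> \<bar>w \<omega>\<bar>"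
  shows "g \<in> scalar_closure v"
proof (rule scalar_closure_limit)
  show "g \<in> L2 P"
    using assms(7) by (intro L2_dominated[OF assms(3,4)]) auto
  have "(\<lambda>n. msq P (\<lambda>\<omega>. f n \<omega> - g \<omega>)) \<longlonglongrightarrow> 0"
    using assms by (intro L2_dominated_convergence[where w=w]) auto
  then show "\<exists>h\<in>scalar_closure v. msq P (\<lambda>\<omega>. g \<omega> - h \<omega>) < e" if "0 < e" for e
    using that assms(1) LIMSEQ_D[of "\<lambda>n. msq P (\<lambda>\<omega>. f n \<omega> - g \<omega>)" 0 e] msq_minus_commute[of P g]
    by fastforce
qed

lemma scalar_closure_increment:
  fixes l :: "real^'m" and v :: "real^'d"
  assumes ab: "0 \<le> a" "a \<le> b" "b \<le> T" and w: "w \<in> borel_measurable (F a)" "\<And>\<omega>. \<bar>w \<omega>\<bar> \<le> C"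
  shows "(\<lambda>\<omega>. w \<omega> * (l \<bullet> (B b \<omega> - B a \<omega>))) \<in> scalar_closure v"
proof -
  \<comment> \<open>The rank-one matrix v l^T, which maps \<open>x\<close> to
    \<open>(l \<bullet> x) *\<^sub>R v\<close>.\<close>
  define M :: "real^'m^'d" where "M = (\<chi> p k. v $ p * l $ k)"
  have M: "(r *\<^sub>R M) *v x = (r * (l \<bullet> x)) *\<^sub>R v" for r x
    by (simp add: vec_eq_iff matrix_vector_mult_def M_def inner_vec_def sum_distrib_left sum_distrib_right ac_simps)
  have "bounded ((\<lambda>\<omega>. w \<omega> *\<^sub>R M) ` space P)"
    unfolding bounded_iff using w(2) by (intro exI[of _ "C * norm M"]) (auto intro: mult_right_mono)
  then have "(\<lambda>s \<omega>. indicator {a<..b} s *\<^sub>R (w \<omega> *\<^sub>R M), \<lambda>\<omega>. (w \<omega> *\<^sub>R M) *v (B b \<omega> - B a \<omega>)) \<in> simple_pairs 0 T"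
    using w(1) by (intro simple_pairs_single ab) auto
  from ito_closure_elem[OF this, of 0] show ?thesis
    unfolding scalar_closure_def M by simp
qed

subsection \<open>Trigonometric functions of the Brownian motion\<close>

text \<open>
  On a grid of mesh \<open>\<delta>\<close>, \<open>exp (i l \<bullet> (B t - B s))\<close> is a product of factors whose conditional means
  are deterministic; replacing each centred factor by \<open>i\<close> times the increment of \<open>l \<bullet> B\<close> makes orthogonal
  errors of variance \<open>O(\<delta>\<^sup>2)\<close>, which avoids the Ito formula.
\<close>

lemma msq_centre_le:
  fixes k :: "'a \<Rightarrow> 'b::euclidean_space"
  assumes "k \<in> L2 P"
  shows "msq P (\<lambda>\<omega>. k \<omega> - (\<integral>\<omega>. k \<omega> \<partial>P)) \<le> msq P k"
proof -
  define m where "m = (\<integral>\<omega>. k \<omega> \<partial>P)"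
  have int: "integrable P k"
    by (rule L2_integrable[OF finite_measure_axioms assms])
  have "msq P (\<lambda>\<omega>. k \<omega> - m) = (\<integral>\<omega>. (norm (k \<omega>))\<^sup>2 - 2 * (k \<omega> \<bullet> m) + m \<bullet> m \<partial>P)"
    unfolding msq_def by (simp add: power2_norm_eq_inner algebra_simps inner_commute)
  also have "\<dots> = msq P k - 2 * (m \<bullet> m) + m \<bullet> m"
    using int L2_integrable_sq[OF assms] by (simp add: msq_def m_def prob_space)
  also have "\<dots> \<le> msq P k"
    by simp
  finally show ?thesis
    by (simp add: m_def)
qed

text \<open>Let Y be the increment of \<open>l \<bullet> B\<close> and k = cis Y - 1 - i Y. Since Y
  has mean 0, \<open>g\<close> is k minus its mean, and centring does not increase the mean square.
  The bound |k| <= Y^2 / 2 leads to a quarter of the fourth moment, hence to 3/4 of the stated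
  constant.\<close>

lemma cis_increment_error:
  fixes l :: "real^'m"
  assumes st: "0 \<le> s" "s \<le> t" "t \<le> T"
  defines "q \<equiv> (\<integral>\<omega>. cis (l \<bullet> (B t \<omega> - B s \<omega>)) \<partial>P)"
  defines "g \<equiv> \<lambda>x. cis (l \<bullet> x) - q - \<i> * (l \<bullet> x)"
  shows "g \<in> borel_measurable borel" "norm q \<le> 1"
    "(\<lambda>\<omega>. g (B t \<omega> - B s \<omega>)) \<in> L2 P" "(\<integral>\<omega>. g (B t \<omega> - B s \<omega>) \<partial>P) = 0"
    "msq P (\<lambda>\<omega>. g (B t \<omega> - B s \<omega>)) \<le> norm l ^ 4 * real CARD('m)^2 * (t - s)\<^sup>2"
proof -
  define Y where "Y \<omega> = l \<bullet> (B t \<omega> - B s \<omega>)" for \<omega>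
  have cont: "continuous_on UNIV (\<lambda>x. cis (l \<bullet> x) - q - \<i> * (l \<bullet> x))"
    by (intro continuous_intros)
  then show "g \<in> borel_measurable borel"
    unfolding g_def by (rule borel_measurable_continuous_onI)
  have cis [measurable]: "cis \<in> borel_measurable borel"
    by (intro borel_measurable_continuous_onI continuous_intros)
  have [measurable]: "B s \<in> borel_measurable P" "B t \<in> borel_measurable P"
    using st by (auto intro: B_measurable)
  have Y_meas [measurable]: "Y \<in> borel_measurable P"
    unfolding Y_def by measurable
  have Y_L2: "Y \<in> L2 P"
  proof (rule L2_dominated[OF Y_meas L2_scale[OF increment_L2[OF st], of "norm l"]])
    show "AE \<omega> in P. norm (Y \<omega>) \<le> norm (norm l *\<^sub>R (B t \<omega> - B s \<omega>))"
      unfolding Y_def using Cauchy_Schwarz_ineq2[of l] by simp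
  qed
  have Y_int: "integrable P Y" "(\<integral>\<omega>. Y \<omega> \<partial>P) = 0"
  proof -
    show "integrable P Y"
      by (rule L2_integrable[OF finite_measure_axioms Y_L2])
    have "(\<integral>\<omega>. Y \<omega> \<partial>P) = (\<integral>\<omega>. (\<Sum>k\<in>UNIV. l $ k * (B t \<omega> - B s \<omega>) $ k) \<partial>P)"
      by (simp add: Y_def inner_vec_def)
    also have "\<dots> = (\<Sum>k\<in>UNIV. l $ k * (\<integral>\<omega>. (B t \<omega> - B s \<omega>) $ k \<partial>P))"
      using integrable_increment[OF st] by (subst Bochner_Integration.integral_sum) auto
    finally show "(\<integral>\<omega>. Y \<omega> \<partial>P) = 0"
      using integral_increment[OF st] by simp
  qed
  have iY: "integrable P (\<lambda>\<omega>. \<i> * complex_of_real (Y \<omega>))" "(\<integral>\<omega>. \<i> * complex_of_real (Y \<omega>) \<partial>P) = 0"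
    using Y_int by auto
  have cisY: "integrable P (\<lambda>\<omega>. cis (Y \<omega>))"
    by (rule integrable_const_bound[where B=1]) auto
  have q: "q = (\<integral>\<omega>. cis (Y \<omega>) \<partial>P)"
    by (simp add: q_def Y_def)
  have "norm q \<le> (\<integral>\<omega>. norm (cis (Y \<omega>)) \<partial>P)"
    unfolding q by (rule integral_norm_bound)
  then show "norm q \<le> 1"
    by (simp add: prob_space)
  define k where "k \<omega> = cis (Y \<omega>) - 1 - \<i> * Y \<omega>" for \<omega>
  have k_meas: "k \<in> borel_measurable P"
    unfolding k_def by measurable
  have k_le: "(norm (k \<omega>))\<^sup>2 \<le> norm l ^ 4 / 4 * norm (B t \<omega> - B s \<omega>) ^ 4" for \<omega>
  proof -
    have "norm (k \<omega>) \<le> (norm l * norm (B t \<omega> - B s \<omega>))\<^sup>2 / 2"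
    proof -
      have "(Y \<omega>)\<^sup>2 \<le> (norm l * norm (B t \<omega> - B s \<omega>))\<^sup>2"
        using power_mono[OF Cauchy_Schwarz_ineq2[of l "B t \<omega> - B s \<omega>"] abs_ge_zero, of 2]
        unfolding Y_def power2_abs .
      then show ?thesis
        using cis_linear_error[of "Y \<omega>"] by (simp add: k_def)
    qed
    then have "(norm (k \<omega>))\<^sup>2 \<le> ((norm l * norm (B t \<omega> - B s \<omega>))\<^sup>2 / 2)\<^sup>2"
      by (intro power_mono) auto
    then show ?thesis
      by (simp add: power_divide power_mult_distrib)
  qed
  have k_L2: "k \<in> L2 P"
  proof (rule L2I[OF k_meas])
    have [measurable]: "k \<in> borel_measurable P" by (rule k_meas)
    show "integrable P (\<lambda>\<omega>. (norm (k \<omega>))\<^sup>2)"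
      by (rule Bochner_Integration.integrable_bound[OF
          integrable_mult_right[OF integrable_norm_increment_4[OF st], of "norm l ^ 4 / 4"]])
        (use k_le in \<open>auto simp: abs_mult intro: order_trans\<close>)
  qed
  have "msq P k \<le> (\<integral>\<omega>. norm l ^ 4 / 4 * norm (B t \<omega> - B s \<omega>) ^ 4 \<partial>P)"
    unfolding msq_def using k_le integrable_norm_increment_4[OF st] L2_integrable_sq[OF k_L2]
    by (intro integral_mono) auto
  also have "\<dots> \<le> norm l ^ 4 / 4 * (3 * real CARD('m)^2 * (t - s)\<^sup>2)"
    using integral_norm_increment_4[OF st] by (simp add: mult_left_mono)
  also have "\<dots> \<le> norm l ^ 4 * real CARD('m)^2 * (t - s)\<^sup>2"
    by (simp add: field_simps)
  finally have k_msq: "msq P k \<le> norm l ^ 4 * real CARD('m)^2 * (t - s)\<^sup>2" .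
  have "(\<integral>\<omega>. k \<omega> \<partial>P) = q - 1"
    unfolding k_def q using cisY iY by (simp add: prob_space)
  then have gk: "g (B t \<omega> - B s \<omega>) = k \<omega> - (\<integral>\<omega>. k \<omega> \<partial>P)" for \<omega>
    by (simp add: g_def k_def Y_def)
  show "(\<lambda>\<omega>. g (B t \<omega> - B s \<omega>)) \<in> L2 P"
    unfolding gk by (intro L2_diff k_L2 const_L2)
  show "(\<integral>\<omega>. g (B t \<omega> - B s \<omega>) \<partial>P) = 0"
    unfolding gk using L2_integrable[OF finite_measure_axioms k_L2] by (simp add: prob_space)
  show "msq P (\<lambda>\<omega>. g (B t \<omega> - B s \<omega>)) \<le> norm l ^ 4 * real CARD('m)^2 * (t - s)\<^sup>2"
    unfolding gk using msq_centre_le[OF k_L2] k_msq by linarith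
qed

text \<open>The hypothesis ranges over all phases because the mean factor \<open>Q\<close> below is
  complex: the real part of \<open>Q * U\<close> involves the sine as well, which is a cosine with
  phase shifted by \<open>pi / 2\<close>.\<close>

lemma scalar_closure_cos_step:
  fixes l :: "real^'m"
  assumes st: "0 \<le> s" "s \<le> t" "t \<le> T"
    and \<theta>: "\<theta> \<in> borel_measurable (F s)" "\<And>\<alpha>. (\<lambda>\<omega>. cos (\<theta> \<omega> + \<alpha>)) \<in> scalar_closure v"
  shows "(\<lambda>\<omega>. cos (\<theta> \<omega> + l \<bullet> (B t \<omega> - B s \<omega>) + \<alpha>)) \<in> scalar_closure v"
proof -
  define K where "K = norm l ^ 4 * real CARD('m)^2 * (t - s)\<^sup>2"
  have K: "0 \<le> K" by (simp add: K_def)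
  let ?f = "\<lambda>\<omega>. cos (\<theta> \<omega> + l \<bullet> (B t \<omega> - B s \<omega>) + \<alpha>)"
  have cis [measurable]: "cis \<in> borel_measurable borel"
    by (intro borel_measurable_continuous_onI continuous_intros)
  have \<theta>P [measurable]: "\<theta> \<in> borel_measurable P" "B s \<in> borel_measurable P" "B t \<in> borel_measurable P"
    using \<theta>(1) st by (auto intro: measurable_F_P B_measurable)
  have approx: "\<exists>Y\<in>scalar_closure v. msq P (\<lambda>\<omega>. ?f \<omega> - Y \<omega>) \<le> K / N" if N: "0 < N" for N :: nat
  proof -
    define \<delta> where "\<delta> = (t - s) / N"
    define r where "r i = s + real i * \<delta>" for i
    have \<delta>: "0 \<le> \<delta>" "real N * \<delta> = t - s"
      using st N by (auto simp: \<delta>_def)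
    have r_le: "s \<le> r i" "r i \<le> r (Suc i)" for i
      using \<delta> by (auto simp: r_def algebra_simps)
    have r_mono: "r i \<le> r j" if "i \<le> j" for i j
      using that \<delta> by (auto simp: r_def intro: mult_right_mono)
    have r_N: "r N = t" "r 0 = s"
      using \<delta> by (auto simp: r_def)
    have r_T: "r i \<le> T" "0 \<le> r i" if "i \<le> N" for i
      using r_mono[OF that] r_N st r_le(1)[of i] by auto
    have r_diff: "r (Suc i) - r i = \<delta>" for i
      by (simp add: r_def algebra_simps)
    define D where "D i \<omega> = B (r (Suc i)) \<omega> - B (r i) \<omega>" for i \<omega>
    define z where "z i \<omega> = cis (l \<bullet> D i \<omega>)" for i \<omega>
    define q where "q i = (\<integral>\<omega>. z i \<omega> \<partial>P)" for i
    define g where "g i x = cis (l \<bullet> x) - q i - \<i> * (l \<bullet> x)" for i and x :: "real^'m"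
    define h where "h i \<omega> = g i (D i \<omega>)" for i \<omega>
    define U where "U \<omega> = cis (\<theta> \<omega> + \<alpha>)" for \<omega>
    \<comment> \<open>The coefficient of the \<open>i\<close>-th exchange in
      \<open>prod_diff_telescope\<close>: exponentials of the past, known at \<open>r i\<close>,
      times the means of the future factors. Its modulus is at most 1.\<close>
    define W where "W i \<omega> = U \<omega> * (\<Prod>j<i. z j \<omega>) * (\<Prod>j\<in>{Suc i..<N}. q j)" for i \<omega>
    have g: "g i \<in> borel_measurable borel" "norm (q i) \<le> 1" "h i \<in> L2 P" "(\<integral>\<omega>. h i \<omega> \<partial>P) = 0"
        "msq P (h i) \<le> norm l ^ 4 * real CARD('m)^2 * \<delta>\<^sup>2" if i: "i < N" for i
      using cis_increment_error[OF r_T(2)[of i] r_le(2) r_T(1)[of "Suc i"], of l] i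
      unfolding g_def[abs_def] h_def[abs_def] q_def z_def D_def r_diff by auto
    have D_meas: "D i \<in> borel_measurable (F (r j))" if "i < j" "j \<le> N" for i j
      unfolding D_def[abs_def] using r_mono[of "Suc i" j] r_mono[of i j] r_T that
      by (intro borel_measurable_diff B_adapted) auto
    have z_meas: "z i \<in> borel_measurable (F (r j))" if "i < j" "j \<le> N" for i j
      using D_meas[OF that] unfolding z_def[abs_def] by measurable
    have U_meas: "U \<in> borel_measurable (F (r j))" for j
    proof -
      have [measurable]: "\<theta> \<in> borel_measurable (F (r j))"
        by (rule measurable_F_mono[OF \<theta>(1) r_le(1)])
      show ?thesis
        unfolding U_def[abs_def] by measurable
    qed
    have W_meas: "W i \<in> borel_measurable (F (r i))" if "i \<le> N" for i
      unfolding W_def[abs_def] using z_meas that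
      by (intro borel_measurable_times U_meas borel_measurable_prod borel_measurable_const) auto
    have W_P: "W i \<in> borel_measurable P" if "i \<le> N" for i
      using W_meas[OF that] r_T[OF that] by (auto intro: measurable_F_P)
    have W_le: "norm (W i \<omega>) \<le> 1" if "i < N" for i \<omega>
    proof -
      have "(\<Prod>j\<in>{Suc i..<N}. norm (q j)) \<le> 1"
        using g(2) by (intro prod_le_1) auto
      then show ?thesis
        by (simp add: W_def norm_mult U_def z_def prod_norm[symmetric])
    qed
    \<comment> \<open>The real inner product of complex numbers is the real part of
      \<open>cnj x * y\<close>. Everything except \<open>h j\<close> is known at time
      \<open>r j\<close>, and \<open>h j\<close> is independent of it with mean 0.\<close>
    have orth: "(\<integral>\<omega>. (W i \<omega> * h i \<omega>) \<bullet> (W j \<omega> * h j \<omega>) \<partial>P) = 0" if ij: "i < j" "j < N" for i j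
    proof -
      define V where "V \<omega> = cnj (W i \<omega> * h i \<omega>) * W j \<omega>" for \<omega>
      have [measurable]: "g i \<in> borel_measurable borel" "D i \<in> borel_measurable (F (r j))"
          "W j \<in> borel_measurable (F (r j))" "W i \<in> borel_measurable (F (r j))"
        using g(1)[of i] D_meas[of i j] ij W_meas measurable_F_mono[OF W_meas[of i] r_mono[of i j]]
        by auto
      have cnj [measurable]: "cnj \<in> borel_measurable borel"
        by (intro borel_measurable_continuous_onI continuous_intros)
      have V_meas: "V \<in> borel_measurable (F (r j))"
        unfolding V_def[abs_def] h_def by measurable
      have V_P: "V \<in> borel_measurable P"
        using V_meas r_T[of j] ij by (auto intro: measurable_F_P)
      have V_L2: "V \<in> L2 P"
      proof (rule L2_dominated[OF V_P g(3)[of i]])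
        have "norm (V \<omega>) \<le> 1 * norm (h i \<omega>) * 1" for \<omega>
          unfolding V_def norm_mult complex_mod_cnj using W_le[of i] W_le[of j] ij
          by (intro mult_mono) auto
        then show "AE \<omega> in P. norm (V \<omega>) \<le> norm (h i \<omega>)"
          by simp
      qed (use ij in simp)
      have hj: "integrable P (\<lambda>\<omega>. g j (B (r (Suc j)) \<omega> - B (r j) \<omega>))"
          "(\<integral>\<omega>. g j (B (r (Suc j)) \<omega> - B (r j) \<omega>) \<partial>P) = 0"
        using L2_integrable[OF finite_measure_axioms g(3)[of j]] g(4)[of j] ij
        by (auto simp: h_def[abs_def] D_def)
      have jT: "0 \<le> r j" "r (Suc j) \<le> T"
        using r_T ij by auto
      note V_int = L2_integrable[OF finite_measure_axioms V_L2]
      have "integrable P (\<lambda>\<omega>. V \<omega> * h j \<omega>)" "(\<integral>\<omega>. V \<omega> * h j \<omega> \<partial>P) = 0"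
        using integrable_F_increment[OF jT(1) r_le(2) jT(2) V_meas V_int g(1)[OF ij(2)] hj(1)]
          integral_F_increment[OF jT(1) r_le(2) jT(2) V_meas V_int g(1)[OF ij(2)] hj(1)] hj(2)
        by (simp_all add: h_def[abs_def] D_def)
      moreover have "(W i \<omega> * h i \<omega>) \<bullet> (W j \<omega> * h j \<omega>) = Re (V \<omega> * h j \<omega>)" for \<omega>
      proof -
        have "x \<bullet> y = Re (cnj x * y)" for x y :: complex
          by (simp add: inner_complex_def)
        then show ?thesis
          by (simp only: V_def mult.assoc)
      qed
      ultimately show ?thesis
        by (simp only: integral_Re) simp
    qed
    define E where "E \<omega> = (\<Sum>i<N. W i \<omega> * h i \<omega>)" for \<omega>
    have Wh: "(\<lambda>\<omega>. W i \<omega> * h i \<omega>) \<in> L2 P" "msq P (\<lambda>\<omega>. W i \<omega> * h i \<omega>) \<le> norm l ^ 4 * real CARD('m)^2 * \<delta>\<^sup>2"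
      if "i < N" for i
      using bounded_mult_L2_complex[OF W_P[of i] W_le g(3)] g(5) that by (auto intro: order_trans)
    have E_L2: "E \<in> L2 P"
      unfolding E_def[abs_def] by (intro L2_sum Wh) auto
    have "msq P E = (\<Sum>i<N. msq P (\<lambda>\<omega>. W i \<omega> * h i \<omega>))"
      unfolding E_def[abs_def]
    proof (rule msq_sum_orthogonal)
      fix i j assume "i \<in> {..<N}" "j \<in> {..<N}" "i \<noteq> j"
      then show "(\<integral>\<omega>. (W i \<omega> * h i \<omega>) \<bullet> (W j \<omega> * h j \<omega>) \<partial>P) = 0"
        using orth[of i j] orth[of j i] by (cases "i < j") (auto simp: inner_commute)
    qed (auto intro: Wh)
    also have "\<dots> \<le> (\<Sum>i<N. norm l ^ 4 * real CARD('m)^2 * \<delta>\<^sup>2)"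
      by (intro sum_mono Wh) auto
    \<comment> \<open>\<open>N\<close> errors, each a constant times
      \<open>((t - s) / N)\<^sup>2\<close>, add up to \<open>K / N\<close>.\<close>
    also have "\<dots> = K / N"
      using N by (simp add: K_def \<delta>_def power2_eq_square field_simps)
    finally have E_msq: "msq P E \<le> K / N" .
    define Q where "Q = (\<Prod>j<N. q j)"
    \<comment> \<open>The real part of the telescoped expansion without the error \<open>E\<close>:
      the term \<open>Q * U\<close> is covered by the hypothesis on \<open>\<theta>\<close>, and the
      others are bounded weights times increments.\<close>
    define Y where "Y \<omega> = (Re Q * cos (\<theta> \<omega> + \<alpha>) - Im Q * cos (\<theta> \<omega> + (\<alpha> - pi / 2)))
        + (\<Sum>i<N. Re (\<i> * W i \<omega>) * (l \<bullet> D i \<omega>))" for \<omega>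
    have "Y \<in> scalar_closure v"
      unfolding Y_def[abs_def]
    proof (intro scalar_closure_add scalar_closure_diff scalar_closure_cmult scalar_closure_sum \<theta>)
      fix i assume "i \<in> {..<N}"
      then have i: "i < N" by simp
      have [measurable]: "W i \<in> borel_measurable (F (r i))"
        using W_meas i by simp
      have le: "\<bar>Re (\<i> * W i \<omega>)\<bar> \<le> 1" for \<omega>
        using abs_Re_le_cmod[of "\<i> * W i \<omega>"] W_le[OF i, of \<omega>] by (simp add: norm_mult)
      show "(\<lambda>\<omega>. Re (\<i> * W i \<omega>) * (l \<bullet> D i \<omega>)) \<in> scalar_closure v"
        unfolding D_def using r_T i r_le by (intro scalar_closure_increment[OF _ _ _ _ le]) auto
    qed simp
    moreover have "?f \<omega> - Y \<omega> = Re (E \<omega>)" for \<omega>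
    proof -
      have "(\<Prod>j<N. z j \<omega>) = cis (\<Sum>i<N. l \<bullet> D i \<omega>)"
        by (simp add: z_def cis_sum)
      also have "(\<Sum>i<N. l \<bullet> D i \<omega>) = l \<bullet> (\<Sum>i<N. D i \<omega>)"
        by (rule inner_sum_right[symmetric])
      also have "(\<Sum>i<N. D i \<omega>) = B t \<omega> - B s \<omega>"
        unfolding D_def using sum_lessThan_telescope[of "\<lambda>i. B (r i) \<omega>" N] r_N by simp
      finally have "U \<omega> * (\<Prod>j<N. z j \<omega>) = cis (\<theta> \<omega> + l \<bullet> (B t \<omega> - B s \<omega>) + \<alpha>)"
        by (simp add: U_def cis_mult ac_simps)
      moreover have "U \<omega> * (\<Prod>j<N. z j \<omega>) = Q * U \<omega> + (\<Sum>i<N. W i \<omega> * (z i \<omega> - q i))"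
        using prod_diff_telescope[of "\<lambda>j. z j \<omega>" N q]
        by (simp add: Q_def W_def algebra_simps sum_distrib_left)
      moreover have "W i \<omega> * (z i \<omega> - q i) = W i \<omega> * h i \<omega> + (\<i> * W i \<omega>) * (l \<bullet> D i \<omega>)" for i
        by (simp add: h_def g_def z_def algebra_simps)
      ultimately have eq: "cis (\<theta> \<omega> + l \<bullet> (B t \<omega> - B s \<omega>) + \<alpha>)
          = Q * U \<omega> + E \<omega> + (\<Sum>i<N. (\<i> * W i \<omega>) * (l \<bullet> D i \<omega>))"
        by (simp add: E_def sum.distrib add.assoc)
      have "cos (\<theta> \<omega> + (\<alpha> - pi / 2)) = sin (\<theta> \<omega> + \<alpha>)"
        using cos_sin_eq[of "\<theta> \<omega> + \<alpha> - pi / 2"] sin_cos_eq[of "\<theta> \<omega> + \<alpha>"] cos_minus[of "pi / 2 - (\<theta> \<omega> + \<alpha>)"]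
        by (simp add: algebra_simps)
      then have "Re (Q * U \<omega>) = Re Q * cos (\<theta> \<omega> + \<alpha>) - Im Q * cos (\<theta> \<omega> + (\<alpha> - pi / 2))"
        by (simp add: U_def)
      moreover have "Re (\<Sum>i<N. (\<i> * W i \<omega>) * (l \<bullet> D i \<omega>)) = (\<Sum>i<N. Re (\<i> * W i \<omega>) * (l \<bullet> D i \<omega>))"
        by simp
      ultimately show ?thesis
        using arg_cong[OF eq, of Re] by (simp add: Y_def)
    qed
    moreover have "msq P (\<lambda>\<omega>. Re (E \<omega>)) \<le> K / N"
      using msq_mono[OF E_L2, of "\<lambda>\<omega>. Re (E \<omega>)"] abs_Re_le_cmod E_msq by simp
    ultimately show ?thesis
      by (intro bexI[of _ Y]) (simp_all only:)
  qed
  show ?thesis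
  proof (rule scalar_closure_limit)
    show "?f \<in> L2 P"
      by (rule L2_bounded[OF finite_measure_axioms, of _ 1]) auto
    fix e :: real assume "0 < e"
    obtain N :: nat where N: "K / e < N"
      using reals_Archimedean2 by blast
    moreover have "0 \<le> K / e"
      using K \<open>0 < e\<close> by simp
    ultimately have "0 < N"
      by (metis of_nat_0_less_iff le_less_trans)
    have "K / N < e"
      using N \<open>0 < N\<close> \<open>0 < e\<close> by (simp add: field_simps)
    then show "\<exists>Y\<in>scalar_closure v. msq P (\<lambda>\<omega>. ?f \<omega> - Y \<omega>) < e"
      using approx[OF \<open>0 < N\<close>] by (meson le_less_trans)
  qed
qed

section \<open>Cosines of linear combinations of Brownian values, and the algebra they span\<close>

definition trig_arg :: "real set \<Rightarrow> (real \<Rightarrow> real^'m) \<Rightarrow> 'a \<Rightarrow> real" where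
  "trig_arg J l \<omega> = (\<Sum>j\<in>J. l j \<bullet> B j \<omega>)"

lemma trig_arg_measurable:
  assumes "J \<subseteq> {0..s}"
  shows "trig_arg J l \<in> borel_measurable (F s)"
  unfolding trig_arg_def[abs_def] using assms
  by (intro borel_measurable_sum borel_measurable_inner borel_measurable_const B_adapted) auto

text \<open>Induction on the largest time \<open>b\<close>: the term
  \<open>l b \<bullet> B b\<close> is split into the increment after the preceding time
  \<open>s\<close> and \<open>l b \<bullet> B s\<close>, which is absorbed into the coefficient at
  \<open>s\<close>. Coefficients and phase therefore vary in the induction.\<close>

lemma cos_trig_arg_scalar_closure:
  assumes "finite J" "J \<subseteq> {0..T}"
  shows "(\<lambda>\<omega>. cos (trig_arg J l \<omega> + \<alpha>)) \<in> scalar_closure v"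
  using assms
proof (induction J arbitrary: l \<alpha> rule: finite_linorder_max_induct)
  case empty
  then show ?case
    by (simp add: trig_arg_def scalar_closure_const)
next
  case (insert b A)
  have b: "0 \<le> b" "b \<le> T" "b \<notin> A"
    using insert by auto
  show ?case
  proof (cases "A = {}")
    \<comment> \<open>With no earlier time the increment is taken from 0, where \<open>B\<close>
      vanishes almost surely.\<close>
    case True
    have "(\<lambda>\<omega>. cos (0 + l b \<bullet> (B b \<omega> - B 0 \<omega>) + \<alpha>)) \<in> scalar_closure v"
      using b by (intro scalar_closure_cos_step scalar_closure_const) auto
    moreover have "AE \<omega> in P. cos (trig_arg {b} l \<omega> + \<alpha>) = cos (0 + l b \<bullet> (B b \<omega> - B 0 \<omega>) + \<alpha>)"
      using B_0 by eventually_elim (simp add: trig_arg_def)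
    moreover have "(\<lambda>\<omega>. cos (trig_arg {b} l \<omega> + \<alpha>)) \<in> borel_measurable P"
    proof -
      have [measurable]: "trig_arg {b} l \<in> borel_measurable P"
        using b by (intro measurable_F_P[OF trig_arg_measurable[of _ b]]) auto
      show ?thesis by measurable
    qed
    ultimately show ?thesis
      unfolding True using scalar_closure_AE by blast
  next
    case False
    define s where "s = Max A"
    have "s \<in> A"
      using insert(1) False by (simp add: s_def)
    then have s: "s \<in> A" "0 \<le> s" "s \<le> b" "A \<subseteq> {0..s}"
      using insert by (auto simp: s_def intro: less_imp_le)
    define l' where "l' = l(s := l s + l b)"
    have "trig_arg A l' \<omega> = trig_arg A l \<omega> + l b \<bullet> B s \<omega>" for \<omega>
      unfolding trig_arg_def using insert(1) s(1)
      by (simp add: sum.remove[of A s] l'_def inner_add_left)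
    then have eq: "trig_arg (insert b A) l \<omega> = trig_arg A l' \<omega> + l b \<bullet> (B b \<omega> - B s \<omega>)" for \<omega>
      using insert(1) b by (simp add: trig_arg_def inner_diff_right)
    show ?thesis
      unfolding eq using insert s b by (intro scalar_closure_cos_step trig_arg_measurable) auto
  qed
qed

text \<open>The phase \<open>\<alpha>\<close> makes sines available as well, and the product-to-sum
  formula keeps the span closed under multiplication.\<close>

inductive_set trig_alg :: "('a \<Rightarrow> real) set" where
  cos: "finite J \<Longrightarrow> J \<subseteq> {0..T} \<Longrightarrow> (\<lambda>\<omega>. cos (trig_arg J l \<omega> + \<alpha>)) \<in> trig_alg"
| add: "f \<in> trig_alg \<Longrightarrow> g \<in> trig_alg \<Longrightarrow> (\<lambda>\<omega>. f \<omega> + g \<omega>) \<in> trig_alg"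
| cmult: "f \<in> trig_alg \<Longrightarrow> (\<lambda>\<omega>. r * f \<omega>) \<in> trig_alg"

lemma trig_alg_scalar_closure: "f \<in> trig_alg \<Longrightarrow> f \<in> scalar_closure v"
  by (induction rule: trig_alg.induct) (auto intro: cos_trig_arg_scalar_closure scalar_closure_add scalar_closure_cmult)

lemma trig_alg_const: "(\<lambda>\<omega>. r) \<in> trig_alg"
  using trig_alg.cmult[OF trig_alg.cos[of "{}" "\<lambda>_. 0" 0], of r] by (simp add: trig_arg_def)

lemma trig_alg_measurable: "f \<in> trig_alg \<Longrightarrow> f \<in> borel_measurable P"
proof (induction rule: trig_alg.induct)
  case (cos J l \<alpha>)
  then have [measurable]: "trig_arg J l \<in> borel_measurable P"
    by (intro measurable_F_P[OF trig_arg_measurable[of _ T]]) auto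
  show ?case by measurable
qed auto

lemma trig_alg_bounded: "f \<in> trig_alg \<Longrightarrow> \<exists>C. \<forall>\<omega>. \<bar>f \<omega>\<bar> \<le> C"
proof (induction rule: trig_alg.induct)
  case (cos J l \<alpha>)
  show ?case
    by (intro exI[of _ 1]) simp
next
  case (add f g)
  then obtain C D where "\<forall>\<omega>. \<bar>f \<omega>\<bar> \<le> C" "\<forall>\<omega>. \<bar>g \<omega>\<bar> \<le> D"
    by blast
  then show ?case
    by (intro exI[of _ "C + D"]) (meson abs_triangle_ineq add_mono order_trans)
next
  case (cmult f r)
  then obtain C where "\<forall>\<omega>. \<bar>f \<omega>\<bar> \<le> C"
    by blast
  then show ?case
    by (intro exI[of _ "\<bar>r\<bar> * C"]) (simp add: abs_mult mult_left_mono)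
qed

text \<open>Extending both coefficient families by zero puts them on a common set of times;
  \<open>c = 1\<close> and \<open>c = -1\<close> give the two arguments of the product-to-sum
  formula.\<close>

lemma trig_arg_Un:
  assumes "finite J" "finite J'"
  shows "trig_arg (J \<union> J') (\<lambda>j. (if j \<in> J then l j else 0) + c *\<^sub>R (if j \<in> J' then l' j else 0)) \<omega>
    = trig_arg J l \<omega> + c * trig_arg J' l' \<omega>"
proof -
  have "(\<Sum>j\<in>J \<union> J'. (if j \<in> J then l j else 0) \<bullet> B j \<omega>) = (\<Sum>j\<in>J. l j \<bullet> B j \<omega>)"
    using assms by (intro sum.mono_neutral_cong_right) auto
  moreover have "(\<Sum>j\<in>J \<union> J'. (if j \<in> J' then l' j else 0) \<bullet> B j \<omega>) = (\<Sum>j\<in>J'. l' j \<bullet> B j \<omega>)"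
    using assms by (intro sum.mono_neutral_cong_right) auto
  ultimately show ?thesis
    by (simp add: trig_arg_def inner_add_left sum.distrib sum_distrib_left[symmetric])
qed

lemma trig_alg_mult_cos:
  assumes "g \<in> trig_alg" "finite J" "J \<subseteq> {0..T}"
  shows "(\<lambda>\<omega>. cos (trig_arg J l \<omega> + \<alpha>) * g \<omega>) \<in> trig_alg"
  using assms(1)
proof (induction rule: trig_alg.induct)
  case (cos J' l' \<beta>)
  let ?L = "\<lambda>c. (\<lambda>j. (if j \<in> J then l j else 0) + c *\<^sub>R (if j \<in> J' then l' j else 0))"
  have "cos (trig_arg J l \<omega> + \<alpha>) * cos (trig_arg J' l' \<omega> + \<beta>)
      = 1 / 2 * cos (trig_arg (J \<union> J') (?L (-1)) \<omega> + (\<alpha> - \<beta>))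
        + 1 / 2 * cos (trig_arg (J \<union> J') (?L 1) \<omega> + (\<alpha> + \<beta>))" for \<omega>
    unfolding trig_arg_Un[OF assms(2) cos(1)] by (simp add: cos_times_cos algebra_simps)
  moreover have "(\<lambda>\<omega>. 1 / 2 * cos (trig_arg (J \<union> J') (?L (-1)) \<omega> + (\<alpha> - \<beta>))
        + 1 / 2 * cos (trig_arg (J \<union> J') (?L 1) \<omega> + (\<alpha> + \<beta>))) \<in> trig_alg"
    using assms cos by (intro trig_alg.add trig_alg.cmult trig_alg.cos) auto
  ultimately show ?case
    by presburger
next
  case (add f g)
  show ?case
    using trig_alg.add[OF add.IH] by (simp add: distrib_left)
next
  case (cmult f r)
  show ?case
    using trig_alg.cmult[OF cmult.IH, of r] by (simp add: mult.left_commute)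
qed

lemma trig_alg_mult:
  assumes "f \<in> trig_alg" "g \<in> trig_alg"
  shows "(\<lambda>\<omega>. f \<omega> * g \<omega>) \<in> trig_alg"
  using assms(1)
proof (induction rule: trig_alg.induct)
  case (cos J l \<alpha>)
  then show ?case
    by (rule trig_alg_mult_cos[OF assms(2)])
next
  case (add f g)
  show ?case
    using trig_alg.add[OF add.IH] by (simp add: distrib_right)
next
  case (cmult f r)
  show ?case
    using trig_alg.cmult[OF cmult.IH, of r] by (simp add: mult.assoc)
qed

lemma trig_alg_polynomial:
  fixes p :: "real \<Rightarrow> real"
  assumes "real_polynomial_function p" "f \<in> trig_alg"
  shows "(\<lambda>\<omega>. p (f \<omega>)) \<in> trig_alg"
  using assms(1)
proof (induction rule: real_polynomial_function.induct)
  case (linear h)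
  then obtain c where "h = (\<lambda>x. x * c)"
    using real_bounded_linear by auto
  then show ?case
    using trig_alg.cmult[OF assms(2), of c] by (simp add: mult.commute)
qed (auto intro: trig_alg_const trig_alg.add trig_alg_mult)

text \<open>Uniform approximation keeps members bounded, and polynomials in a bounded member of the
  algebra approximate its absolute value uniformly; minima and positive parts follow.\<close>

definition trig_closure :: "('a \<Rightarrow> real) set" where
  "trig_closure = {f \<in> borel_measurable P. \<forall>e>0. \<exists>g\<in>trig_alg. \<forall>\<omega>. \<bar>f \<omega> - g \<omega>\<bar> < e}"

lemma trig_closureE:
  assumes "f \<in> trig_closure" "0 < e"
  obtains g where "g \<in> trig_alg" "\<And>\<omega>. \<bar>f \<omega> - g \<omega>\<bar> < e"
  using assms by (auto simp: trig_closure_def)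

lemma trig_closure_measurable: "f \<in> trig_closure \<Longrightarrow> f \<in> borel_measurable P"
  by (simp add: trig_closure_def)

lemma trig_alg_closure: "f \<in> trig_alg \<Longrightarrow> f \<in> trig_closure"
  unfolding trig_closure_def using trig_alg_measurable by (auto intro!: bexI[of _ f])

lemma trig_closure_scalar_closure:
  assumes f: "f \<in> trig_closure"
  shows "f \<in> scalar_closure v"
proof (rule scalar_closure_limit)
  obtain g where g: "g \<in> trig_alg" "\<And>\<omega>. \<bar>f \<omega> - g \<omega>\<bar> < 1"
    using trig_closureE[OF f, of 1] by auto
  obtain C where C: "\<And>\<omega>. \<bar>g \<omega>\<bar> \<le> C"
    using trig_alg_bounded[OF g(1)] by blast
  have "\<bar>f \<omega>\<bar> \<le> C + 1" for \<omega>
    using g(2)[of \<omega>] C[of \<omega>] by linarith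
  then show "f \<in> L2 P"
    using trig_closure_measurable[OF f] by (intro L2_bounded[OF finite_measure_axioms, of _ "C + 1"]) auto
  fix e :: real assume "0 < e"
  then obtain h where h: "h \<in> trig_alg" "\<And>\<omega>. \<bar>f \<omega> - h \<omega>\<bar> < sqrt (e / 2)"
    using trig_closureE[OF f, of "sqrt (e / 2)"] by auto
  have "msq P (\<lambda>\<omega>. f \<omega> - h \<omega>) \<le> msq P (\<lambda>\<omega>. sqrt (e / 2))"
    using h(2) \<open>0 < e\<close> by (intro msq_mono const_L2) (auto intro: less_imp_le)
  also have "\<dots> < e"
    using \<open>0 < e\<close> by (simp add: msq_def prob_space)
  finally show "\<exists>g\<in>scalar_closure v. msq P (\<lambda>\<omega>. f \<omega> - g \<omega>) < e"
    using trig_alg_scalar_closure[OF h(1)] by blast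
qed

lemma trig_closure_add:
  assumes f: "f \<in> trig_closure" and g: "g \<in> trig_closure"
  shows "(\<lambda>\<omega>. f \<omega> + g \<omega>) \<in> trig_closure"
  unfolding trig_closure_def
proof (intro CollectI conjI allI impI)
  show "(\<lambda>\<omega>. f \<omega> + g \<omega>) \<in> borel_measurable P"
    using assms by (intro borel_measurable_add trig_closure_measurable)
  fix e :: real assume "0 < e"
  then have e: "0 < e / 2" by simp
  obtain f' where f': "f' \<in> trig_alg" "\<And>\<omega>. \<bar>f \<omega> - f' \<omega>\<bar> < e / 2"
    using trig_closureE[OF f e] by blast
  obtain g' where g': "g' \<in> trig_alg" "\<And>\<omega>. \<bar>g \<omega> - g' \<omega>\<bar> < e / 2"
    using trig_closureE[OF g e] by blast
  have "\<bar>f \<omega> + g \<omega> - (f' \<omega> + g' \<omega>)\<bar> < e" for \<omega>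
    using f'(2)[of \<omega>] g'(2)[of \<omega>] by linarith
  then show "\<exists>h\<in>trig_alg. \<forall>\<omega>. \<bar>f \<omega> + g \<omega> - h \<omega>\<bar> < e"
    by (intro bexI[OF _ trig_alg.add[OF f'(1) g'(1)]] allI)
qed

lemma trig_closure_cmult:
  assumes f: "f \<in> trig_closure"
  shows "(\<lambda>\<omega>. r * f \<omega>) \<in> trig_closure"
  unfolding trig_closure_def
proof (intro CollectI conjI allI impI)
  show "(\<lambda>\<omega>. r * f \<omega>) \<in> borel_measurable P"
    using assms by (intro borel_measurable_times borel_measurable_const trig_closure_measurable)
  fix e :: real assume "0 < e"
  then have e: "0 < e / (\<bar>r\<bar> + 1)" by (simp add: add_nonneg_pos)
  obtain f' where f': "f' \<in> trig_alg" "\<And>\<omega>. \<bar>f \<omega> - f' \<omega>\<bar> < e / (\<bar>r\<bar> + 1)"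
    using trig_closureE[OF f e] by blast
  have "\<bar>r * f \<omega> - r * f' \<omega>\<bar> < e" for \<omega>
  proof -
    have "\<bar>r * f \<omega> - r * f' \<omega>\<bar> = \<bar>r\<bar> * \<bar>f \<omega> - f' \<omega>\<bar>"
      by (simp add: abs_mult[symmetric] right_diff_distrib)
    also have "\<dots> \<le> (\<bar>r\<bar> + 1) * \<bar>f \<omega> - f' \<omega>\<bar>"
      by (intro mult_right_mono) auto
    also have "\<dots> < e"
      using f'(2)[of \<omega>] by (simp add: pos_less_divide_eq add_nonneg_pos mult.commute)
    finally show ?thesis .
  qed
  then show "\<exists>h\<in>trig_alg. \<forall>\<omega>. \<bar>r * f \<omega> - h \<omega>\<bar> < e"
    by (intro bexI[OF _ trig_alg.cmult[OF f'(1), of r]] allI)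
qed

text \<open>\<open>f\<close> is within \<open>e / 2\<close> of some bounded \<open>g\<close> in the
  algebra, and the absolute value is within \<open>e / 2\<close> of a polynomial on an interval
  containing the range of \<open>g\<close>; polynomials in \<open>g\<close> stay in the
  algebra.\<close>

lemma trig_closure_abs:
  assumes f: "f \<in> trig_closure"
  shows "(\<lambda>\<omega>. \<bar>f \<omega>\<bar>) \<in> trig_closure"
  unfolding trig_closure_def
proof (intro CollectI conjI allI impI)
  show "(\<lambda>\<omega>. \<bar>f \<omega>\<bar>) \<in> borel_measurable P"
    using trig_closure_measurable[OF f] by measurable
  fix e :: real assume "0 < e"
  then have e: "0 < e / 2" by simp
  obtain g where g: "g \<in> trig_alg" "\<And>\<omega>. \<bar>f \<omega> - g \<omega>\<bar> < e / 2"
    using trig_closureE[OF f e] by blast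
  obtain C where C: "\<And>\<omega>. \<bar>g \<omega>\<bar> \<le> C"
    using trig_alg_bounded[OF g(1)] by blast
  obtain p :: "real \<Rightarrow> real" where p: "real_polynomial_function p" "\<And>x. x \<in> {-C..C} \<Longrightarrow> \<bar>\<bar>x\<bar> - p x\<bar> < e / 2"
    using Stone_Weierstrass_real_polynomial_function[of "{-C..C}" abs "e / 2"] e
      continuous_on_rabs[OF continuous_on_id, of "{-C..C}"] by (auto simp only: compact_Icc id_apply)
  have "\<bar>\<bar>f \<omega>\<bar> - p (g \<omega>)\<bar> < e" for \<omega>
  proof -
    have "g \<omega> \<in> {-C..C}"
      using C[of \<omega>] by auto
    then show ?thesis
      using p(2)[of "g \<omega>"] g(2)[of \<omega>] by linarith
  qed
  then show "\<exists>h\<in>trig_alg. \<forall>\<omega>. \<bar>\<bar>f \<omega>\<bar> - h \<omega>\<bar> < e"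
    by (intro bexI[OF _ trig_alg_polynomial[OF p(1) g(1)]] allI)
qed

lemma trig_closure_const: "(\<lambda>\<omega>. r) \<in> trig_closure"
  by (intro trig_alg_closure trig_alg_const)

lemma trig_closure_diff:
  "f \<in> trig_closure \<Longrightarrow> g \<in> trig_closure \<Longrightarrow> (\<lambda>\<omega>. f \<omega> - g \<omega>) \<in> trig_closure"
  using trig_closure_add[of f "\<lambda>\<omega>. -1 * g \<omega>"] trig_closure_cmult[of g "-1"] by simp

lemma trig_closure_min:
  assumes "f \<in> trig_closure" "g \<in> trig_closure"
  shows "(\<lambda>\<omega>. min (f \<omega>) (g \<omega>)) \<in> trig_closure"
proof -
  have "min (f \<omega>) (g \<omega>) = 1 / 2 * ((f \<omega> + g \<omega>) - \<bar>f \<omega> - g \<omega>\<bar>)" for \<omega>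
    by (simp add: min_def)
  then show ?thesis
    using assms by (simp only:) (intro trig_closure_cmult trig_closure_diff trig_closure_add trig_closure_abs)
qed

lemma trig_closure_pos_part:
  assumes "f \<in> trig_closure"
  shows "(\<lambda>\<omega>. max (f \<omega>) 0) \<in> trig_closure"
proof -
  have "max (f \<omega>) 0 = 1 / 2 * (f \<omega> + \<bar>f \<omega>\<bar>)" for \<omega>
    by (simp add: max_def)
  then show ?thesis
    using assms by (simp only:) (intro trig_closure_cmult trig_closure_add trig_closure_abs)
qed

section \<open>From positivity sets to all events and all square-integrable functions\<close>

lemma indicator_pos_scalar_closure:
  assumes f: "f \<in> trig_closure"
  shows "indicator {\<omega>\<in>space P. 0 < f \<omega>} \<in> scalar_closure v"
proof (rule scalar_closure_dominated_limit[where w="\<lambda>_. 1"])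
  \<comment> \<open>Lattice operations in the uniform closure produce these functions, which
    increase to the indicator of the set where \<open>f\<close> is positive.\<close>
  let ?\<phi> = "\<lambda>n \<omega>. min 1 (real n * max (f \<omega>) 0)"
  have [measurable]: "f \<in> borel_measurable P"
    by (rule trig_closure_measurable[OF f])
  have \<phi>: "?\<phi> n \<in> trig_closure" for n
    by (intro trig_closure_min trig_closure_const trig_closure_cmult trig_closure_pos_part f)
  then show "?\<phi> n \<in> scalar_closure v" "?\<phi> n \<in> borel_measurable P" for n
    using trig_closure_scalar_closure trig_closure_measurable by auto
  show "indicator {\<omega>\<in>space P. 0 < f \<omega>} \<in> borel_measurable P"
    by measurable
  show "(\<lambda>_. 1::real) \<in> L2 P"
    by (rule const_L2)
  fix \<omega> assume \<omega>: "\<omega> \<in> space P"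
  show "(\<lambda>n. ?\<phi> n \<omega>) \<longlonglongrightarrow> indicator {\<omega>\<in>space P. 0 < f \<omega>} \<omega>"
  proof (cases "0 < f \<omega>")
    case True
    obtain N :: nat where N: "1 / f \<omega> < N"
      using reals_Archimedean2 by blast
    have "?\<phi> n \<omega> = 1" if "N \<le> n" for n
    proof -
      have "1 / f \<omega> < real n"
        using N that by linarith
      then show ?thesis
        using True by (simp add: field_simps)
    qed
    then have "\<forall>\<^sub>F n in sequentially. ?\<phi> n \<omega> = 1"
      by (auto simp: eventually_sequentially)
    then show ?thesis
      using True \<omega> by (simp add: tendsto_eventually)
  next
    case False
    then show ?thesis
      by simp
  qed
  show "\<bar>?\<phi> n \<omega>\<bar> \<le> \<bar>1\<bar>" for n
    by (auto simp: min_def max_def)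
  show "\<bar>indicator {\<omega>\<in>space P. 0 < f \<omega>} \<omega>\<bar> \<le> \<bar>1::real\<bar>"
    by (simp add: indicator_def)
qed

text \<open>Members of \<open>trig_closure\<close> minus constants are members again, so the sets
  where a member is positive already make every member measurable; and each coordinate of
  \<open>B\<close> is a pointwise limit of scaled sines of itself.\<close>

lemma sets_F_T_subset:
  "sets (F T) \<subseteq> sigma_sets (space P) ({{\<omega>\<in>space P. 0 < f \<omega>} | f. f \<in> trig_closure} \<union> null_sets P)"
    (is "_ \<subseteq> sigma_sets _ ?G")
proof -
  have G: "?G \<subseteq> Pow (space P)"
    by (auto dest: sets.sets_into_space)
  define N where "N = sigma (space P) ?G"
  have N: "space N = space P" "sets N = sigma_sets (space P) ?G"
    using G by (auto simp: N_def)
  have closure_meas: "f \<in> borel_measurable N" if "f \<in> trig_closure" for f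
  proof (subst borel_measurable_iff_greater, intro allI)
    fix a
    have "{\<omega> \<in> space P. 0 < f \<omega> - a} \<in> ?G"
      by (intro UnI1 CollectI exI[of _ "\<lambda>\<omega>. f \<omega> - a"] conjI refl trig_closure_diff[OF that trig_closure_const])
    then show "{\<omega> \<in> space N. a < f \<omega>} \<in> sets N"
      unfolding N by (intro sigma_sets.Basic) simp
  qed
  have B: "B r \<in> borel_measurable N" if r: "r \<in> {0..T}" for r
  proof (subst borel_measurable_euclidean_space, intro ballI)
    fix b :: "real^'m"
    have "(\<lambda>\<omega>. real (Suc n) * sin (B r \<omega> \<bullet> b / real (Suc n))) \<in> trig_alg" for n
    proof -
      have "cos (trig_arg {r} (\<lambda>_. (1 / real (Suc n)) *\<^sub>R b) \<omega> + (- (pi / 2))) = sin (B r \<omega> \<bullet> b / real (Suc n))" for \<omega>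
        using cos_diff[of "B r \<omega> \<bullet> b / real (Suc n)" "pi / 2"] by (simp add: trig_arg_def inner_commute)
      then show ?thesis
        using trig_alg.cmult[OF trig_alg.cos[of "{r}" "\<lambda>_. (1 / real (Suc n)) *\<^sub>R b" "- (pi / 2)"], of "real (Suc n)"] r
        by simp
    qed
    then have "(\<lambda>\<omega>. real (Suc n) * sin (B r \<omega> \<bullet> b / real (Suc n))) \<in> borel_measurable N" for n
      by (intro closure_meas trig_alg_closure)
    then show "(\<lambda>\<omega>. B r \<omega> \<bullet> b) \<in> borel_measurable N"
      by (rule borel_measurable_LIMSEQ_real[OF scaled_sin_tendsto])
  qed
  have "Fgen T \<subseteq> sets N"
  proof -
    have "B r -` A \<inter> space P \<in> sets N" if "r \<in> {0..T}" "A \<in> sets borel" for r A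
      using measurable_sets[OF B[OF that(1)] that(2)] by (simp add: N(1))
    moreover have "null_sets P \<subseteq> sets N"
      unfolding N(2) by (auto intro: sigma_sets.Basic)
    ultimately show ?thesis by auto
  qed
  then have "sets (F T) \<subseteq> sets N"
    unfolding sets_F using sets.sigma_sets_subset[of "Fgen T" N] by (simp add: N(1))
  then show ?thesis
    by (simp add: N(2))
qed

text \<open>Two positivity sets intersect in the positivity set of the minimum, so together with the
  null sets they form an intersection-stable generator. Complements are handled by differences and
  disjoint unions by dominated limits.\<close>

lemma indicator_scalar_closure:
  assumes "A \<in> sets (F T)"
  shows "indicator A \<in> scalar_closure v"
proof -
  let ?R = "{{\<omega>\<in>space P. 0 < f \<omega>} | f. f \<in> trig_closure}"
  let ?G = "?R \<union> null_sets P"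
  have R: "?R \<subseteq> sets P"
    using trig_closure_measurable by auto
  have G_sets: "?G \<subseteq> sets P"
    using R by auto
  have G: "?G \<subseteq> Pow (space P)"
    using G_sets sets.sets_into_space by blast
  have stable: "Int_stable ?G"
  proof (rule Int_stableI)
    fix a b assume ab: "a \<in> ?G" "b \<in> ?G"
    have sets: "a \<in> sets P" "b \<in> sets P"
      using ab G_sets by auto
    show "a \<inter> b \<in> ?G"
    proof (cases "a \<in> ?R \<and> b \<in> ?R")
      case True
      then obtain f g where fg: "f \<in> trig_closure" "g \<in> trig_closure"
        "a = {\<omega>\<in>space P. 0 < f \<omega>}" "b = {\<omega>\<in>space P. 0 < g \<omega>}"
        by blast
      have "a \<inter> b = {\<omega>\<in>space P. 0 < min (f \<omega>) (g \<omega>)}"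
        unfolding fg(3,4) by auto
      then show ?thesis
        by (intro UnI1 CollectI exI[of _ "\<lambda>\<omega>. min (f \<omega>) (g \<omega>)"] conjI trig_closure_min[OF fg(1,2)])
    next
      case False
      then show ?thesis
        using ab sets by (auto intro: null_set_Int1 null_set_Int2)
    qed
  qed
  have sub: "sigma_sets (space P) ?G \<subseteq> sets P"
    using G_sets by (rule sets.sigma_sets_subset)
  have "A \<in> sigma_sets (space P) ?G"
    using assms sets_F_T_subset by auto
  from stable G this show ?thesis
  proof (induction rule: sigma_sets_induct_disjoint)
    case (basic A)
    show ?case
    proof (cases "A \<in> ?R")
      case True
      then show ?thesis
        using indicator_pos_scalar_closure by auto
    next
      case False
      then have A: "A \<in> null_sets P"
        using basic by auto
      show ?thesis
      proof (rule scalar_closure_AE[OF scalar_closure_const[of 0]])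
        show "indicator A \<in> borel_measurable P"
          using A by (intro borel_measurable_indicator) auto
        show "AE \<omega> in P. indicator A \<omega> = (0::real)"
          using AE_not_in[OF A] by eventually_elim simp
      qed
    qed
  next
    case empty
    show ?case
      using scalar_closure_const[of 0] by (simp add: indicator_def[abs_def])
  next
    case (compl A)
    have "A \<in> sets P"
      using compl(1) sub by auto
    then show ?case
      by (intro scalar_closure_AE[OF scalar_closure_diff[OF scalar_closure_const[of 1] compl(2)]]) (auto simp: indicator_def)
  next
    case (union A)
    have A: "A i \<in> sets P" for i
      using union(2) sub by auto
    show ?case
    proof (rule scalar_closure_dominated_limit[where w="\<lambda>_. 1"])
      fix n
      let ?S = "\<lambda>\<omega>. \<Sum>i<n. indicator (A i) \<omega> :: real"
      show "?S \<in> scalar_closure v"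
        using union(3) by (intro scalar_closure_sum) auto
      show "?S \<in> borel_measurable P"
        using A by (intro borel_measurable_sum borel_measurable_indicator)
      fix \<omega>
      \<comment> \<open>Disjointness makes the partial sums indicators again, hence bounded by
        1.\<close>
      have "?S \<omega> = indicator (\<Union>i<n. A i) \<omega>"
        using union(1) by (intro indicator_UN_disjoint[symmetric])
          (auto simp: disjoint_family_on_def)
      then show "\<bar>?S \<omega>\<bar> \<le> \<bar>1\<bar>"
        by (simp add: indicator_def)
    next
      fix \<omega>
      have "(\<lambda>n. indicator (\<Union>i<n. A i) \<omega> :: real) \<longlonglongrightarrow> indicator (\<Union>i. A i) \<omega>"
        by (rule LIMSEQ_indicator_UN)
      moreover have "(\<Sum>i<n. indicator (A i) \<omega> :: real) = indicator (\<Union>i<n. A i) \<omega>" for n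
        using union(1) by (intro indicator_UN_disjoint[symmetric])
          (auto simp: disjoint_family_on_def)
      ultimately show "(\<lambda>n. \<Sum>i<n. indicator (A i) \<omega> :: real) \<longlonglongrightarrow> indicator (\<Union>i. A i) \<omega>"
        by simp
    next
      show "\<bar>indicator (\<Union>i. A i) \<omega>\<bar> \<le> \<bar>1::real\<bar>" for \<omega>
        by (simp add: indicator_def)
    qed (use A const_L2 in auto)
  qed
qed

lemma nonneg_scalar_closure:
  fixes f :: "'a \<Rightarrow> real"
  assumes "f \<in> borel_measurable (F T)" "\<And>\<omega>. 0 \<le> f \<omega>" "f \<in> L2 P"
  shows "f \<in> scalar_closure v"
  using assms
proof (induction f rule: borel_measurable_induct_real)
  case (set A)
  then show ?case
    by (intro indicator_scalar_closure)
next
  case (mult u c)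
  show ?case
  proof (cases "c = 0")
    case True
    then show ?thesis
      using scalar_closure_const[of 0] by simp
  next
    case False
    then have "u \<in> L2 P"
      using L2_scale[OF mult.prems, of "inverse c"] by (simp add: mult.assoc[symmetric])
    then show ?thesis
      using mult by (intro scalar_closure_cmult)
  qed
next
  case (add u w)
  have "u \<in> L2 P"
    using add.hyps(2,4) by (intro L2_dominated[OF measurable_F_P[OF add.hyps(1) order_refl] add.prems]) simp
  moreover have "w \<in> L2 P"
    using add.hyps(2,4) by (intro L2_dominated[OF measurable_F_P[OF add.hyps(3) order_refl] add.prems]) simp
  ultimately show ?case
    using add by (intro scalar_closure_add)
next
  case (seq U)
  have le: "U i \<omega> \<le> f \<omega>" if "\<omega> \<in> space P" for i \<omega>
    using seq that by (intro incseq_le) (auto simp: incseq_def le_fun_def)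
  have UP: "U i \<in> borel_measurable P" for i
    using seq(1) measurable_F_P by auto
  have abs_le: "\<bar>U i \<omega>\<bar> \<le> \<bar>f \<omega>\<bar>" if "\<omega> \<in> space P" for i \<omega>
    using le[OF that, of i] seq(2)[of i \<omega>] by linarith
  have UL2: "U i \<in> L2 P" for i
    using abs_le by (intro L2_dominated[OF UP seq.prems] AE_I2) simp
  show ?case
  proof (rule scalar_closure_dominated_limit[where f=U, OF _ UP L2_measurable[OF seq.prems] seq.prems])
    show "U i \<in> scalar_closure v" for i
      by (rule seq.IH[OF UL2])
  qed (use seq.hyps abs_le in auto)
qed

lemma L2_F_scalar_closure:
  fixes f :: "'a \<Rightarrow> real"
  assumes "f \<in> borel_measurable (F T)" "f \<in> L2 P"
  shows "f \<in> scalar_closure v"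
proof -
  have [measurable]: "f \<in> borel_measurable (F T)" "f \<in> borel_measurable P"
    using assms L2_measurable by auto
  have "(\<lambda>\<omega>. max 0 (f \<omega>)) \<in> L2 P" "(\<lambda>\<omega>. max 0 (- f \<omega>)) \<in> L2 P"
    by (rule L2_dominated[OF _ assms(2)]; simp)+
  then have "(\<lambda>\<omega>. max 0 (f \<omega>)) \<in> scalar_closure v" "(\<lambda>\<omega>. max 0 (- f \<omega>)) \<in> scalar_closure v"
    by (intro nonneg_scalar_closure; simp)+
  from scalar_closure_diff[OF this] have "(\<lambda>\<omega>. max 0 (f \<omega>) - max 0 (- f \<omega>)) \<in> scalar_closure v" .
  moreover have "max 0 (f \<omega>) - max 0 (- f \<omega>) = f \<omega>" for \<omega>
    by simp
  ultimately show ?thesis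
    by (simp only:)
qed

text \<open>Each coordinate is approximated along its own axis vector, and the closure is a vector
  space.\<close>

proposition Lp_F_ito_closure:
  fixes X :: "'a \<Rightarrow> real^'d"
  assumes "X \<in> Lp P (F T) 2"
  shows "X \<in> ito_closure"
proof -
  have X: "X \<in> borel_measurable (F T)"
    using assms by (simp add: Lp_2_iff)
  have X2: "X \<in> L2 P"
    using assms measurable_F_P[OF X order_refl] by (simp add: Lp_2_iff L2_def)
  have "(\<lambda>\<omega>. X \<omega> $ k *\<^sub>R axis k 1) \<in> ito_closure" for k
  proof -
    have "(\<lambda>\<omega>. X \<omega> $ k) \<in> borel_measurable (F T)"
      using X by measurable
    then have "(\<lambda>\<omega>. X \<omega> $ k) \<in> scalar_closure (axis k 1 :: real^'d)"
      by (intro L2_F_scalar_closure L2_vec_nth X2)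
    then show ?thesis
      by (simp add: scalar_closure_def)
  qed
  then have "(\<lambda>\<omega>. \<Sum>k\<in>UNIV. X \<omega> $ k *\<^sub>R axis k 1) \<in> ito_closure"
    by (intro ito_closure_sum) auto
  moreover have "(\<Sum>k\<in>UNIV. x $ k *\<^sub>R axis k 1) = x" for x :: "real^'d"
    using basis_expansion[of x] by (simp add: scalar_mult_eq_scaleR)
  ultimately show ?thesis
    by (simp only:)
qed

end

section \<open>Martingale representation\<close>

context brownian
begin

lemma simple_pairs_progressive:
  fixes I :: "'a \<Rightarrow> real^'d"
  assumes "(\<phi>, I) \<in> simple_pairs t u"
  shows "(\<lambda>(s, \<omega>). \<phi> s \<omega>) \<in> borel_measurable (restrict_space borel {t..u} \<Otimes>\<^sub>M F u)"
proof -
  obtain n \<tau> c where si: "simple_integrand P F t u n \<tau> c" and \<phi>: "\<phi> = simple_process n \<tau> c"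
    using assms by (rule simple_pairsE)
  let ?N = "restrict_space borel {t..u} \<Otimes>\<^sub>M F u"
  have "(\<lambda>p. indicator {\<tau> i<..\<tau> (Suc i)} (fst p) *\<^sub>R c i (snd p)) \<in> borel_measurable ?N" if i: "i < n" for i
  proof -
    have [measurable]: "c i \<in> borel_measurable (F u)"
      using measurable_F_mono[OF simple_grid(4)[OF si i]] simple_grid(2)[OF si, of i] i by simp
    have "(\<lambda>s. indicator {\<tau> i<..\<tau> (Suc i)} s :: real) \<in> borel_measurable (restrict_space borel {t..u})"
      by (intro measurable_restrict_space1) measurable
    from measurable_compose[OF measurable_fst this]
    have [measurable]: "(\<lambda>p. indicator {\<tau> i<..\<tau> (Suc i)} (fst p) :: real) \<in> borel_measurable ?N" .
    show ?thesis
      by measurable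
  qed
  then show ?thesis
    unfolding \<phi> simple_process_def case_prod_unfold by (intro borel_measurable_sum) simp
qed

lemma vec_cond_exp_L2_F:
  fixes X :: "'a \<Rightarrow> real^'d"
  assumes "X \<in> L2 P" "s \<le> T"
  shows "vec_cond_exp P (F s) X \<in> L2 P" "msq P (vec_cond_exp P (F s) X) \<le> msq P X"
    "vec_cond_exp P (F s) X \<in> borel_measurable (F s)" "vec_cond_exp P (F s) X \<in> Lp P (F s) 2"
proof -
  interpret S: prob_subalgebra P "F s"
    by (rule prob_subalgebra_F[OF assms(2)])
  show *: "vec_cond_exp P (F s) X \<in> L2 P" "msq P (vec_cond_exp P (F s) X) \<le> msq P X"
    "vec_cond_exp P (F s) X \<in> borel_measurable (F s)"
    using S.vec_cond_exp_L2[OF assms(1)] S.vec_cond_exp_measurable by auto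
  then show "vec_cond_exp P (F s) X \<in> Lp P (F s) 2"
    by (simp add: Lp_2_iff L2_def)
qed

text \<open>The constant \<open>x\<close> cancels in the difference of conditional expectations, and
  each of these is a contraction; the factor 4 is 2 + 2 from \<open>msq_diff_le\<close>.\<close>

lemma cond_exp_diff_approx:
  fixes X I :: "'a \<Rightarrow> real^'d"
  assumes X: "X \<in> L2 P" and I: "I \<in> L2 P" and st: "s \<le> T" "u \<le> T" and K: "K \<in> borel_measurable P"
    "AE \<omega> in P. K \<omega> = vec_cond_exp P (F u) I \<omega> - vec_cond_exp P (F s) I \<omega>"
  shows "msq P (\<lambda>\<omega>. K \<omega> - (vec_cond_exp P (F u) X \<omega> - vec_cond_exp P (F s) X \<omega>)) \<le> 4 * msq P (\<lambda>\<omega>. X \<omega> - (x + I \<omega>))"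
proof -
  define Z where "Z \<omega> = X \<omega> - (x + I \<omega>)" for \<omega>
  have Z: "Z \<in> L2 P"
    unfolding Z_def by (intro L2_diff L2_add const_L2 X I)
  have Zeq: "AE \<omega> in P. vec_cond_exp P (F r) Z \<omega> = vec_cond_exp P (F r) X \<omega> - x - vec_cond_exp P (F r) I \<omega>"
    if r: "r \<le> T" for r
  proof -
    interpret S: prob_subalgebra P "F r"
      by (rule prob_subalgebra_F[OF r])
    have int: "integrable P X" "integrable P I" "integrable P (\<lambda>\<omega>. x)" "integrable P (\<lambda>\<omega>. X \<omega> - x)"
      using L2_integrable[OF finite_measure_axioms X] L2_integrable[OF finite_measure_axioms I] by auto
    have "Z = (\<lambda>\<omega>. (X \<omega> - x) - I \<omega>)"
      by (auto simp: Z_def)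
    then show ?thesis
      using S.vec_cond_exp_diff[OF int(4,2)] S.vec_cond_exp_diff[OF int(1,3)]
        S.vec_cond_exp_F_meas[OF int(3)] by auto
  qed
  note meas = L2_measurable[OF vec_cond_exp_L2_F(1)[OF X]] L2_measurable[OF vec_cond_exp_L2_F(1)[OF Z]]
  have "msq P (\<lambda>\<omega>. K \<omega> - (vec_cond_exp P (F u) X \<omega> - vec_cond_exp P (F s) X \<omega>))
      = msq P (\<lambda>\<omega>. vec_cond_exp P (F s) Z \<omega> - vec_cond_exp P (F u) Z \<omega>)"
  proof (rule msq_cong_AE)
    show "AE \<omega> in P. K \<omega> - (vec_cond_exp P (F u) X \<omega> - vec_cond_exp P (F s) X \<omega>)
        = vec_cond_exp P (F s) Z \<omega> - vec_cond_exp P (F u) Z \<omega>"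
      using Zeq[OF st(1)] Zeq[OF st(2)] K(2)
    proof eventually_elim
      case (elim \<omega>)
      show ?case
        unfolding elim by simp
    qed
  qed (intro borel_measurable_diff K meas st)+
  also have "\<dots> \<le> 2 * msq P (vec_cond_exp P (F s) Z) + 2 * msq P (vec_cond_exp P (F u) Z)"
    by (intro msq_diff_le vec_cond_exp_L2_F(1) Z st)
  also have "\<dots> \<le> 4 * msq P Z"
    using vec_cond_exp_L2_F(2)[OF Z st(1)] vec_cond_exp_L2_F(2)[OF Z st(2)] by simp
  finally show ?thesis
    by (simp add: Z_def[abs_def])
qed

text \<open>Simple processes whose integrals approximate \<open>X\<close> are cut to
  \<open>(t, u]\<close>; by the isometry those cut at \<open>T\<close> are Cauchy, and their limit
  is the integrand. Cuts at different \<open>u\<close> agree up to the earlier cut, so one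
  \<open>z\<close> and one subsequence serve all \<open>u\<close>.\<close>

theorem martingale_representation:
  fixes X :: "'a \<Rightarrow> real^'d"
  assumes X: "X \<in> Lp P (F T) 2" and t: "0 \<le> t" "t \<le> T"
  obtains z where "z \<in> L2_progressive P F t T"
    "\<And>u. t \<le> u \<Longrightarrow> u \<le> T \<Longrightarrow> is_ito_integral P F B t u z
      (\<lambda>\<omega>. vec_cond_exp P (F u) X \<omega> - vec_cond_exp P (F t) X \<omega>)"
proof -
  have XL2: "X \<in> L2 P"
    using ito_closure_L2[OF Lp_F_ito_closure[OF X]] .
  define approx where "approx k x \<phi> I \<longleftrightarrow> (\<phi>, I) \<in> simple_pairs 0 T
      \<and> msq P (\<lambda>\<omega>. X \<omega> - (x + I \<omega>)) < inverse (real (Suc k))" for k x \<phi> I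
  have "\<exists>x \<phi> I. approx k x \<phi> I" for k
  proof -
    have "0 < inverse (real (Suc k))"
      by simp
    then obtain x \<phi> I where "(\<phi>, I) \<in> simple_pairs 0 T" "msq P (\<lambda>\<omega>. X \<omega> - (x + I \<omega>)) < inverse (real (Suc k))"
      by (rule ito_closureE[OF Lp_F_ito_closure[OF X]])
    then show ?thesis
      unfolding approx_def by blast
  qed
  then obtain x \<phi> I where "\<And>k. approx k (x k) (\<phi> k) (I k)"
    by metis
  then have \<phi>: "\<And>k. (\<phi> k, I k) \<in> simple_pairs 0 T"
      "\<And>k. msq P (\<lambda>\<omega>. X \<omega> - (x k + I k \<omega>)) < inverse (real (Suc k))"
    unfolding approx_def by blast+
  have IL2: "I k \<in> L2 P" for k
    by (rule simple_pairs_L2[OF \<phi>(1)])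
  let ?D = "\<lambda>u \<omega>. vec_cond_exp P (F u) X \<omega> - vec_cond_exp P (F t) X \<omega>"
  define \<psi> where "\<psi> u k s \<omega> = indicator {t<..u} s *\<^sub>R \<phi> k s \<omega>" for u k s \<omega>
  have "\<exists>J. (\<psi> u k, J) \<in> simple_pairs t u \<and> msq P (\<lambda>\<omega>. J \<omega> - ?D u \<omega>) \<le> 4 * inverse (real (Suc k))"
    if u: "t \<le> u" "u \<le> T" for u k
  proof -
    obtain J where J: "(\<psi> u k, J) \<in> simple_pairs t u"
        "AE \<omega> in P. J \<omega> = vec_cond_exp P (F u) (I k) \<omega> - vec_cond_exp P (F t) (I k) \<omega>"
      unfolding \<psi>_def[abs_def] using simple_pairs_restrict[OF \<phi>(1) order_refl order_refl t(1) u] by blast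
    have "J \<in> borel_measurable P"
      using L2_measurable[OF simple_pairs_integral_L2[OF J(1) t(1) u(2)]] .
    from cond_exp_diff_approx[OF XL2 IL2 t(2) u(2) this J(2), of "x k"] \<phi>(2)[of k] J(1)
    show ?thesis
      by (intro exI[of _ J]) auto
  qed
  then have "\<forall>u k. \<exists>J. t \<le> u \<longrightarrow> u \<le> T \<longrightarrow> (\<psi> u k, J) \<in> simple_pairs t u
      \<and> msq P (\<lambda>\<omega>. J \<omega> - ?D u \<omega>) \<le> 4 * inverse (real (Suc k))"
    by blast
  then obtain J where "\<forall>u k. t \<le> u \<longrightarrow> u \<le> T \<longrightarrow> (\<psi> u k, J u k) \<in> simple_pairs t u
      \<and> msq P (\<lambda>\<omega>. J u k \<omega> - ?D u \<omega>) \<le> 4 * inverse (real (Suc k))"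
    unfolding choice_iff by blast
  then have J: "\<And>u k. t \<le> u \<Longrightarrow> u \<le> T \<Longrightarrow> (\<psi> u k, J u k) \<in> simple_pairs t u"
      "\<And>u k. t \<le> u \<Longrightarrow> u \<le> T \<Longrightarrow> msq P (\<lambda>\<omega>. J u k \<omega> - ?D u \<omega>) \<le> 4 * inverse (real (Suc k))"
    by blast+
  have JL2: "J u k \<in> L2 P" if "t \<le> u" "u \<le> T" for u k
    by (rule simple_pairs_integral_L2[OF J(1)[OF that] t(1) that(2)])
  have DL2: "?D u \<in> L2 P" if "u \<le> T" for u
    by (intro L2_diff vec_cond_exp_L2_F(1)[OF XL2] that t(2))
  define S where "S k = (\<lambda>(s, \<omega>). \<psi> T k s \<omega>)" for k
  have SL2: "S k \<in> L2 (PQ t T)" for k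
    unfolding S_def by (rule simple_pairs_isometry(1)[OF J(1)[OF t(2) order_refl] t(1) order_refl])
  have cauchy: "\<exists>N. \<forall>i\<ge>N. \<forall>j\<ge>N. msq (PQ t T) (\<lambda>p. S i p - S j p) < e" if e: "0 < e" for e
  proof -
    \<comment> \<open>16 = 2 * 4 + 2 * 4: two distances to the limit, each at most
      \<open>4 * inverse (real (Suc N))\<close>, and each doubled by the quadratic triangle
      inequality.\<close>
    obtain N where N: "inverse (real (Suc N)) < e / 16"
      using reals_Archimedean[of "e / 16"] e by auto
    have "msq (PQ t T) (\<lambda>p. S i p - S j p) < e" if ij: "N \<le> i" "N \<le> j" for i j
    proof -
      have "msq (PQ t T) (\<lambda>p. S i p - S j p) = msq P (\<lambda>\<omega>. J T i \<omega> - J T j \<omega>)"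
        using simple_pairs_isometry(2)[OF simple_pairs_diff[OF J(1)[OF t(2) order_refl] J(1)[OF t(2) order_refl]] t(1) order_refl]
        unfolding S_def case_prod_unfold .
      also have "\<dots> \<le> 2 * msq P (\<lambda>\<omega>. J T i \<omega> - ?D T \<omega>) + 2 * msq P (\<lambda>\<omega>. ?D T \<omega> - J T j \<omega>)"
        by (intro msq_triangle3 JL2 DL2 t order_refl)
      also have "\<dots> \<le> 2 * (4 * inverse (real (Suc i))) + 2 * (4 * inverse (real (Suc j)))"
        using J(2)[OF t(2) order_refl, of i] J(2)[OF t(2) order_refl, of j]
        unfolding msq_minus_commute[of P "?D T"] by simp
      also have "\<dots> \<le> 16 * inverse (real (Suc N))"
      proof -
        have "inverse (real (Suc m)) \<le> inverse (real (Suc N))" if "N \<le> m" for m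
          using that by (intro le_imp_inverse_le) auto
        from this[OF ij(1)] this[OF ij(2)] show ?thesis
          by linarith
      qed
      also have "\<dots> < e"
        using N by simp
      finally show ?thesis .
    qed
    then show ?thesis by blast
  qed
  obtain r :: "nat \<Rightarrow> nat" where r: "strict_mono r" "(\<lambda>p. lim (\<lambda>k. S (r k) p)) \<in> L2 (PQ t T)"
      "(\<lambda>k. msq (PQ t T) (\<lambda>p. S (r k) p - lim (\<lambda>k. S (r k) p))) \<longlonglongrightarrow> 0"
    using L2_complete[OF finite_PQ SL2 cauchy] by blast
  \<comment> \<open>\<open>lim\<close> is total and preserves measurability even off the set of
    convergence, so this pointwise limit is progressive, whereas a limit known only up to null sets
    of \<open>PQ t T\<close> need not be.\<close>
  define z where "z s \<omega> = lim (\<lambda>k. \<psi> T (r k) s \<omega>)" for s \<omega>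
  have z_eq: "(\<lambda>(s, \<omega>). z s \<omega>) = (\<lambda>p. lim (\<lambda>k. S (r k) p))"
    by (auto simp: z_def S_def)
  have \<psi>_eq: "\<psi> u k s \<omega> = \<psi> T k s \<omega>" if "s \<le> u" "u \<le> T" for u k s \<omega>
    using that by (auto simp: \<psi>_def indicator_def)
  have prog: "(\<lambda>(s, \<omega>). z s \<omega>) \<in> borel_measurable (restrict_space borel {t..u} \<Otimes>\<^sub>M F u)"
    if u: "t \<le> u" "u \<le> T" for u
    unfolding z_eq
  proof (rule borel_measurable_lim_metric)
    fix k
    \<comment> \<open>Up to time \<open>u\<close> the process cut at \<open>T\<close> coincides with
      the one cut at \<open>u\<close>, whose coefficients are known at time
      \<open>u\<close>.\<close>
    have "S (r k) \<in> borel_measurable (restrict_space borel {t..u} \<Otimes>\<^sub>M F u)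
        \<longleftrightarrow> (\<lambda>(s, \<omega>). \<psi> u (r k) s \<omega>) \<in> borel_measurable (restrict_space borel {t..u} \<Otimes>\<^sub>M F u)"
      using \<psi>_eq[OF _ u(2)] by (intro measurable_cong)
        (auto simp: S_def space_pair_measure space_restrict_space)
    then show "S (r k) \<in> borel_measurable (restrict_space borel {t..u} \<Otimes>\<^sub>M F u)"
      using simple_pairs_progressive[OF J(1)[OF u]] by blast
  qed
  have "(\<lambda>(s, \<omega>). z s \<omega>) \<in> L2 (PQ t T)"
    using r(2) by (simp only: z_eq)
  then have z: "z \<in> L2_progressive P F t T"
    using prog L2_integrable_sq[of "\<lambda>(s, \<omega>). z s \<omega>" "PQ t T"] unfolding L2_progressive_def
    by (simp add: case_prod_unfold)
  show ?thesis
  proof (rule that[OF z])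
    fix u assume u: "t \<le> u" "u \<le> T"
    show "is_ito_integral P F B t u z (?D u)"
      unfolding is_ito_integral_iff
    proof (intro conjI exI[of _ "\<lambda>k. \<psi> u (r k)"] exI[of _ "\<lambda>k. J u (r k)"] allI J(1) u)
      have "vec_cond_exp P (F u) X \<in> borel_measurable (F u)" "vec_cond_exp P (F t) X \<in> borel_measurable (F u)"
        using vec_cond_exp_L2_F(3)[OF XL2 u(2)] measurable_F_mono[OF vec_cond_exp_L2_F(3)[OF XL2 t(2)] u(1)] by auto
      then show "?D u \<in> Lp P (F u) 2"
        using L2_integrable_sq[OF DL2[OF u(2)]] by (simp add: Lp_2_iff)
      have le: "msq (PQ t u) (\<lambda>(s, \<omega>). \<psi> u (r k) s \<omega> - z s \<omega>)
          \<le> msq (PQ t T) (\<lambda>p. S (r k) p - lim (\<lambda>k. S (r k) p))" for k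
      proof -
        have "msq (PQ t u) (\<lambda>(s, \<omega>). \<psi> u (r k) s \<omega> - z s \<omega>)
            = msq (PQ t u) (\<lambda>p. S (r k) p - lim (\<lambda>k. S (r k) p))"
          unfolding msq_def using \<psi>_eq[OF _ u(2)]
          by (intro Bochner_Integration.integral_cong)
            (auto simp: S_def z_def space_pair_measure space_restrict_space)
        also have "\<dots> \<le> msq (PQ t T) (\<lambda>p. S (r k) p - lim (\<lambda>k. S (r k) p))"
          by (rule L2_PQ_mono(2)[OF order_refl u(2) L2_diff[OF SL2 r(2)]])
        finally show ?thesis .
      qed
      show "(\<lambda>k. msq (PQ t u) (\<lambda>(s, \<omega>). \<psi> u (r k) s \<omega> - z s \<omega>)) \<longlonglongrightarrow> 0"
        by (rule tendsto_sandwich[OF _ _ tendsto_const r(3)]) (use le in \<open>auto intro: always_eventually\<close>)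
      have "(\<lambda>k. 4 * inverse (real (Suc (r k)))) \<longlonglongrightarrow> 4 * 0"
        using LIMSEQ_subseq_LIMSEQ[OF LIMSEQ_inverse_real_of_nat r(1)]
        by (intro tendsto_mult tendsto_const) (simp add: comp_def)
      then have lim: "(\<lambda>k. 4 * inverse (real (Suc (r k)))) \<longlonglongrightarrow> 0"
        by simp
      show "(\<lambda>k. msq P (\<lambda>\<omega>. J u (r k) \<omega> - ?D u \<omega>)) \<longlonglongrightarrow> 0"
        by (rule tendsto_sandwich[OF _ _ tendsto_const lim]) (use J(2)[OF u] in \<open>auto intro: always_eventually\<close>)
    qed
  qed
qed

text \<open>The first component is the conditional expectation of \<open>X\<close> at
  \<open>t\<close>. Before \<open>t\<close> the tower property applies; from \<open>t\<close> on,
  the Ito integral is the difference of the conditional expectations at \<open>u\<close> and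
  \<open>t\<close>.\<close>

lemma J_mart_representation:
  fixes X :: "'a \<Rightarrow> real^'d"
  assumes X: "X \<in> Lp P (F T) 2" and t: "0 \<le> t" "t \<le> T"
  obtains p where "p \<in> R_space P F T t"
    "\<And>u. 0 \<le> u \<Longrightarrow> u \<le> T \<Longrightarrow> J_mart P F B t p u \<in> Lp P (F u) 2"
    "\<And>u. 0 \<le> u \<Longrightarrow> u \<le> T \<Longrightarrow> AE \<omega> in P. J_mart P F B t p u \<omega> = vec_cond_exp P (F u) X \<omega>"
proof -
  have XL2: "X \<in> L2 P"
    using ito_closure_L2[OF Lp_F_ito_closure[OF X]] .
  obtain z where z: "z \<in> L2_progressive P F t T"
    "\<And>u. t \<le> u \<Longrightarrow> u \<le> T \<Longrightarrow> is_ito_integral P F B t u z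
      (\<lambda>\<omega>. vec_cond_exp P (F u) X \<omega> - vec_cond_exp P (F t) X \<omega>)"
    using martingale_representation[OF X t] by blast
  let ?\<xi> = "vec_cond_exp P (F t) X"
  let ?p = "(?\<xi>, z)"
  have \<xi>: "?\<xi> \<in> Lp P (F t) 2" "?\<xi> \<in> L2 P"
    by (rule vec_cond_exp_L2_F[OF XL2 t(2)])+
  have J_less: "J_mart P F B t ?p u = vec_cond_exp P (F u) ?\<xi>" if "u < t" for u
    using that by (intro ext) simp
  have J_ge: "J_mart P F B t ?p u = (\<lambda>\<omega>. ?\<xi> \<omega> + ito_integral P F B t u z \<omega>)" if "t \<le> u" for u
    using that by (intro ext) simp
  show ?thesis
  proof (rule that[of ?p])
    show "?p \<in> R_space P F T t"
      using \<xi> z(1) by (simp add: R_space_def)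
  next
    fix u assume u: "0 \<le> u" "u \<le> T"
    show "J_mart P F B t ?p u \<in> Lp P (F u) 2"
    proof (cases "u < t")
      case True
      then show ?thesis
        unfolding J_less[OF True] by (intro vec_cond_exp_L2_F(4) \<xi>(2) u)
    next
      case False
      then have tu: "t \<le> u" by simp
      have I: "ito_integral P F B t u z \<in> Lp P (F u) 2"
        by (rule ito_integral_eq(1)[OF z(1) t(1) tu u(2) z(2)[OF tu u(2)]])
      then have IL2: "ito_integral P F B t u z \<in> L2 P"
        using measurable_F_P[OF _ u(2)] by (auto simp: Lp_2_iff L2_def)
      have "(\<lambda>\<omega>. ?\<xi> \<omega> + ito_integral P F B t u z \<omega>) \<in> borel_measurable (F u)"
        using I measurable_F_mono[OF _ tu] \<xi>(1)
        by (intro borel_measurable_add) (auto simp: Lp_2_iff)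
      then show ?thesis
        unfolding J_ge[OF tu] using L2_integrable_sq[OF L2_add[OF \<xi>(2) IL2]] by (simp add: Lp_2_iff)
    qed
    show "AE \<omega> in P. J_mart P F B t ?p u \<omega> = vec_cond_exp P (F u) X \<omega>"
    proof (cases "u < t")
      case True
      interpret S: prob_subalgebra P "F u"
        by (rule prob_subalgebra_F[OF u(2)])
      show ?thesis
        unfolding J_less[OF True] using True
        by (intro S.vec_cond_exp_nested subalgebra_F subalgebra_F_F t
            L2_integrable[OF finite_measure_axioms XL2]) simp
    next
      case False
      then have tu: "t \<le> u" by simp
      show ?thesis
        unfolding J_ge[OF tu] using ito_integral_eq(2)[OF z(1) t(1) tu u(2) z(2)[OF tu u(2)]]
        by eventually_elim simp
    qed
  qed
qed

end

section \<open>Set-valued random variables and their selections\<close>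

lemma dense_sequence:
  obtains D :: "nat \<Rightarrow> real^'d" where "\<And>x e. 0 < e \<Longrightarrow> \<exists>k. dist (D k) x < e"
proof -
  obtain S :: "(real^'d) set" where S: "countable S" "\<And>X. open X \<Longrightarrow> X \<noteq> {} \<Longrightarrow> \<exists>d\<in>S. d \<in> X"
    using countable_dense_setE by blast
  have "S \<noteq> {}"
    using S(2)[of UNIV] by auto
  show ?thesis
  proof
    fix x :: "real^'d" and e :: real assume "0 < e"
    then obtain d where "d \<in> S" "d \<in> ball x e"
      using S(2)[of "ball x e"] by auto
    moreover obtain k where "from_nat_into S k = d"
      using from_nat_into_surj[OF S(1) \<open>d \<in> S\<close>] by blast
    ultimately show "\<exists>k. dist (from_nat_into S k) x < e"
      by (auto simp: dist_commute)
  qed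
qed

context prob_subalgebra
begin

lemma space_G: "space G = space P"
  using subalg by (simp add: subalgebra_def)

lemma Lp_2_L2: "f \<in> Lp P G 2 \<Longrightarrow> f \<in> L2 P"
  using measurable_from_subalg[OF subalg] by (auto simp: Lp_2_iff L2_def)

lemma Lp_closure_2_iff:
  "f \<in> Lp_closure P G 2 V \<longleftrightarrow> f \<in> Lp P G 2 \<and> (\<forall>e>0. \<exists>g\<in>V. msq P (\<lambda>\<omega>. f \<omega> - g \<omega>) < e)"
  by (simp add: Lp_closure_def msq_def)

text \<open>Mean-square convergence gives an almost surely convergent subsequence, and the values of
  \<open>X\<close> are closed.\<close>

lemma selections_closed:
  assumes X: "set_valued_rv G X"
  shows "Lp_closed P G 2 (selections P G 2 X)"
  unfolding Lp_closed_def
proof (intro conjI subsetI)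
  fix f assume "f \<in> selections P G 2 X"
  then show "f \<in> Lp P G 2"
    by (simp add: selections_def)
next
  fix f assume "f \<in> Lp_closure P G 2 (selections P G 2 X)"
  then have f: "f \<in> Lp P G 2" and lim: "\<And>e. 0 < e \<Longrightarrow> \<exists>g\<in>selections P G 2 X. msq P (\<lambda>\<omega>. f \<omega> - g \<omega>) < e"
    by (auto simp: Lp_closure_2_iff)
  have "\<exists>g. g \<in> selections P G 2 X \<and> msq P (\<lambda>\<omega>. f \<omega> - g \<omega>) < inverse (real (Suc n))" for n
    using lim[of "inverse (real (Suc n))"] by auto
  then obtain g where g: "\<And>n. g n \<in> selections P G 2 X" "\<And>n. msq P (\<lambda>\<omega>. f \<omega> - g n \<omega>) < inverse (real (Suc n))"
    by metis
  have gL2: "g n \<in> L2 P" for n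
    using g(1)[of n] by (auto simp: selections_def intro: Lp_2_L2)
  have "(\<lambda>n. msq P (\<lambda>\<omega>. g n \<omega> - f \<omega>)) \<longlonglongrightarrow> 0"
    unfolding msq_minus_commute[of P "g _"]
    by (rule tendsto_sandwich[OF _ _ tendsto_const LIMSEQ_inverse_real_of_nat])
      (use g(2) in \<open>auto intro: always_eventually less_imp_le\<close>)
  then obtain r :: "nat \<Rightarrow> nat" where r: "AE \<omega> in P. (\<lambda>n. g (r n) \<omega>) \<longlonglongrightarrow> f \<omega>"
    using L2_tendsto_AE_subseq[of g, OF gL2 Lp_2_L2[OF f]] by blast
  have "AE \<omega> in P. \<forall>n. g n \<omega> \<in> X \<omega>"
    using g(1) by (subst AE_all_countable) (auto simp: selections_def)
  then have "AE \<omega> in P. f \<omega> \<in> X \<omega>"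
    using r AE_space
  proof eventually_elim
    case (elim \<omega>)
    then have "closed (X \<omega>)"
      using X by (simp add: set_valued_rv_def space_G)
    then show ?case
      using elim closed_sequentially[of "X \<omega>" "\<lambda>n. g (r n) \<omega>"] by blast
  qed
  then show "f \<in> selections P G 2 X"
    using f by (simp add: selections_def)
qed

lemma Lp_2_if:
  assumes "f \<in> Lp P G 2" "g \<in> Lp P G 2" "D \<in> sets G"
  shows "(\<lambda>\<omega>. if \<omega> \<in> D then f \<omega> else g \<omega>) \<in> Lp P G 2"
proof -
  have [measurable]: "f \<in> borel_measurable G" "g \<in> borel_measurable G" "D \<in> sets G"
    using assms by (auto simp: Lp_2_iff)
  have m: "(\<lambda>\<omega>. if \<omega> \<in> D then f \<omega> else g \<omega>) \<in> borel_measurable G"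
    by measurable
  have "integrable P (\<lambda>\<omega>. (norm (f \<omega>))\<^sup>2 + (norm (g \<omega>))\<^sup>2)"
    using assms by (auto simp: Lp_2_iff)
  moreover have [measurable]: "(\<lambda>\<omega>. if \<omega> \<in> D then f \<omega> else g \<omega>) \<in> borel_measurable P"
    by (rule measurable_from_subalg[OF subalg m])
  then have "(\<lambda>\<omega>. (norm (if \<omega> \<in> D then f \<omega> else g \<omega>))\<^sup>2) \<in> borel_measurable P"
    by (intro borel_measurable_power measurable_compose[OF _ borel_measurable_norm])
  ultimately have "integrable P (\<lambda>\<omega>. (norm (if \<omega> \<in> D then f \<omega> else g \<omega>))\<^sup>2)"
    by (rule Bochner_Integration.integrable_bound) auto
  then show ?thesis
    using m by (simp add: Lp_2_iff)
qed

lemma selections_decomposable: "decomposable G (selections P G 2 X)"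
  unfolding decomposable_def
proof (intro ballI)
  fix f g D assume f: "f \<in> selections P G 2 X" and g: "g \<in> selections P G 2 X" and D: "D \<in> sets G"
  have "AE \<omega> in P. f \<omega> \<in> X \<omega>" "AE \<omega> in P. g \<omega> \<in> X \<omega>"
    using f g by (simp_all add: selections_def)
  then have "AE \<omega> in P. (if \<omega> \<in> D then f \<omega> else g \<omega>) \<in> X \<omega>"
    by eventually_elim simp
  then show "(\<lambda>\<omega>. if \<omega> \<in> D then f \<omega> else g \<omega>) \<in> selections P G 2 X"
    using Lp_2_if[OF _ _ D, of f g] f g by (simp add: selections_def)
qed

text \<open>Nonempty closed sets contain nearest points, so a sublevel set of the distance is the
  event that \<open>X\<close> hits a closed ball, and hitting events of closed sets are what
  measurability of \<open>X\<close> supplies.\<close>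

lemma infdist_measurable:
  fixes X :: "'a \<Rightarrow> (real^'d) set"
  assumes X: "set_valued_rv G X"
  shows "(\<lambda>\<omega>. infdist q (X \<omega>)) \<in> borel_measurable G"
proof (subst borel_measurable_iff_le, intro allI)
  fix a
  have "infdist q (X \<omega>) \<le> a \<longleftrightarrow> X \<omega> \<inter> cball q a \<noteq> {}" if "\<omega> \<in> space G" for \<omega>
  proof
    assume le: "infdist q (X \<omega>) \<le> a"
    have "closed (X \<omega>)" "X \<omega> \<noteq> {}"
      using X that by (auto simp: set_valued_rv_def)
    then obtain x where "x \<in> X \<omega>" "infdist q (X \<omega>) = dist q x"
      using infdist_attains_inf by metis
    then show "X \<omega> \<inter> cball q a \<noteq> {}"
      using le by auto
  next
    assume "X \<omega> \<inter> cball q a \<noteq> {}"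
    then obtain x where "x \<in> X \<omega>" "dist q x \<le> a"
      by auto
    then show "infdist q (X \<omega>) \<le> a"
      using infdist_le order_trans by blast
  qed
  then have "{\<omega> \<in> space G. infdist q (X \<omega>) \<le> a} = {\<omega> \<in> space G. X \<omega> \<inter> cball q a \<noteq> {}}"
    by auto
  then show "{\<omega> \<in> space G. infdist q (X \<omega>) \<le> a} \<in> sets G"
    using X by (simp add: set_valued_rv_def)
qed

text \<open>Choosing the first suitable point of a fixed dense sequence keeps the choice measurable.
  Suitable points exist close to a nearest point of \<open>X \<omega>\<close>, which lies strictly
  within \<open>\<rho> \<omega>\<close> of \<open>h \<omega>\<close>.\<close>

lemma selection_step:
  fixes X :: "'a \<Rightarrow> (real^'d) set"
  assumes X: "set_valued_rv G X" and h: "h \<in> borel_measurable G" "\<rho> \<in> borel_measurable G"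
    and lt: "\<And>\<omega>. \<omega> \<in> space G \<Longrightarrow> infdist (h \<omega>) (X \<omega>) < \<rho> \<omega>" and \<epsilon>: "0 < \<epsilon>"
  shows "\<exists>h'\<in>borel_measurable G. \<forall>\<omega>\<in>space G. dist (h' \<omega>) (h \<omega>) < \<rho> \<omega> \<and> infdist (h' \<omega>) (X \<omega>) < \<epsilon>"
proof -
  obtain D :: "nat \<Rightarrow> real^'d" where D: "\<And>x e. 0 < e \<Longrightarrow> \<exists>k. dist (D k) x < e"
    using dense_sequence by blast
  define Q where "Q k \<omega> \<longleftrightarrow> dist (D k) (h \<omega>) < \<rho> \<omega> \<and> infdist (D k) (X \<omega>) < \<epsilon>" for k \<omega>
  have ex: "\<exists>k. Q k \<omega>" if \<omega>: "\<omega> \<in> space G" for \<omega>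
  proof -
    have "closed (X \<omega>)" "X \<omega> \<noteq> {}"
      using X \<omega> by (auto simp: set_valued_rv_def)
    then obtain x where x: "x \<in> X \<omega>" "infdist (h \<omega>) (X \<omega>) = dist (h \<omega>) x"
      using infdist_attains_inf by metis
    obtain k where k: "dist (D k) x < min \<epsilon> (\<rho> \<omega> - dist (h \<omega>) x)"
      using D[of "min \<epsilon> (\<rho> \<omega> - dist (h \<omega>) x)" x] lt[OF \<omega>] x(2) \<epsilon> by auto
    have "dist (D k) (h \<omega>) \<le> dist (D k) x + dist (h \<omega>) x"
      by (metis dist_commute dist_triangle)
    moreover have "infdist (D k) (X \<omega>) \<le> dist (D k) x"
      by (rule infdist_le[OF x(1)])
    ultimately show ?thesis
      using k by (intro exI[of _ k]) (auto simp: Q_def)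
  qed
  have Q: "Measurable.pred G (Q k)" for k
  proof -
    have [measurable]: "h \<in> borel_measurable G" "\<rho> \<in> borel_measurable G"
        "(\<lambda>\<omega>. infdist (D k) (X \<omega>)) \<in> borel_measurable G"
      using h infdist_measurable[OF X] by auto
    show ?thesis
      unfolding Q_def[abs_def] by measurable
  qed
  have "(\<lambda>\<omega>. D (LEAST k. Q k \<omega>)) \<in> borel_measurable G"
    using measurable_compose[OF measurable_Least[OF Q], of D borel] by simp
  moreover have "Q (LEAST k. Q k \<omega>) \<omega>" if "\<omega> \<in> space G" for \<omega>
    using LeastI_ex[OF ex[OF that]] .
  ultimately show ?thesis
    by (intro bexI[of _ "\<lambda>\<omega>. D (LEAST k. Q k \<omega>)"]) (auto simp: Q_def)
qed

text \<open>The Kuratowski-Ryll-Nardzewski construction with control of the distance to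
  \<open>q\<close>. The \<open>n\<close>-th approximation is within \<open>e * (1/2)^n\<close> of
  the set and the next move is no longer than that, so the limit lies in the closed set. The start
  costs \<open>e\<close> and the moves sum to at most \<open>2 * e\<close>, whence
  \<open>3 * e\<close>.\<close>

lemma selection_near_point:
  fixes X :: "'a \<Rightarrow> (real^'d) set"
  assumes X: "set_valued_rv G X" and e: "0 < e"
  obtains f where "f \<in> borel_measurable G"
    "\<And>\<omega>. \<omega> \<in> space G \<Longrightarrow> f \<omega> \<in> X \<omega> \<and> dist (f \<omega>) q \<le> infdist q (X \<omega>) + 3 * e"
proof -
  \<comment> \<open>The clause for \<open>n = 0\<close> ties the start to \<open>q\<close>; later
    members are controlled by the step sizes alone.\<close>
  let ?P = "\<lambda>n h. h \<in> borel_measurable G \<and> (\<forall>\<omega>\<in>space G. infdist (h \<omega>) (X \<omega>) < e * (1/2)^n)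
    \<and> (n = 0 \<longrightarrow> (\<forall>\<omega>\<in>space G. dist (h \<omega>) q < infdist q (X \<omega>) + e))"
  have "\<exists>f. \<forall>n. ?P n (f n) \<and> (\<forall>\<omega>\<in>space G. dist (f (Suc n) \<omega>) (f n \<omega>) < e * (1/2)^n)"
  proof (rule dependent_nat_choice)
    have "\<exists>h'\<in>borel_measurable G. \<forall>\<omega>\<in>space G. dist (h' \<omega>) q < infdist q (X \<omega>) + e \<and> infdist (h' \<omega>) (X \<omega>) < e"
      using infdist_measurable[OF X] e by (intro selection_step[OF X]) auto
    then show "\<exists>h. ?P 0 h"
      by auto
  next
    fix h n assume "?P n h"
    then have "\<exists>h'\<in>borel_measurable G. \<forall>\<omega>\<in>space G. dist (h' \<omega>) (h \<omega>) < e * (1/2)^n \<and> infdist (h' \<omega>) (X \<omega>) < e * (1/2)^Suc n"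
      using e by (intro selection_step[OF X]) auto
    then show "\<exists>h'. ?P (Suc n) h' \<and> (\<forall>\<omega>\<in>space G. dist (h' \<omega>) (h \<omega>) < e * (1/2)^n)"
      by auto
  qed
  then obtain f where f: "\<And>n. f n \<in> borel_measurable G"
      "\<And>n \<omega>. \<omega> \<in> space G \<Longrightarrow> infdist (f n \<omega>) (X \<omega>) < e * (1/2)^n"
      "\<And>\<omega>. \<omega> \<in> space G \<Longrightarrow> dist (f 0 \<omega>) q < infdist q (X \<omega>) + e"
      "\<And>n \<omega>. \<omega> \<in> space G \<Longrightarrow> dist (f (Suc n) \<omega>) (f n \<omega>) < e * (1/2)^n"
    by metis
  define F where "F \<omega> = lim (\<lambda>n. f n \<omega>)" for \<omega>
  show ?thesis
  proof (rule that[of F])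
    show "F \<in> borel_measurable G"
      unfolding F_def by (rule borel_measurable_lim_metric[OF f(1)])
    fix \<omega> assume \<omega>: "\<omega> \<in> space G"
    let ?d = "\<lambda>n. f (Suc n) \<omega> - f n \<omega>"
    have d: "norm (?d n) \<le> e * (1/2)^n" for n
      using f(4)[OF \<omega>, of n] by (simp add: dist_norm less_imp_le)
    have geo: "summable (\<lambda>n. e * (1/2)^n)" "(\<Sum>n. e * (1/2)^n) = 2 * e"
      using summable_mult[OF summable_geometric[of "1/2::real"], of e] suminf_mult[OF summable_geometric[of "1/2::real"], of e]
        suminf_geometric[of "1/2::real"] by auto
    have sm: "summable (\<lambda>n. norm (?d n))"
      using d by (intro summable_comparison_test[OF _ geo(1)]) auto
    have "(\<lambda>n. \<Sum>i<n. ?d i) \<longlonglongrightarrow> (\<Sum>i. ?d i)"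
      by (rule summable_LIMSEQ[OF summable_norm_cancel[OF sm]])
    then have "(\<lambda>n. f n \<omega> - f 0 \<omega>) \<longlonglongrightarrow> (\<Sum>i. ?d i)"
      using sum_lessThan_telescope[of "\<lambda>n. f n \<omega>"] by (simp only:)
    from tendsto_add[OF this tendsto_const[of "f 0 \<omega>"]]
    have lim: "(\<lambda>n. f n \<omega>) \<longlonglongrightarrow> f 0 \<omega> + (\<Sum>i. ?d i)"
      by (simp add: add.commute)
    then have F: "F \<omega> = f 0 \<omega> + (\<Sum>i. ?d i)"
      unfolding F_def by (rule limI)
    have "norm (\<Sum>i. ?d i) \<le> (\<Sum>i. norm (?d i))"
      by (rule summable_norm[OF sm])
    also have "\<dots> \<le> 2 * e"
      unfolding geo(2)[symmetric] by (rule suminf_le[OF d sm geo(1)])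
    finally have "dist (F \<omega>) (f 0 \<omega>) \<le> 2 * e"
      by (simp add: F dist_norm)
    then have "dist (F \<omega>) q \<le> infdist q (X \<omega>) + 3 * e"
      using f(3)[OF \<omega>] dist_triangle[of "F \<omega>" q "f 0 \<omega>"] by linarith
    moreover have "F \<omega> \<in> X \<omega>"
    proof -
      have "(\<lambda>n. infdist (f n \<omega>) (X \<omega>)) \<longlonglongrightarrow> infdist (F \<omega>) (X \<omega>)"
        using lim unfolding F by (rule tendsto_infdist)
      moreover have "(\<lambda>n. infdist (f n \<omega>) (X \<omega>)) \<longlonglongrightarrow> 0"
        by (rule tendsto_sandwich[OF _ _ tendsto_const summable_LIMSEQ_zero[OF geo(1)]])
          (use f(2)[OF \<omega>] infdist_nonneg in \<open>auto intro: always_eventually less_imp_le\<close>)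
      ultimately have "infdist (F \<omega>) (X \<omega>) = 0"
        by (rule LIMSEQ_unique)
      moreover have "closed (X \<omega>)" "X \<omega> \<noteq> {}"
        using X \<omega> by (auto simp: set_valued_rv_def)
      ultimately show ?thesis
        by (simp add: in_closed_iff_infdist_zero)
    qed
    ultimately show "F \<omega> \<in> X \<omega> \<and> dist (F \<omega>) q \<le> infdist q (X \<omega>) + 3 * e"
      by blast
  qed
qed

text \<open>A selection of \<open>X\<close> that is nearly nearest to \<open>q\<close> need not be
  square-integrable, so it is used only where the distance is at most \<open>N\<close> and replaced
  by a given selection \<open>f0\<close> elsewhere; the result also selects from \<open>Y\<close>.
  The same \<open>N\<close> sets the precision, so letting \<open>N\<close> grow removes both
  restrictions.\<close>

lemma selections_subset_infdist_le:
  fixes X Y :: "'a \<Rightarrow> (real^'d) set"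
  assumes X: "set_valued_rv G X"
    and sub: "selections P G 2 X \<subseteq> selections P G 2 Y" and ne: "selections P G 2 X \<noteq> {}"
  shows "AE \<omega> in P. infdist q (Y \<omega>) \<le> infdist q (X \<omega>)"
proof -
  obtain f0 where f0: "f0 \<in> Lp P G 2" "AE \<omega> in P. f0 \<omega> \<in> X \<omega>"
    using ne by (auto simp: selections_def)
  have "AE \<omega> in P. infdist q (X \<omega>) \<le> real N \<longrightarrow> infdist q (Y \<omega>) \<le> infdist q (X \<omega>) + 3 * inverse (real (Suc N))" for N
  proof -
    define e where "e = inverse (real (Suc N))"
    have e: "0 < e" by (simp add: e_def)
    obtain f where f: "f \<in> borel_measurable G"
        "\<And>\<omega>. \<omega> \<in> space G \<Longrightarrow> f \<omega> \<in> X \<omega> \<and> dist (f \<omega>) q \<le> infdist q (X \<omega>) + 3 * e"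
      using selection_near_point[OF X e, of q] by blast
    define D where "D = {\<omega> \<in> space G. infdist q (X \<omega>) \<le> real N}"
    have [measurable]: "(\<lambda>\<omega>. infdist q (X \<omega>)) \<in> borel_measurable G" "f \<in> borel_measurable G"
      using infdist_measurable[OF X] f(1) by auto
    have D: "D \<in> sets G"
      unfolding D_def by measurable
    \<comment> \<open>The value 0 off \<open>D\<close> only serves to make \<open>f1\<close>
      bounded; it is overwritten by \<open>f0\<close> below.\<close>
    define f1 where "f1 \<omega> = (if \<omega> \<in> D then f \<omega> else 0)" for \<omega>
    have f1_meas: "f1 \<in> borel_measurable G"
      using D unfolding f1_def by measurable
    have "norm (f1 \<omega>) \<le> norm q + N + 3 * e" for \<omega>
    proof (cases "\<omega> \<in> D")
      case True
      then have "norm (f \<omega> - q) \<le> N + 3 * e"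
        using f(2)[of \<omega>] by (auto simp: D_def dist_norm)
      then show ?thesis
        using True norm_triangle_ineq[of q "f \<omega> - q"] by (simp add: f1_def)
    qed (use e in \<open>simp add: f1_def\<close>)
    then have "f1 \<in> L2 P"
      by (intro L2_bounded[OF finite_measure_axioms measurable_from_subalg[OF subalg f1_meas]])
    then have "f1 \<in> Lp P G 2"
      using f1_meas by (simp add: Lp_2_iff L2_def)
    then have g: "(\<lambda>\<omega>. if \<omega> \<in> D then f1 \<omega> else f0 \<omega>) \<in> Lp P G 2"
      by (rule Lp_2_if[OF _ f0(1) D])
    have "AE \<omega> in P. (if \<omega> \<in> D then f1 \<omega> else f0 \<omega>) \<in> X \<omega>"
      using f0(2) by eventually_elim (use f(2) in \<open>auto simp: f1_def D_def\<close>)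
    then have "(\<lambda>\<omega>. if \<omega> \<in> D then f1 \<omega> else f0 \<omega>) \<in> selections P G 2 X"
      using g by (simp add: selections_def)
    then have "(\<lambda>\<omega>. if \<omega> \<in> D then f1 \<omega> else f0 \<omega>) \<in> selections P G 2 Y"
      using sub by blast
    then have "AE \<omega> in P. (if \<omega> \<in> D then f1 \<omega> else f0 \<omega>) \<in> Y \<omega>"
      by (simp add: selections_def)
    then show ?thesis
      using AE_space
    proof eventually_elim
      case (elim \<omega>)
      show ?case
      proof
        assume "infdist q (X \<omega>) \<le> real N"
        then have "\<omega> \<in> D"
          using elim by (simp add: D_def space_G)
        then have "f \<omega> \<in> Y \<omega>"
          using elim by (simp add: f1_def)
        then have "infdist q (Y \<omega>) \<le> dist q (f \<omega>)"
          by (rule infdist_le)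
        then show "infdist q (Y \<omega>) \<le> infdist q (X \<omega>) + 3 * inverse (real (Suc N))"
          using f(2)[of \<omega>] elim by (simp add: e_def dist_commute space_G)
      qed
    qed
  qed
  then have "AE \<omega> in P. \<forall>N::nat. infdist q (X \<omega>) \<le> real N \<longrightarrow> infdist q (Y \<omega>) \<le> infdist q (X \<omega>) + 3 * inverse (real (Suc N))"
    by (subst AE_all_countable) auto
  then show ?thesis
  proof eventually_elim
    case (elim \<omega>)
    obtain N0 :: nat where N0: "infdist q (X \<omega>) \<le> real N0"
      using real_arch_simple by blast
    have "(\<lambda>N. infdist q (X \<omega>) + 3 * inverse (real (Suc N))) \<longlonglongrightarrow> infdist q (X \<omega>) + 3 * 0"
      by (intro tendsto_intros LIMSEQ_inverse_real_of_nat)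
    then show ?case
      using elim N0 by (intro LIMSEQ_le_const[of _ "infdist q (X \<omega>)"]) (auto intro!: exI[of _ N0])
  qed
qed

text \<open>A closed set is determined by its distances from a dense sequence, so countably many
  almost sure inequalities suffice.\<close>

lemma selections_eq_imp_AE_eq:
  fixes X Y :: "'a \<Rightarrow> (real^'d) set"
  assumes X: "set_valued_rv G X" and Y: "set_valued_rv G Y"
    and eq: "selections P G 2 X = selections P G 2 Y" and ne: "selections P G 2 X \<noteq> {}"
  shows "AE \<omega> in P. X \<omega> = Y \<omega>"
proof -
  obtain D :: "nat \<Rightarrow> real^'d" where D: "\<And>x e. 0 < e \<Longrightarrow> \<exists>k. dist (D k) x < e"
    using dense_sequence by blast
  have sub: "A \<subseteq> C"
    if "closed C" "C \<noteq> {}" "\<And>k. infdist (D k) C \<le> infdist (D k) A" for A C :: "(real^'d) set"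
  proof
    fix x assume x: "x \<in> A"
    have "infdist x C \<le> 0 + e" if "0 < e" for e
    proof -
      obtain k where k: "dist (D k) x < e / 2"
        using D[of "e / 2" x] \<open>0 < e\<close> by (meson half_gt_zero)
      have "infdist x C \<le> infdist (D k) C + dist x (D k)"
        by (rule infdist_triangle)
      also have "infdist (D k) C \<le> dist (D k) x"
        using \<open>infdist (D k) C \<le> infdist (D k) A\<close> infdist_le[OF x] order_trans by blast
      finally show ?thesis
        using k by (simp add: dist_commute)
    qed
    then have "infdist x C = 0"
      using field_le_epsilon[of "infdist x C" 0] infdist_nonneg[of x C] by auto
    then show "x \<in> C"
      using that by (simp add: in_closed_iff_infdist_zero)
  qed
  have "AE \<omega> in P. \<forall>k. infdist (D k) (Y \<omega>) \<le> infdist (D k) (X \<omega>)"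
    "AE \<omega> in P. \<forall>k. infdist (D k) (X \<omega>) \<le> infdist (D k) (Y \<omega>)"
    using selections_subset_infdist_le[OF X _ ne, of Y] selections_subset_infdist_le[OF Y, of X] eq ne
    by (auto simp: AE_all_countable)
  then show ?thesis
    using AE_space
  proof eventually_elim
    case (elim \<omega>)
    then show ?case
      using sub[of "Y \<omega>" "X \<omega>"] sub[of "X \<omega>" "Y \<omega>"] X Y by (auto simp: set_valued_rv_def space_G)
  qed
qed

lemma closed_dec_hull_subset:
  "V \<subseteq> W \<Longrightarrow> Lp_closed P G 2 W \<Longrightarrow> decomposable G W \<Longrightarrow> closed_dec_hull P G V \<subseteq> W"
  unfolding closed_dec_hull_def by blast

lemma Lp_closure_subset_closed_dec_hull: "Lp_closure P G 2 V \<subseteq> closed_dec_hull P G V"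
proof -
  have "Lp_closure P G 2 V \<subseteq> Lp_closure P G 2 W" if "V \<subseteq> W" for W
    using that unfolding Lp_closure_def by blast
  then show ?thesis
    unfolding closed_dec_hull_def Lp_closed_def by blast
qed

end

section \<open>Martingale selections\<close>

context brownian
begin

lemma set_valued_rv_svrv: "X \<in> p_integrable_svrv P G p \<Longrightarrow> set_valued_rv G X"
  by (simp add: p_integrable_svrv_def)

lemma set_norm_bound:
  assumes "(SUP t\<in>{0..T}. set_norm (M t)) \<le> ereal l" "t \<in> {0..T}" "x \<in> M t"
  shows "norm x \<le> l"
proof -
  have "ereal (norm x) \<le> set_norm (M t)"
    unfolding set_norm_def using assms(3) by (rule SUP_upper)
  also have "\<dots> \<le> (SUP t\<in>{0..T}. set_norm (M t))"
    using assms(2) by (rule SUP_upper)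
  also have "\<dots> \<le> ereal l"
    by (rule assms(1))
  finally show ?thesis by simp
qed

lemma AE_selection_bound:
  assumes "AE \<omega> in P. (SUP t\<in>{0..T}. set_norm (M t \<omega>)) \<le> ereal (l \<omega>)" "\<forall>\<omega>\<in>space P. 0 \<le> l \<omega>"
    and "u \<in> {0..T}" "AE \<omega> in P. f \<omega> \<in> M u \<omega>"
  shows "AE \<omega> in P. norm (f \<omega>) \<le> norm (l \<omega>)"
  using assms(1,4) AE_space
proof eventually_elim
  case (elim \<omega>)
  then show ?case
    using set_norm_bound[of "\<lambda>t. M t \<omega>" "l \<omega>" u "f \<omega>"] assms(2,3) by auto
qed

text \<open>
  Square integrability of a selection comes for free from the bound \<open>l\<close>, so the closure in the mean
  that defines the set-valued conditional expectation becomes a closure in mean square.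
\<close>

lemma selection_in_Lp_closure:
  fixes M :: "real \<Rightarrow> 'a \<Rightarrow> (real^'d) set"
  assumes M: "set_martingale P F T M" and bdd: "unif_sq_int_bounded P T M"
    and tu: "0 \<le> t" "t \<le> u" "u \<le> T" and f: "f \<in> selections P (F u) 2 (M u)"
  shows "f \<in> Lp_closure P (F u) 2 ((\<lambda>p. J_mart P F B t p u) ` R_of P F B T M t)"
proof -
  have u: "0 \<le> u" "u \<le> T"
    using tu by auto
  interpret U: prob_subalgebra P "F u"
    by (rule prob_subalgebra_F[OF u(2)])
  obtain l :: "'a \<Rightarrow> real" where l: "l \<in> L2 P" "\<forall>\<omega>\<in>space P. 0 \<le> l \<omega>"
      "AE \<omega> in P. (SUP t\<in>{0..T}. set_norm (M t \<omega>)) \<le> ereal (l \<omega>)"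
    using bdd unfolding unif_sq_int_bounded_def by (auto simp: Lp_2_iff L2_def)
  note bound = AE_selection_bound[OF l(3,2)]
  have cond: "is_set_cond_exp P (F s) (M T) (M s)" if "0 \<le> s" "s \<le> T" for s
    using M that by (simp add: set_martingale_def)
  \<comment> \<open>A conditional expectation of a selection of \<open>M T\<close> is a generator of
    the closed set that describes \<open>M s\<close>, so it selects from \<open>M s\<close>; the
    bound \<open>l\<close> then makes it square-integrable, although \<open>g\<close> is taken only
    as integrable.\<close>
  have gen: "vec_cond_exp P (F s) g \<in> L2 P" "AE \<omega> in P. vec_cond_exp P (F s) g \<omega> \<in> M s \<omega>"
    if g: "g \<in> selections P P 1 (M T)" and s: "0 \<le> s" "s \<le> T" for g s
  proof -
    interpret S: prob_subalgebra P "F s"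
      by (rule prob_subalgebra_F[OF s(2)])
    have "integrable P (\<lambda>\<omega>. norm (g \<omega>))" "g \<in> borel_measurable P"
      using g by (auto simp: selections_def Lp_1_iff)
    then have "integrable P g"
      by (simp add: integrable_norm_iff)
    then have "vec_cond_exp P (F s) g \<in> Lp P (F s) 1"
      using S.vec_cond_exp_measurable S.vec_cond_exp_integrable by (auto simp: Lp_1_iff)
    then have "vec_cond_exp P (F s) g \<in> Lp_closure P (F s) 1 (vec_cond_exp P (F s) ` selections P P 1 (M T))"
      using g unfolding Lp_closure_def by (auto intro!: bexI[of _ "g"])
    then have "vec_cond_exp P (F s) g \<in> selections P (F s) 1 (M s)"
      using cond[OF s] by (simp add: is_set_cond_exp_def)
    then show *: "AE \<omega> in P. vec_cond_exp P (F s) g \<omega> \<in> M s \<omega>"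
      by (simp add: selections_def)
    show "vec_cond_exp P (F s) g \<in> L2 P"
      using s by (intro L2_dominated[OF S.vec_cond_exp_measurable_P l(1)] bound[of s] *) simp
  qed
  have fL2: "f \<in> L2 P" and f_meas: "f \<in> borel_measurable (F u)" and fM: "AE \<omega> in P. f \<omega> \<in> M u \<omega>"
    using f U.Lp_2_L2 by (auto simp: selections_def Lp_2_iff)
  have "f \<in> selections P (F u) 1 (M u)"
    using f_meas fM L2_integrable[OF finite_measure_axioms fL2] by (simp add: selections_def Lp_1_iff)
  then have "f \<in> Lp_closure P (F u) 1 (vec_cond_exp P (F u) ` selections P P 1 (M T))"
    using cond[OF u] by (simp add: is_set_cond_exp_def)
  then have lim: "\<exists>g\<in>selections P P 1 (M T). (\<integral>\<omega>. norm (f \<omega> - vec_cond_exp P (F u) g \<omega>) \<partial>P) < e" if "0 < e" for e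
    using that by (auto simp: Lp_closure_def)
  have "\<forall>n. \<exists>g. g \<in> selections P P 1 (M T) \<and> (\<integral>\<omega>. norm (f \<omega> - vec_cond_exp P (F u) g \<omega>) \<partial>P) < inverse (real (Suc n))"
    using lim[of "inverse (real (Suc _))"] by fastforce
  then obtain g where g: "\<And>n. g n \<in> selections P P 1 (M T)"
      "\<And>n. (\<integral>\<omega>. norm (f \<omega> - vec_cond_exp P (F u) (g n) \<omega>) \<partial>P) < inverse (real (Suc n))"
    unfolding choice_iff by blast
  define h where "h n = vec_cond_exp P (F u) (g n)" for n
  have h: "h n \<in> L2 P" "AE \<omega> in P. h n \<omega> \<in> M u \<omega>" for n
    unfolding h_def using gen[OF g(1) u] by auto
  have "(\<lambda>n. \<integral>\<omega>. norm (f \<omega> - h n \<omega>) \<partial>P) \<longlonglongrightarrow> 0"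
    by (rule tendsto_sandwich[OF _ _ tendsto_const LIMSEQ_inverse_real_of_nat])
      (use g(2) in \<open>auto simp: h_def intro: always_eventually less_imp_le\<close>)
  \<comment> \<open>Convergence in the mean gives an almost surely convergent subsequence, and
    domination by \<open>l\<close> upgrades this to mean-square convergence.\<close>
  then obtain r :: "nat \<Rightarrow> nat" where r: "AE \<omega> in P. (\<lambda>n. f \<omega> - h (r n) \<omega>) \<longlonglongrightarrow> 0"
    using tendsto_L1_AE_subseq[of P "\<lambda>n \<omega>. f \<omega> - h n \<omega>"] L2_integrable[OF finite_measure_axioms L2_diff[OF fL2 h(1)]]
    by blast
  have "(\<lambda>n. msq P (\<lambda>\<omega>. h (r n) \<omega> - f \<omega>)) \<longlonglongrightarrow> 0"
  proof (rule L2_dominated_convergence[OF L2_measurable[OF h(1)] L2_measurable[OF fL2] l(1)])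
    show "AE \<omega> in P. (\<lambda>n. h (r n) \<omega>) \<longlonglongrightarrow> f \<omega>"
      using r
    proof eventually_elim
      case (elim \<omega>)
      from tendsto_diff[OF tendsto_const[of "f \<omega>"] elim] show ?case
        by simp
    qed
  qed (use bound u h(2) fM in auto)
  then have "\<exists>n. msq P (\<lambda>\<omega>. h (r n) \<omega> - f \<omega>) < e" if "0 < e" for e
    using LIMSEQ_D[OF _ that] by fastforce
  then have h_lim: "\<exists>n. msq P (\<lambda>\<omega>. f \<omega> - h n \<omega>) < e" if "0 < e" for e
    using that msq_minus_commute[of P f] by metis
  have J: "\<exists>p\<in>R_of P F B T M t. AE \<omega> in P. J_mart P F B t p u \<omega> = h n \<omega>" for n
  proof -
    have gn: "integrable P (g n)"
      using g(1)[of n] by (auto simp: selections_def Lp_1_iff integrable_norm_iff)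
    \<comment> \<open>\<open>g n\<close> is known to be measurable for \<open>P\<close> only, while
      the representation requires an \<open>F T\<close>-measurable terminal value. By the tower
      property, passing to \<open>X\<close> leaves the conditional expectations given
      \<open>F s\<close> unchanged up to null sets.\<close>
    define X where "X = vec_cond_exp P (F T) (g n)"
    have XL2: "X \<in> L2 P"
      unfolding X_def using T_pos by (intro gen(1)[OF g(1)]) auto
    interpret TT: prob_subalgebra P "F T"
      by (rule prob_subalgebra_F[OF order_refl])
    have X: "X \<in> Lp P (F T) 2"
      using XL2 TT.vec_cond_exp_measurable by (simp add: Lp_2_iff L2_def X_def)
    have cX: "AE \<omega> in P. vec_cond_exp P (F s) X \<omega> = vec_cond_exp P (F s) (g n) \<omega>" if "s \<le> T" for s
    proof -
      interpret S: prob_subalgebra P "F s"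
        by (rule prob_subalgebra_F[OF that])
      show ?thesis
        unfolding X_def by (rule S.vec_cond_exp_nested[OF subalgebra_F[OF order_refl] subalgebra_F_F[OF that] gn])
    qed
    have "t \<le> T"
      using tu by simp
    then obtain p where p: "p \<in> R_space P F T t"
        "\<And>s. 0 \<le> s \<Longrightarrow> s \<le> T \<Longrightarrow> J_mart P F B t p s \<in> Lp P (F s) 2"
        "\<And>s. 0 \<le> s \<Longrightarrow> s \<le> T \<Longrightarrow> AE \<omega> in P. J_mart P F B t p s \<omega> = vec_cond_exp P (F s) X \<omega>"
      using J_mart_representation[OF X tu(1)] by blast
    have "J_mart P F B t p \<in> sq_int_martingales P F T"
      unfolding sq_int_martingales_def
    proof (intro CollectI conjI ballI allI impI)
      fix s assume "s \<in> {0..T}"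
      then show "J_mart P F B t p s \<in> Lp P (F s) 2"
        by (intro p(2)) auto
    next
      fix s v assume sv: "0 \<le> s \<and> s \<le> v \<and> v \<le> T"
      then have s: "0 \<le> s" "s \<le> T" and v: "0 \<le> v" "v \<le> T" "s \<le> v"
        by auto
      interpret S: prob_subalgebra P "F s"
        by (rule prob_subalgebra_F[OF s(2)])
      have "AE \<omega> in P. vec_cond_exp P (F s) (J_mart P F B t p v) \<omega> = vec_cond_exp P (F s) (vec_cond_exp P (F v) X) \<omega>"
        using p(2)[OF v(1,2)] measurable_F_P[OF _ v(2)]
        by (intro S.vec_cond_exp_cong p(3) v L2_measurable[OF vec_cond_exp_L2_F(1)[OF XL2 v(2)]])
          (auto simp: Lp_2_iff)
      moreover have "AE \<omega> in P. vec_cond_exp P (F s) (vec_cond_exp P (F v) X) \<omega> = vec_cond_exp P (F s) X \<omega>"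
        by (intro S.vec_cond_exp_nested subalgebra_F subalgebra_F_F v L2_integrable[OF finite_measure_axioms XL2])
      ultimately show "AE \<omega> in P. vec_cond_exp P (F s) (J_mart P F B t p v) \<omega> = J_mart P F B t p s \<omega>"
        using p(3)[OF s] by eventually_elim simp
    qed
    moreover have "J_mart P F B t p s \<in> selections P (F s) 2 (M s)" if "s \<in> {0..T}" for s
    proof -
      have s: "0 \<le> s" "s \<le> T"
        using that by auto
      have "AE \<omega> in P. J_mart P F B t p s \<omega> \<in> M s \<omega>"
        using p(3)[OF s] cX[OF s(2)] gen(2)[OF g(1) s] by eventually_elim simp
      then show ?thesis
        using p(2)[OF s] by (simp add: selections_def)
    qed
    ultimately have "p \<in> R_of P F B T M t"
      using p(1) by (simp add: R_of_def martingale_selections_def)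
    moreover have "AE \<omega> in P. J_mart P F B t p u \<omega> = h n \<omega>"
      using p(3)[OF u] cX[OF u(2)] unfolding h_def by eventually_elim simp
    ultimately show ?thesis
      by blast
  qed
  show ?thesis
    unfolding U.Lp_closure_2_iff
  proof (intro conjI allI impI)
    show "f \<in> Lp P (F u) 2"
      using f by (simp add: selections_def)
    fix e :: real assume "0 < e"
    then obtain n where n: "msq P (\<lambda>\<omega>. f \<omega> - h n \<omega>) < e"
      using h_lim by blast
    obtain p where p: "p \<in> R_of P F B T M t" "AE \<omega> in P. J_mart P F B t p u \<omega> = h n \<omega>"
      using J by blast
    have "J_mart P F B t p u \<in> Lp P (F u) 2"
      using p(1) u by (simp add: R_of_def martingale_selections_def sq_int_martingales_def)
    then have "msq P (\<lambda>\<omega>. f \<omega> - J_mart P F B t p u \<omega>) = msq P (\<lambda>\<omega>. f \<omega> - h n \<omega>)"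
      using p(2) by (intro msq_cong_AE borel_measurable_diff L2_measurable fL2 h(1) U.Lp_2_L2)
        (auto elim!: eventually_mono)
    then show "\<exists>g\<in>(\<lambda>p. J_mart P F B t p u) ` R_of P F B T M t. msq P (\<lambda>\<omega>. f \<omega> - g \<omega>) < e"
      using n by (intro bexI[OF _ imageI[OF p(1)]]) simp
  qed
qed

lemma selections_eq_closed_dec_hull:
  fixes M :: "real \<Rightarrow> 'a \<Rightarrow> (real^'d) set"
  assumes M: "set_martingale P F T M" and bdd: "unif_sq_int_bounded P T M"
    and tu: "0 \<le> t" "t \<le> u" "u \<le> T"
  shows "selections P (F u) 2 (M u)
    = closed_dec_hull P (F u) ((\<lambda>p. J_mart P F B t p u) ` R_of P F B T M t)"
proof -
  interpret U: prob_subalgebra P "F u"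
    by (rule prob_subalgebra_F[OF tu(3)])
  have "M u \<in> p_integrable_svrv P (F u) 1"
    using M tu by (simp add: set_martingale_def)
  then have X: "set_valued_rv (F u) (M u)"
    by (rule set_valued_rv_svrv)
  have "(\<lambda>p. J_mart P F B t p u) ` R_of P F B T M t \<subseteq> selections P (F u) 2 (M u)"
    using tu by (auto simp: R_of_def martingale_selections_def)
  then have "closed_dec_hull P (F u) ((\<lambda>p. J_mart P F B t p u) ` R_of P F B T M t) \<subseteq> selections P (F u) 2 (M u)"
    by (intro U.closed_dec_hull_subset U.selections_closed X U.selections_decomposable)
  moreover have "selections P (F u) 2 (M u) \<subseteq> closed_dec_hull P (F u) ((\<lambda>p. J_mart P F B t p u) ` R_of P F B T M t)"
    using selection_in_Lp_closure[OF M bdd tu] U.Lp_closure_subset_closed_dec_hull by blast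
  ultimately show ?thesis
    by blast
qed

text \<open>The bound dominates every integrable selection, so a square-integrable one exists. This
  is the membership demanded of a version of the set-valued integral.\<close>

lemma set_martingale_svrv_2:
  fixes M :: "real \<Rightarrow> 'a \<Rightarrow> (real^'d) set"
  assumes M: "set_martingale P F T M" and bdd: "unif_sq_int_bounded P T M" and u: "0 \<le> u" "u \<le> T"
  shows "M u \<in> p_integrable_svrv P (F u) 2"
proof -
  have Mu: "M u \<in> p_integrable_svrv P (F u) 1"
    using M u by (simp add: set_martingale_def)
  then obtain f where f: "f \<in> borel_measurable (F u)" "AE \<omega> in P. f \<omega> \<in> M u \<omega>"
    by (auto simp: p_integrable_svrv_def selections_def Lp_1_iff)
  obtain l :: "'a \<Rightarrow> real" where l: "l \<in> L2 P" "\<forall>\<omega>\<in>space P. 0 \<le> l \<omega>"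
      "AE \<omega> in P. (SUP t\<in>{0..T}. set_norm (M t \<omega>)) \<le> ereal (l \<omega>)"
    using bdd unfolding unif_sq_int_bounded_def by (auto simp: Lp_2_iff L2_def)
  have "f \<in> L2 P"
    using u by (intro L2_dominated[OF measurable_F_P[OF f(1) u(2)] l(1)]
      AE_selection_bound[OF l(3,2) _ f(2)]) simp
  then have "f \<in> selections P (F u) 2 (M u)"
    using f by (simp add: selections_def Lp_2_iff L2_def)
  then show ?thesis
    using set_valued_rv_svrv[OF Mu] by (auto simp: p_integrable_svrv_def)
qed

lemma set_martingale_eq_set_stoch_integral:
  fixes M :: "real \<Rightarrow> 'a \<Rightarrow> (real^'d) set"
  assumes M: "set_martingale P F T M" and bdd: "unif_sq_int_bounded P T M" and u: "0 \<le> u" "u \<le> T"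
  shows "AE \<omega> in P. M u \<omega> = set_stoch_integral P F B (R_of P F B T M 0) u \<omega>"
proof -
  interpret U: prob_subalgebra P "F u"
    by (rule prob_subalgebra_F[OF u(2)])
  let ?V = "closed_dec_hull P (F u) ((\<lambda>p. J_mart P F B 0 p u) ` R_of P F B T M 0)"
  let ?Y = "set_stoch_integral P F B (R_of P F B T M 0) u"
  have Mu: "M u \<in> p_integrable_svrv P (F u) 2 \<and> selections P (F u) 2 (M u) = ?V"
    using set_martingale_svrv_2[OF M bdd u] selections_eq_closed_dec_hull[OF M bdd order_refl u] by blast
  \<comment> \<open>\<open>M u\<close> itself witnesses that the choice in
    \<open>set_stoch_integral\<close> can be made.\<close>
  then have Y: "?Y \<in> p_integrable_svrv P (F u) 2 \<and> selections P (F u) 2 ?Y = ?V"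
    unfolding set_stoch_integral_def
    by (rule someI[of "\<lambda>X. X \<in> p_integrable_svrv P (F u) 2 \<and> selections P (F u) 2 X = ?V"])
  show ?thesis
    using Mu Y by (intro U.selections_eq_imp_AE_eq) (auto simp: p_integrable_svrv_def)
qed

end

theorem theorem5p6:
  fixes P :: "'a measure" and T :: real
    and B :: "real \<Rightarrow> 'a \<Rightarrow> real^'m"
    and F :: "real \<Rightarrow> 'a measure"
    and M :: "real \<Rightarrow> 'a \<Rightarrow> (real^'d) set"
  assumes "prob_space P" and "complete_measure P" and "T > 0"
    and "brownian_motion P T B"
    and "F = augmented_filtration P B"
    and "set_martingale P F T M"
    and "\<forall>t\<in>{0..T}. AE \<omega> in P. convex (M t \<omega>)"
    and "unif_sq_int_bounded P T M"
  shows "\<forall>u\<in>{0..T}.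
    (AE \<omega> in P. M u \<omega> = set_stoch_integral P F B (R_of P F B T M 0) u \<omega>) \<and>
    (\<forall>t\<in>{0..u}. selections P (F u) 2 (M u)
       = closed_dec_hull P (F u) ((\<lambda>p. J_mart P F B t p u) ` R_of P F B T M t))"
proof -
  interpret brownian P T B F
    by (intro brownian.intro brownian_axioms.intro assms)
  show ?thesis
    using set_martingale_eq_set_stoch_integral[OF assms(6,8)]
      selections_eq_closed_dec_hull[OF assms(6,8)] by auto
qed

end
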